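(* Let $\mathcal{T}$ be a notion of total curvature of graphs in $\mathbb{R}^3$, as described in the context. A continuous graph $\Gamma\subset\mathbb{R}^3$ of finite total curvature, $\mathcal{T}(\Gamma)<\infty$, is tame.
   Context: A (continuous, finite) graph $\Gamma\subset\mathbb{R}^3$ is connected and consists of finitely many points (vertices) and finitely many continuous simple arcs (edges), each having two of the vertices as endpoints, disjoint from one another except at common endpoint vertices. The valence $d(q)$ of a vertex $q$ is the number of edges having $q$ as an endpoint; the topological vertices are those of valence $\ne 2$. A graph in $\mathbb{R}^3$ is tame if it is isotopic in $\mathbb{R}^3$ (ambient isotopic: by an isotopy of $\mathbb{R}^3$ starting at the identity) to a polyhedral graph, i.e. a graph whose edges consist of finitely many straight line segments. A polygonal graph $P$ (a graph whose edges are straight line segments) is called $\Gamma$-approximating if its topological vertices are exactly the topological vertices of $\Gamma$, with the same valences, and an arc of $P$ between two topological vertices corresponds one-to-one to each edge of $\Gamma$ between those two vertices, the vertices of valence 2 of that arc lying, in order, along the corresponding edge of $\Gamma$. A notion of total curvature $\mathcal{T}$ means any definition which includes the total curvature of the edges and whose contribution at each vertex is a continuous function of the unit tangent vectors there. Precisely: for each $d\geq 1$ a continuous symmetric function $c_d:(S^2)^d\to\mathbb{R}$ is given, with $c_2(T_1,T_2)=\arccos\langle T_1,-T_2\rangle$ (the exterior angle); for a polygonal graph $P$, $\mathcal{T}(P)=\sum_q c_{d(q)}(T_1(q),\dots,T_{d(q)}(q))$, the sum over all vertices $q$ of $P$ (including those of valence 2), where $T_1(q),\dots,T_{d(q)}(q)$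 are the unit tangent vectors at $q$ pointing into the edges of $P$ at $q$; and for a continuous graph, $\mathcal{T}(\Gamma)=\sup_P\mathcal{T}(P)$ over all $\Gamma$-approximating polygonal graphs $P$. This includes: (1) net total curvature, with $c_d=\frac14\int_{S^2}\big[\sum_{i=1}^d\chi_i(e)\big]^+dA_{S^2}(e)$, where $\chi_i(e)=-1$ if $\langle e,T_i\rangle>0$, $\chi_i(e)=+1$ if $\langle e,T_i\rangle<0$, and $[x]^+=\max(x,0)$; (2) maximal total curvature, with $c_d=\sum_{1\le i<j\le d}\arccos\langle T_i,-T_j\rangle$; (3) cone total curvature, with $c_d=\sup_{e\in S^2}\sum_{i=1}^d\big(\frac{\pi}{2}-\arccos\langle T_i,e\rangle\big)$. *)

theory Defs
  imports "HOL-Analysis.Analysis"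
begin

section \<open>Continuous graphs in three-space\<close>

text \<open>An edge is represented by its point set, so parallel edges are distinct sets.\<close>

record space_graph =
  verts :: "(real^3) set"
  edges :: "(real^3) set set"

definition support :: "space_graph \<Rightarrow> (real^3) set" where
  "support \<Gamma> = verts \<Gamma> \<union> \<Union> (edges \<Gamma>)"

definition simple_arc :: "(real^3) set \<Rightarrow> bool" where
  "simple_arc A \<longleftrightarrow> (\<exists>g. arc g \<and> path_image g = A)"

definition endpoints :: "(real^3) set \<Rightarrow> (real^3) set" where
  "endpoints A = {q. \<exists>g. arc g \<and> path_image g = A \<and> (q = pathstart g \<or> q = pathfinish g)}"

text \<open>
  The equation \<open>A \<inter> verts \<Gamma> = endpoints A\<close> says that both endpoints of an edge are vertices and
  that no vertex lies in the relative interior of an edge. Since an arc has two distinct endpoints,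
  a loop has to be subdivided by vertices of valence two.
\<close>

definition continuous_graph :: "space_graph \<Rightarrow> bool" where
  "continuous_graph \<Gamma> \<longleftrightarrow>
     finite (verts \<Gamma>) \<and> verts \<Gamma> \<noteq> {} \<and> finite (edges \<Gamma>) \<and>
     (\<forall>A\<in>edges \<Gamma>. simple_arc A \<and> A \<inter> verts \<Gamma> = endpoints A) \<and>
     (\<forall>A\<in>edges \<Gamma>. \<forall>B\<in>edges \<Gamma>. A \<noteq> B \<longrightarrow> A \<inter> B \<subseteq> endpoints A \<inter> endpoints B) \<and>
     connected (support \<Gamma>)"

definition edges_at :: "space_graph \<Rightarrow> real^3 \<Rightarrow> (real^3) set set" where
  "edges_at \<Gamma> q = {A \<in> edges \<Gamma>. q \<in> endpoints A}"

definition valence :: "space_graph \<Rightarrow> real^3 \<Rightarrow> nat" where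
  "valence \<Gamma> q = card (edges_at \<Gamma> q)"

definition topological_verts :: "space_graph \<Rightarrow> (real^3) set" where
  "topological_verts \<Gamma> = {q \<in> verts \<Gamma>. valence \<Gamma> q \<noteq> 2}"

section \<open>Tameness\<close>

definition polyhedral_graph :: "space_graph \<Rightarrow> bool" where
  "polyhedral_graph Q \<longleftrightarrow>
     continuous_graph Q \<and>
     (\<forall>A\<in>edges Q. \<exists>S. finite S \<and> (\<forall>s\<in>S. \<exists>a b. s = closed_segment a b) \<and> A = \<Union>S)"

definition ambient_isotopy :: "(real \<Rightarrow> real^3 \<Rightarrow> real^3) \<Rightarrow> bool" where
  "ambient_isotopy H \<longleftrightarrow>
     continuous_on ({0..1} \<times> UNIV) (\<lambda>(t, x). H t x) \<and>
     (\<forall>x. H 0 x = x) \<and>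
     (\<forall>t\<in>{0..1}. \<exists>K. homeomorphism UNIV UNIV (H t) K)"

definition isotopic :: "space_graph \<Rightarrow> space_graph \<Rightarrow> bool" where
  "isotopic \<Gamma> Q \<longleftrightarrow>
     (\<exists>H. ambient_isotopy H \<and> verts Q = H 1 ` verts \<Gamma> \<and> edges Q = (\<lambda>A. H 1 ` A) ` edges \<Gamma>)"

definition tame :: "space_graph \<Rightarrow> bool" where
  "tame \<Gamma> \<longleftrightarrow> (\<exists>Q. polyhedral_graph Q \<and> isotopic \<Gamma> Q)"

section \<open>Approximating polygonal graphs\<close>

definition polygonal_graph :: "space_graph \<Rightarrow> bool" where
  "polygonal_graph P \<longleftrightarrow>
     continuous_graph P \<and> (\<forall>A\<in>edges P. \<exists>a b. A = closed_segment a b)"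

text \<open>
  A parametrization of an arc of the graph running between topological vertices, all vertices in its
  interior having valence two. It is closed if it starts and ends at the same topological vertex. If
  there are no topological vertices, the graph is a simple closed curve, which then counts as a
  single closed arc, with arbitrary starting point.
\<close>

definition topological_edge_path :: "space_graph \<Rightarrow> (real \<Rightarrow> real^3) \<Rightarrow> bool" where
  "topological_edge_path \<Gamma> g \<longleftrightarrow>
     simple_path g \<and> path_image g \<subseteq> support \<Gamma> \<and>
     g ` {0<..<1} \<inter> topological_verts \<Gamma> = {} \<and>
     (if topological_verts \<Gamma> = {} then pathfinish g = pathstart g
      else {pathstart g, pathfinish g} \<subseteq> topological_verts \<Gamma>)"

definition topological_edges :: "space_graph \<Rightarrow> (real^3) set set" where
  "topological_edges \<Gamma> = {path_image g | g. topological_edge_path \<Gamma> g}"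

text \<open>
  The last clause below says that the vertices of \<open>P\<close> on the arc \<open>\<phi> A\<close> lie on \<open>A\<close> in the same order
  (up to reparametrization, they are passed at the same times). It includes the end points of
  the arc, so \<open>A\<close> and \<open>\<phi> A\<close> join the same topological vertices.
\<close>

definition approximating :: "space_graph \<Rightarrow> space_graph \<Rightarrow> bool" where
  "approximating \<Gamma> P \<longleftrightarrow>
     polygonal_graph P \<and>
     topological_verts P = topological_verts \<Gamma> \<and>
     (\<forall>q\<in>topological_verts \<Gamma>. valence P q = valence \<Gamma> q) \<and>
     (\<exists>\<phi>. bij_betw \<phi> (topological_edges \<Gamma>) (topological_edges P) \<and>
        (\<forall>A\<in>topological_edges \<Gamma>. \<exists>g h.
           topological_edge_path \<Gamma> g \<and> path_image g = A \<and>
           topological_edge_path P h \<and> path_image h = \<phi> A \<and>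
           (\<forall>t\<in>{0..1}. h t \<in> verts P \<longrightarrow> g t = h t)))"

section \<open>Notions of total curvature\<close>

text \<open>
  \<open>(S\<^sup>2)\<^sup>d\<close> as a set of extensional functions on \<open>{..<d}\<close>; the topology induced from
  the function space is the product topology.
\<close>

definition sphere_tuples :: "nat \<Rightarrow> (nat \<Rightarrow> real^3) set" where
  "sphere_tuples d = (\<Pi>\<^sub>E i\<in>{..<d}. sphere 0 1)"

definition curvature_notion :: "(nat \<Rightarrow> (nat \<Rightarrow> real^3) \<Rightarrow> real) \<Rightarrow> bool" where
  "curvature_notion c \<longleftrightarrow>
     (\<forall>d\<ge>1. continuous_on (sphere_tuples d) (c d)) \<and>
     (\<forall>d\<ge>1. \<forall>T\<in>sphere_tuples d. \<forall>\<pi>. \<pi> permutes {..<d} \<longrightarrow> c d (T \<circ> \<pi>) = c d T) \<and>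
     (\<forall>T\<in>sphere_tuples 2. c 2 T = arccos (T 0 \<bullet> (- T 1)))"

definition unit_tangent :: "real^3 \<Rightarrow> (real^3) set \<Rightarrow> real^3" where
  "unit_tangent q A = (THE v. \<exists>b. A = closed_segment q b \<and> v = sgn (b - q))"

text \<open>
  By symmetry the value does not depend on the chosen enumeration of the edges at \<open>q\<close>. Valence
  zero occurs only for a one-point graph, to which \<open>c 0\<close> assigns an arbitrary real number.
\<close>

definition vertex_curvature ::
    "(nat \<Rightarrow> (nat \<Rightarrow> real^3) \<Rightarrow> real) \<Rightarrow> space_graph \<Rightarrow> real^3 \<Rightarrow> real" where
  "vertex_curvature c P q =
     (let d = valence P q; f = (SOME f. bij_betw f {..<d} (edges_at P q))
      in c d (\<lambda>i\<in>{..<d}. unit_tangent q (f i)))"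

definition polygonal_curvature ::
    "(nat \<Rightarrow> (nat \<Rightarrow> real^3) \<Rightarrow> real) \<Rightarrow> space_graph \<Rightarrow> real" where
  "polygonal_curvature c P = (\<Sum>q\<in>verts P. vertex_curvature c P q)"

definition total_curvature ::
    "(nat \<Rightarrow> (nat \<Rightarrow> real^3) \<Rightarrow> real) \<Rightarrow> space_graph \<Rightarrow> ereal" where
  "total_curvature c \<Gamma> = (SUP P\<in>{P. approximating \<Gamma> P}. ereal (polygonal_curvature c P))"

end

theory Submission
  imports Defs
begin

text \<open>
  Crossing chords of an arc can be avoided by taking a chain of points with the fewest steps of
  length at most \<open>\<delta>\<close>, and cones of chords near the vertices; this yields embedded
  approximating graphs of arbitrarily small mesh. Vertex contributions are bounded by compactness,
  so finite total curvature bounds the turning of these polygons. Hence each edge splits into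
  finitely many arcs whose chords pairwise make an angle of at most \<open>\<pi>/3\<close>: infinitely
  many disjoint subarcs violating this would each cost a fixed amount of turning. Such an arc moves
  monotonically away from both of its end points and is a graph over a line. Near a vertex the
  edges therefore meet every small sphere once, and a homeomorphism preserving these spheres
  straightens them, however often they wind around each other; away from the vertices a shear along
  the planes orthogonal to the line makes the edge polygonal. A homeomorphism of space that moves
  points by a bounded amount is the end of an ambient isotopy, by Alexander's trick.
\<close>

section \<open>Homeomorphisms at bounded distance from the identity\<close>

text \<open>The supremum counts embedded polygons only, so a bound on turning is known for some
  polygon of each small mesh, not for every inscribed one. Estimates of turning are therefore made
  for an arbitrary chain of sufficiently small mesh. The constant \<pi>/3 comes from two unit
  vectors at distance at most 1. The condition |v| |w| \<le> 2 <v,w> is closed under limits and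
  passes to sums of vectors, hence from the sides of polygons to the chords of an arc. The main
  obstacle is a vertex where several edges share a tangent: no small perturbation there is visibly
  an isotopy. Working on concentric spheres turns the edges into a braid over the radius, and maps
  that preserve the spheres are continuous at the centre no matter how wildly they rotate. All
  homeomorphisms are built as continuous injections with bounded displacement. This class is stable
  under composition and under combination of disjoint supports, and surjectivity and continuity of
  the inverse follow from invariance of domain.\<close>

definition bounded_embedding :: "('a::euclidean_space \<Rightarrow> 'a) \<Rightarrow> bool" where
  "bounded_embedding h \<longleftrightarrow> continuous_on UNIV h \<and> inj h \<and> (\<exists>C. \<forall>x. norm (h x -
      x) \<le> C)"

text \<open>The displacement bound makes \<open>h\<close> proper: preimages of points near
  \<open>y\<close> stay in a fixed ball about \<open>y\<close>. So the range is closed, while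
  invariance of domain makes it open.\<close>

lemma bounded_embedding_surj:
  assumes "bounded_embedding h"
  shows "surj h"
proof -
  obtain C where C: "\<And>x. norm (h x - x) \<le> C" and cont: "continuous_on UNIV h" and inj: "inj h"
    using assms unfolding bounded_embedding_def by blast
  have "closed (range h)"
  proof -
    have "y \<in> range h" if y: "y \<in> closure (range h)" for y
    proof -
      let ?K = "h ` cball y (C + 1)"
      have sub: "ball y 1 \<inter> range h \<subseteq> ?K"
      proof
        fix z assume "z \<in> ball y 1 \<inter> range h"
        then obtain x where x: "z = h x" "dist y (h x) < 1" by auto
        have "dist y x \<le> dist y (h x) + dist (h x) x" by (rule dist_triangle)
        then have "dist y x \<le> C + 1" using x C[of x] by (simp add: dist_norm)
        then show "z \<in> ?K" using x by auto
      qed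
      have "closed ?K"
        by (intro compact_imp_closed compact_continuous_image continuous_on_subset[OF cont]) auto
      then have "closure (ball y 1 \<inter> range h) \<subseteq> ?K" using sub by (rule closure_minimal[rotated])
      moreover have "y \<in> closure (ball y 1 \<inter> range h)"
        using y open_Int_closure_subset[of "ball y 1" "range h"] by auto
      ultimately show ?thesis by auto
    qed
    then show ?thesis using closure_subset_eq by blast
  qed
  moreover have "open (range h)" using invariance_of_domain[OF cont open_UNIV inj] .
  ultimately show ?thesis using clopen[of "range h"] by auto
qed

lemma bounded_embedding_homeomorphism:
  assumes "bounded_embedding h"
  shows "\<exists>k. homeomorphism UNIV UNIV h k"
proof -
  have "continuous_on UNIV h" "inj h" using assms unfolding bounded_embedding_def by auto
  then obtain k where "homeomorphism UNIV (range h) h k"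
    using invariance_of_domain_homeomorphism[of UNIV h] by auto
  then show ?thesis using bounded_embedding_surj[OF assms] by auto
qed

lemma bounded_embedding_id: "bounded_embedding (\<lambda>x. x)"
  unfolding bounded_embedding_def by (auto intro!: exI[of _ 0])

lemma bounded_embedding_comp:
  assumes "bounded_embedding h" "bounded_embedding k"
  shows "bounded_embedding (\<lambda>x. k (h x))"
proof -
  obtain C D where C: "\<And>x. norm (h x - x) \<le> C" and D: "\<And>x. norm (k x - x) \<le> D"
    using assms unfolding bounded_embedding_def by metis
  have "norm (k (h x) - x) \<le> D + C" for x
    using norm_triangle_mono[OF D[of "h x"] C[of x]] by simp
  moreover have "continuous_on UNIV (\<lambda>x. k (h x))"
    by (rule continuous_on_compose2[where t = UNIV and g = k and f = h])
       (use assms in \<open>simp_all add: bounded_embedding_def\<close>)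
  moreover have "inj (\<lambda>x. k (h x))"
    using assms unfolding bounded_embedding_def inj_def by metis
  ultimately show ?thesis unfolding bounded_embedding_def by blast
qed

text \<open>The Alexander trick, performed on all of space: conjugating with shrinking dilations.\<close>

lemma bounded_embedding_ambient_isotopy:
  fixes h :: "real^3 \<Rightarrow> real^3"
  assumes "bounded_embedding h"
  shows "\<exists>H. ambient_isotopy H \<and> H 1 = h"
proof -
  define H where "H t x = (if t = 0 then x else t *\<^sub>R h ((1/t) *\<^sub>R x))" for t :: real and x :: "real^3"
  obtain C where C: "\<And>x. norm (h x - x) \<le> C" and cont: "continuous_on UNIV h" and inj: "inj h"
    using assms unfolding bounded_embedding_def by blast
  have C0: "0 \<le> C" using C[of 0] norm_ge_zero order_trans by blast
  \<comment> \<open>Conjugation with the dilation by \<open>t\<close> scales displacements by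
    \<open>t\<close>; this uniform bound yields continuity at \<open>t = 0\<close>.\<close>
  have displ: "norm (H t x - x) \<le> \<bar>t\<bar> * C" for t x
  proof (cases "t = 0")
    case False
    then have "H t x - x = t *\<^sub>R (h ((1/t) *\<^sub>R x) - (1/t) *\<^sub>R x)"
      by (simp add: H_def scaleR_diff_right)
    then show ?thesis using C by (simp add: mult_left_mono)
  qed (simp add: H_def C0)
  have cont_pos: "continuous_on ({0<..} \<times> UNIV) (\<lambda>(t, x). H t x)"
  proof -
    have "continuous_on ({0<..} \<times> UNIV) (\<lambda>z. fst z *\<^sub>R h ((1/fst z) *\<^sub>R snd z))"
      by (intro continuous_intros continuous_on_compose2[OF cont]) auto
    then show ?thesis
      by (rule continuous_on_eq) (auto simp: H_def)
  qed
  have "continuous_on ({0..1} \<times> UNIV) (\<lambda>(t, x). H t x)"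
    unfolding continuous_on_eq_continuous_within
  proof
    fix z :: "real \<times> (real^3)" assume z: "z \<in> {0..1} \<times> UNIV"
    obtain s y where zz: "z = (s, y)" by force
    show "continuous (at z within {0..1} \<times> UNIV) (\<lambda>(t, x). H t x)"
    proof (cases "s = 0")
      case False
      then have "z \<in> {0<..} \<times> UNIV" using z zz by auto
      moreover have "open ({0<..} \<times> UNIV :: (real \<times> (real^3)) set)" by (intro open_Times) auto
      ultimately have "continuous (at z) (\<lambda>(t, x). H t x)"
        using cont_pos continuous_on_eq_continuous_at by blast
      then show ?thesis using continuous_at_imp_continuous_at_within by blast
    next
      case True
      have "((\<lambda>w. H (fst w) (snd w) - snd w) \<longlongrightarrow> 0) (at z within {0..1} \<times> UNIV)"
      proof (rule Lim_null_comparison)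
        show "\<forall>\<^sub>F w in at z within {0..1} \<times> UNIV. norm (H (fst w) (snd w) - snd w) \<le> \<bar>fst
            w\<bar> * C"
          by (simp add: displ)
        have "((\<lambda>w. \<bar>fst w\<bar> * C) \<longlongrightarrow> \<bar>fst z\<bar> * C) (at z within {0..1} \<times>
            UNIV)"
          by (intro tendsto_intros)
        then show "((\<lambda>w. \<bar>fst w\<bar> * C) \<longlongrightarrow> 0) (at z within {0..1} \<times> UNIV)"
          using True zz by simp
      qed
      moreover have "((\<lambda>w. snd w) \<longlongrightarrow> snd z) (at z within {0..1} \<times> UNIV)"
        by (intro tendsto_intros)
      ultimately have "((\<lambda>w. (H (fst w) (snd w) - snd w) + snd w) \<longlongrightarrow> 0 + snd z) (at z within
          {0..1} \<times> UNIV)"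
        by (rule tendsto_add)
      then show ?thesis using True zz by (simp add: continuous_within H_def split_def)
    qed
  qed
  moreover have "\<exists>K. homeomorphism UNIV UNIV (H t) K" if "t \<in> {0..1}" for t
  proof (rule bounded_embedding_homeomorphism, cases "t = 0")
    case True
    then have "H t = (\<lambda>x. x)" by (auto simp: H_def)
    then show "bounded_embedding (H t)" using bounded_embedding_id by simp
  next
    case False
    have Ht: "H t = (\<lambda>x. t *\<^sub>R h ((1/t) *\<^sub>R x))" using False by (auto simp: H_def)
    have "continuous_on UNIV (H t)" unfolding Ht
      by (intro continuous_intros continuous_on_compose2[OF cont]) auto
    moreover have "inj (H t)" using False by (auto simp: Ht dest!: injD[OF inj] intro!: injI)
    ultimately show "bounded_embedding (H t)" unfolding bounded_embedding_def using displ by blast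
  qed
  moreover have "H 0 x = x" for x by (simp add: H_def)
  ultimately have "ambient_isotopy H" unfolding ambient_isotopy_def by blast
  moreover have "H 1 = h" by (auto simp: H_def)
  ultimately show ?thesis by blast
qed

text \<open>Homeomorphisms with disjoint supports are performed at once. Writing the result as the
  identity plus the sum of all displacements gives continuity without gluing along the boundaries of
  the \<open>K i\<close>.\<close>

lemma bounded_embedding_disjoint_sum:
  fixes h :: "'i \<Rightarrow> 'a::euclidean_space \<Rightarrow> 'a"
  assumes fin: "finite I"
    and emb: "\<And>i. i \<in> I \<Longrightarrow> bounded_embedding (h i)"
    and out: "\<And>i x. i \<in> I \<Longrightarrow> x \<notin> K i \<Longrightarrow> h i x = x"
    and disj: "\<And>i j. i \<in> I \<Longrightarrow> j \<in> I \<Longrightarrow> i \<noteq> j \<Longrightarrow> K i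
        \<inter> K j = {}"
  obtains H where "bounded_embedding H"
    and "\<And>i x. i \<in> I \<Longrightarrow> x \<in> K i \<Longrightarrow> H x = h i x"
    and "\<And>x. x \<notin> (\<Union>i\<in>I. K i) \<Longrightarrow> H x = x"
proof
  define H where "H x = x + (\<Sum>i\<in>I. h i x - x)" for x
  show H_in: "H x = h i x" if "i \<in> I" "x \<in> K i" for i x
  proof -
    have "(\<Sum>j\<in>I. h j x - x) = (\<Sum>j\<in>{i}. h j x - x)"
      using that fin disj out by (intro sum.mono_neutral_right) (auto, blast)
    then show ?thesis by (simp add: H_def)
  qed
  show H_out: "H x = x" if "x \<notin> (\<Union>i\<in>I. K i)" for x
    using that out by (simp add: H_def)
  \<comment> \<open>If \<open>h i x\<close> left \<open>K i\<close>, it would be a fixed point of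
    \<open>h i\<close> different from \<open>x\<close> with the same image as
    \<open>x\<close>.\<close>
  have inv: "h i x \<in> K i" if "i \<in> I" "x \<in> K i" for i x
  proof (rule ccontr)
    assume "h i x \<notin> K i"
    moreover from this have "h i (h i x) = h i x" using out that by simp
    ultimately show False using that emb unfolding bounded_embedding_def inj_def by metis
  qed
  have "inj H"
  proof (rule injI)
    fix x y assume eq: "H x = H y"
    have *: "H z \<in> K i" if "i \<in> I" "z \<in> K i" for i z using H_in inv that by simp
    have **: "z \<in> K i" if "i \<in> I" "H z \<in> K i" for i z
    proof (cases "z \<in> (\<Union>i\<in>I. K i)")
      case True
      then obtain j where "j \<in> I" "z \<in> K j" by auto
      then show ?thesis using *[of j z] disj that by blast
    qed (use H_out that in simp)
    show "x = y"
    proof (cases "x \<in> (\<Union>i\<in>I. K i)")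
      case True
      then obtain i where i: "i \<in> I" "x \<in> K i" by auto
      then have "y \<in> K i" using * ** eq by metis
      then have "h i x = h i y" using H_in i eq by simp
      then show ?thesis using emb[OF i(1)] unfolding bounded_embedding_def inj_def by blast
    next
      case False
      then have "y \<notin> (\<Union>i\<in>I. K i)" using * H_out eq by (metis UN_E UN_I)
      then show ?thesis using False H_out eq by simp
    qed
  qed
  moreover have "continuous_on UNIV H" unfolding H_def
    using emb by (intro continuous_intros) (auto simp: bounded_embedding_def)
  moreover have "\<exists>C. \<forall>x. norm (H x - x) \<le> C"
  proof -
    have "\<forall>i\<in>I. \<exists>C. \<forall>x. norm (h i x - x) \<le> C" using emb unfolding bounded_embedding_def by
        blast
    then obtain C where "\<forall>i\<in>I. \<forall>x. norm (h i x - x) \<le> C i" by metis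
    then have "norm (H x - x) \<le> sum C I" for x unfolding H_def by (simp add: sum_norm_le)
    then show ?thesis by blast
  qed
  ultimately show "bounded_embedding H" unfolding bounded_embedding_def by blast
qed

text \<open>Every horizontal plane is displaced by the identity plus a contraction.\<close>

lemma tube_embedding:
  fixes u :: "'a::euclidean_space" and f D :: "real \<Rightarrow> 'a"
  assumes "a \<le> b" "0 < \<rho>"
    and f: "continuous_on {a..b} f" and D: "continuous_on {a..b} D"
    and ends: "D a = 0" "D b = 0"
    and horiz: "\<And>z. z \<in> {a..b} \<Longrightarrow> D z \<bullet> u = 0"
    and small: "\<And>z. z \<in> {a..b} \<Longrightarrow> norm (D z) \<le> \<rho>/2"
    and height: "\<And>z. z \<in> {a..b} \<Longrightarrow> f z \<bullet> u = z"
  obtains T where "bounded_embedding T"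
    and "\<And>z. z \<in> {a..b} \<Longrightarrow> T (f z) = f z + D z"
    and "\<And>x. x \<bullet> u \<le> a \<or> b \<le> x \<bullet> u \<Longrightarrow> T x = x"
    and "\<And>x. x \<notin> (\<Union>z\<in>{a..b}. cball (f z) \<rho>) \<Longrightarrow> T x = x"
proof
  \<comment> \<open>The height of \<open>x\<close> is clamped to \<open>{a..b}\<close>; as
    \<open>D\<close> vanishes at both ends, nothing moves above and below. The factor in
    \<open>T\<close> is 1 on the curve and 0 at distance \<open>\<rho>\<close> from the point of the
    curve at the clamped height.\<close>
  define \<zeta> where "\<zeta> x = max a (min (x \<bullet> u) b)" for x
  define T where "T x = x + max 0 (1 - norm (x - f (\<zeta> x)) / \<rho>) *\<^sub>R D (\<zeta> x)" for x
  have \<zeta>: "\<zeta> x \<in> {a..b}" for x using \<open>a \<le> b\<close> by (auto simp: \<zeta>_def)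
  have cont\<zeta>: "continuous_on UNIV \<zeta>" unfolding \<zeta>_def by (intro continuous_intros)
  have "continuous_on UNIV T" unfolding T_def using \<open>0 < \<rho>\<close>
    by (intro continuous_intros continuous_on_compose2[OF f cont\<zeta>] continuous_on_compose2[OF D cont\<zeta>])
       (use \<zeta> in auto)
  moreover have "inj T"
  proof (rule injI)
    fix x y assume eq: "T x = T y"
    \<comment> \<open>\<open>T\<close> preserves heights, so two points with equal image lie in one
      plane orthogonal to \<open>u\<close>, where the displacement has Lipschitz constant (1/\<rho>)
      (\<rho>/2) = 1/2.\<close>
    have "T z \<bullet> u = z \<bullet> u" for z using horiz[OF \<zeta>[of z]] by (simp add: T_def inner_add_left)
    then have "x \<bullet> u = y \<bullet> u" using eq by metis
    then have z: "\<zeta> x = \<zeta> y" by (simp add: \<zeta>_def)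
    define s t where "s = max 0 (1 - norm (x - f (\<zeta> y)) / \<rho>)" and "t = max 0 (1 - norm (y - f (\<zeta> y)) /
        \<rho>)"
    have "\<bar>s - t\<bar> \<le> \<bar>norm (x - f (\<zeta> y)) / \<rho> - norm (y - f (\<zeta> y)) / \<rho>\<bar>"
      unfolding s_def t_def by linarith
    also have "\<dots> = \<bar>norm (x - f (\<zeta> y)) - norm (y - f (\<zeta> y))\<bar> / \<rho>"
      using \<open>0 < \<rho>\<close> by (simp add: diff_divide_distrib[symmetric])
    also have "\<dots> \<le> norm (x - y) / \<rho>"
      using \<open>0 < \<rho>\<close> norm_triangle_ineq3[of "x - f (\<zeta> y)" "y - f (\<zeta> y)"] by (simp add:
          divide_right_mono)
    finally have st: "\<bar>s - t\<bar> \<le> norm (x - y) / \<rho>" .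
    have "x - y = (t - s) *\<^sub>R D (\<zeta> y)" using eq unfolding T_def z s_def[symmetric] t_def[symmetric]
      by (simp add: algebra_simps)
    then have "norm (x - y) = \<bar>s - t\<bar> * norm (D (\<zeta> y))" by (metis abs_minus_commute norm_scaleR)
    also have "\<dots> \<le> (norm (x - y) / \<rho>) * (\<rho>/2)"
      using st small[OF \<zeta>] \<open>0 < \<rho>\<close> by (intro mult_mono) auto
    also have "\<dots> = norm (x - y) / 2" using \<open>0 < \<rho>\<close> by simp
    finally show "x = y" by simp
  qed
  moreover have "norm (T x - x) \<le> \<rho>/2" for x
  proof -
    have "norm (T x - x) = max 0 (1 - norm (x - f (\<zeta> x)) / \<rho>) * norm (D (\<zeta> x))" by (simp add: T_def)
    also have "\<dots> \<le> 1 * (\<rho>/2)" using small[OF \<zeta>] \<open>0 < \<rho>\<close> by (intro mult_mono) auto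
    finally show ?thesis by simp
  qed
  ultimately show "bounded_embedding T" unfolding bounded_embedding_def by blast
  show "T (f z) = f z + D z" if "z \<in> {a..b}" for z
  proof -
    have "\<zeta> (f z) = z" using that height[OF that] by (auto simp: \<zeta>_def)
    then show ?thesis by (simp add: T_def)
  qed
  show "T x = x" if "x \<bullet> u \<le> a \<or> b \<le> x \<bullet> u" for x
  proof -
    have "\<zeta> x = a \<or> \<zeta> x = b" using that \<open>a \<le> b\<close> by (auto simp: \<zeta>_def)
    then show ?thesis using ends by (auto simp: T_def)
  qed
  show "T x = x" if "x \<notin> (\<Union>z\<in>{a..b}. cball (f z) \<rho>)" for x
  proof -
    have "x \<notin> cball (f (\<zeta> x)) \<rho>" using that \<zeta> by blast
    then have "1 - norm (x - f (\<zeta> x)) / \<rho> \<le> 0" using \<open>0 < \<rho>\<close> by (simp add: dist_norm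
        norm_minus_commute)
    then show ?thesis by (simp add: T_def max_absorb1)
  qed
qed

section \<open>Straightening curves that run into a point\<close>

text \<open>\<open>Q i\<close> persists when the radius shrinks, so the least of finitely many radii
  serves all indices. This is applied to distances, moduli of continuity and meshes.\<close>

lemma finite_uniform_radius:
  assumes "finite I" "\<And>i. i \<in> I \<Longrightarrow> \<exists>d>0. Q i d"
    and mono: "\<And>i d e. i \<in> I \<Longrightarrow> Q i d \<Longrightarrow> 0 < e \<Longrightarrow> e \<le> d
        \<Longrightarrow> Q i e"
  shows "\<exists>d>0::real. \<forall>i\<in>I. Q i d"
  using assms
proof (induction I rule: finite_induct)
  case empty
  show ?case by (auto intro: exI[of _ 1])
next
  case (insert i I)
  have "\<exists>d>0. \<forall>j\<in>I. Q j d" by (rule insert.IH) (blast intro: insert.prems)+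
  then obtain d where d: "d > 0" "\<forall>j\<in>I. Q j d" by blast
  obtain e where e: "e > 0" "Q i e" using insert.prems(1) by auto
  have "Q j (min d e)" if "j \<in> insert i I" for j
    using that insert.prems(2)[of j d "min d e"] insert.prems(2)[of j e "min d e"] d e by auto
  then show ?case using d e by (intro exI[of _ "min d e"]) auto
qed

text \<open>For a small field V with Lipschitz constant 1/8 this makes \<omega> -> sgn (\<omega> + V
  \<omega>) injective on the unit sphere. Equal directions make the difference of
  \<open>x + p\<close> and \<open>y + q\<close> radial, so its norm is a difference of lengths, and
  for unit \<open>x\<close>, \<open>y\<close> this is too small compared with
  \<open>norm (x - y)\<close>.\<close>

lemma sgn_perturbation_inj:
  fixes x y p q :: "'a::real_inner"
  assumes n: "norm x = 1" "norm y = 1" and p: "norm p \<le> 1/8" and q: "norm q \<le> 1/8"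
    and pq: "norm (p - q) \<le> norm (x - y) / 8"
    and eq: "sgn (x + p) = sgn (y + q)"
  shows "x = y"
proof -
  define w where "w = norm (x - y)"
  define m k where "m = norm (x + p)" and "k = norm (y + q)"
  have m: "7/8 \<le> m" unfolding m_def using norm_triangle_ineq2[of x "-p"] n p by simp
  have k: "7/8 \<le> k" unfolding k_def using norm_triangle_ineq2[of y "-q"] n q by simp
  have polar: "z = norm z *\<^sub>R sgn z" for z :: 'a by (cases "z = 0") (auto simp: sgn_div_norm)
  have "x + p = m *\<^sub>R sgn (x + p)" "y + q = k *\<^sub>R sgn (y + q)"
    unfolding m_def k_def by (rule polar)+
  then have "(x + p) - (y + q) = (m - k) *\<^sub>R sgn (x + p)" using eq by (metis scaleR_diff_left)
  moreover have "norm (sgn (x + p)) = 1" using m m_def by (auto simp: norm_sgn)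
  ultimately have XY: "norm ((x + p) - (y + q)) = \<bar>m - k\<bar>" by (metis mult.right_neutral norm_scaleR)
  have xx: "x \<bullet> x = 1" "y \<bullet> y = 1" using n by (simp_all add: dot_square_norm)
  \<comment> \<open>The unit lengths cancel, and what remains is at most (2 (1/8 + 1/8) + 1/32) w =
    17/32 w. Division by m + k \<ge> 7/4 turns this into 17/56 w, and 17/56 + 1/8 < 1.\<close>
  have "m^2 - k^2 = 2 * ((x - y) \<bullet> p + y \<bullet> (p - q)) + (p - q) \<bullet> (p + q)"
    unfolding m_def k_def power2_norm_eq_inner
    by (simp add: algebra_simps xx inner_commute)
  moreover have "\<bar>(x - y) \<bullet> p\<bar> \<le> w / 8"
    using Cauchy_Schwarz_ineq2[of "x - y" p] mult_left_mono[OF p, of w] by (simp add: w_def)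
  moreover have "\<bar>y \<bullet> (p - q)\<bar> \<le> w / 8"
    using Cauchy_Schwarz_ineq2[of y "p - q"] pq n by (simp add: w_def)
  moreover have "\<bar>(p - q) \<bullet> (p + q)\<bar> \<le> w / 32"
  proof -
    have "norm (p + q) \<le> 1/4" using norm_triangle_ineq[of p q] p q by simp
    then have "norm (p - q) * norm (p + q) \<le> (w / 8) * (1/4)"
      using pq unfolding w_def by (intro mult_mono) auto
    then show ?thesis using Cauchy_Schwarz_ineq2[of "p - q" "p + q"] by simp
  qed
  moreover have "\<bar>M\<bar> \<le> 17/32 * w"
    if "M = 2 * (A + B) + C" "\<bar>A\<bar> \<le> w / 8" "\<bar>B\<bar> \<le> w / 8" "\<bar>C\<bar> \<le> w / 32" for M A B
        C :: real
    using that by argo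
  ultimately have "\<bar>m^2 - k^2\<bar> \<le> 17/32 * w" by metis
  moreover have "m^2 - k^2 = (m - k) * (m + k)" by (simp add: power2_eq_square algebra_simps)
  ultimately have "\<bar>m - k\<bar> * (m + k) \<le> 17/32 * w" using m k by (simp add: abs_mult)
  moreover have "\<bar>m - k\<bar> * (7/4) \<le> \<bar>m - k\<bar> * (m + k)" using m k by (intro mult_left_mono) auto
  ultimately have "\<bar>m - k\<bar> * (7/4) \<le> 17/32 * w" by (rule order_trans[rotated])
  then have mk: "\<bar>m - k\<bar> \<le> 17/56 * w" by (simp add: field_simps)
  have "x - y = ((x + p) - (y + q)) - (p - q)" by simp
  then have "w \<le> \<bar>m - k\<bar> + norm (p - q)" using norm_triangle_ineq4 XY unfolding w_def by metis
  then have "w \<le> 17/56 * w + w/8" using mk pq unfolding w_def[symmetric] by argo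
  moreover have "w \<ge> 0" by (simp add: w_def)
  ultimately have "w = 0" by linarith
  then show ?thesis by (simp add: w_def)
qed

text \<open>
  \<open>G\<close> preserves all spheres about the origin. On radii between \<open>a\<close> and \<open>b\<close> it moves
      the curves
  \<open>r p\<^sub>i(r)\<close> to straight rays, and below radius \<open>a\<close> it does not depend on the radius, so
  that it keeps straight rays straight.
\<close>

definition untwists ::
  "'i set \<Rightarrow> ('i \<Rightarrow> real \<Rightarrow> 'a::euclidean_space) \<Rightarrow> real \<Rightarrow> real
      \<Rightarrow> ('a \<Rightarrow> 'a) \<Rightarrow> bool" where
  "untwists I p a b G \<longleftrightarrow> continuous_on UNIV G \<and> inj G \<and> (\<forall>x. norm (G x) = norm x) \<and>
     (\<forall>x. b \<le> norm x \<longrightarrow> G x = x) \<and>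
     (\<forall>i\<in>I. \<forall>r\<in>{a..b}. G (r *\<^sub>R p i r) = r *\<^sub>R p i b) \<and>
     (\<forall>x t. norm x \<le> a \<longrightarrow> 0 \<le> t \<longrightarrow> t \<le> 1 \<longrightarrow> G (t *\<^sub>R
         x) = t *\<^sub>R G x)"

text \<open>Between the radii \<open>a\<close> and \<open>b\<close>, \<open>G\<close> leaves
  straight rays in the directions \<open>p i b\<close>; \<open>G'\<close> is radially homogeneous
  inside radius \<open>b\<close> and turns these into rays in the directions \<open>p i c\<close>.
  Outside radius \<open>b\<close> only \<open>G'\<close> acts.\<close>

lemma untwists_trans:
  assumes G: "untwists I p a b G" and G': "untwists I p b c G'" and "0 < a" "a \<le> b" "b \<le> c"
    and p: "\<And>i r. i \<in> I \<Longrightarrow> r \<in> {a..c} \<Longrightarrow> norm (p i r) = 1"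
  shows "untwists I p a c (G' \<circ> G)"
proof -
  have "continuous_on UNIV (G' \<circ> G)"
    using G G' unfolding untwists_def by (metis continuous_on_compose continuous_on_subset subset_UNIV)
  moreover have "inj (G' \<circ> G)" using G G' unfolding untwists_def by (simp add: inj_compose)
  moreover have "norm ((G' \<circ> G) x) = norm x" for x using G G' unfolding untwists_def by simp
  moreover have "(G' \<circ> G) x = x" if "c \<le> norm x" for x
    using G G' that \<open>b \<le> c\<close> unfolding untwists_def by auto
  moreover have "(G' \<circ> G) (r *\<^sub>R p i r) = r *\<^sub>R p i c" if i: "i \<in> I" and r: "r \<in> {a..c}" for i r
  proof (cases "r \<le> b")
    case True
    have "G (r *\<^sub>R p i r) = r *\<^sub>R p i b" using G i r True unfolding untwists_def by auto
    also have "\<dots> = (r / b) *\<^sub>R (b *\<^sub>R p i b)" using \<open>0 < a\<close> \<open>a \<le> b\<close> by simp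
    finally have "G' (G (r *\<^sub>R p i r)) = G' ((r / b) *\<^sub>R (b *\<^sub>R p i b))" by simp
    also have "\<dots> = (r / b) *\<^sub>R G' (b *\<^sub>R p i b)"
    proof -
      have "norm (b *\<^sub>R p i b) \<le> b" "0 \<le> r / b" "r / b \<le> 1"
        using p[OF i, of b] r True \<open>0 < a\<close> \<open>a \<le> b\<close> \<open>b \<le> c\<close> by auto
      then show ?thesis using G' unfolding untwists_def by blast
    qed
    also have "G' (b *\<^sub>R p i b) = b *\<^sub>R p i c" using G' i \<open>b \<le> c\<close> unfolding untwists_def by auto
    finally show ?thesis using \<open>0 < a\<close> \<open>a \<le> b\<close> by simp
  next
    case False
    have "norm (r *\<^sub>R p i r) = r" using p[OF i r] r \<open>0 < a\<close> by simp
    then have "G (r *\<^sub>R p i r) = r *\<^sub>R p i r" using G False unfolding untwists_def by simp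
    then show ?thesis using G' i r False unfolding untwists_def by simp
  qed
  moreover have "(G' \<circ> G) (t *\<^sub>R x) = t *\<^sub>R (G' \<circ> G) x" if "norm x \<le> a" "0 \<le> t" "t \<le> 1"
      for x t
    using G G' that \<open>a \<le> b\<close> unfolding untwists_def by simp
  ultimately show ?thesis unfolding untwists_def by blast
qed

text \<open>On the sphere of radius \<open>r\<close> directions are pushed by bumps of radius
  \<open>\<sigma>\<close> centred at the \<open>p i r\<close>. A bump vanishes at the other centres,
  so each centre moves exactly to \<open>p i b\<close>. Bumps have Lipschitz constant 1/\<sigma> and
  at most \<open>card I\<close> of them overlap, so the bound in \<open>small\<close> makes the
  whole field small with Lipschitz constant 1/8, as \<open>sgn_perturbation_inj\<close>
  requires.\<close>

lemma untwists_small: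
  fixes p :: "'i \<Rightarrow> real \<Rightarrow> 'a::euclidean_space"
  assumes "finite I" "0 < a" "a \<le> b" "0 < \<sigma>" "\<sigma> \<le> 1"
    and cont: "\<And>i. i \<in> I \<Longrightarrow> continuous_on {a..b} (p i)"
    and norm: "\<And>i r. i \<in> I \<Longrightarrow> r \<in> {a..b} \<Longrightarrow> norm (p i r) = 1"
    and sep: "\<And>i j r. i \<in> I \<Longrightarrow> j \<in> I \<Longrightarrow> i \<noteq> j \<Longrightarrow> r \<in>
        {a..b} \<Longrightarrow> \<sigma> \<le> norm (p i r - p j r)"
    and small: "\<And>i r. i \<in> I \<Longrightarrow> r \<in> {a..b} \<Longrightarrow> norm (p i b - p i r) \<le> \<sigma>
        / (8 * (card I + 1))"
  shows "\<exists>G. untwists I p a b G"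
proof -
  define V where "V r \<omega> = (\<Sum>i\<in>I. max 0 (1 - norm (\<omega> - p i r) / \<sigma>) *\<^sub>R (p i b - p i r))"
      for r \<omega>
  \<comment> \<open>Clamping the radius provides two clauses of \<open>untwists\<close>: from radius
    \<open>b\<close> on the field vanishes, and below \<open>a\<close> it does not depend on the
    radius.\<close>
  define R where "R x = max a (min (norm x) b)" for x :: 'a
  define G where "G x = norm x *\<^sub>R sgn (sgn x + V (R x) (sgn x))" for x
  have R: "R x \<in> {a..b}" for x using \<open>a \<le> b\<close> by (auto simp: R_def)
  have Rid: "R x = norm x" if "norm x \<in> {a..b}" for x using that by (auto simp: R_def)
  have card: "real (card I) * (1 / (8 * (card I + 1))) \<le> 1/8" by (simp add: field_simps)
  have Vb: "norm (V r \<omega>) \<le> 1/8" if "r \<in> {a..b}" for r \<omega>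
  proof -
    have "norm (V r \<omega>) \<le> (\<Sum>i\<in>I. 1 / (8 * (card I + 1)))" unfolding V_def
    proof (rule sum_norm_le)
      fix i assume i: "i \<in> I"
      have "max 0 (1 - norm (\<omega> - p i r) / \<sigma>) * norm (p i b - p i r) \<le> 1 * (\<sigma> / (8 * (card I + 1)))"
        using small[OF i that] \<open>0 < \<sigma>\<close> by (intro mult_mono) auto
      also have "\<dots> \<le> 1 / (8 * (card I + 1))" using \<open>\<sigma> \<le> 1\<close> by (simp add: divide_right_mono)
      finally show "norm (max 0 (1 - norm (\<omega> - p i r) / \<sigma>) *\<^sub>R (p i b - p i r)) \<le> 1 / (8 * (card I +
          1))"
        by simp
    qed
    also have "\<dots> = real (card I) * (1 / (8 * (card I + 1)))" by simp
    finally show ?thesis using card by linarith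
  qed
  have VL: "norm (V r \<omega> - V r \<omega>') \<le> norm (\<omega> - \<omega>') / 8" if "r \<in> {a..b}" for r \<omega>
      \<omega>'
  proof -
    have "norm (V r \<omega> - V r \<omega>') \<le> (\<Sum>i\<in>I. norm (\<omega> - \<omega>') * (1 / (8 * (card I + 1))))"
      unfolding V_def sum_subtractf[symmetric]
    proof (rule sum_norm_le)
      fix i assume i: "i \<in> I"
      define s t where "s = max 0 (1 - norm (\<omega> - p i r) / \<sigma>)" and "t = max 0 (1 - norm (\<omega>' - p i r) /
          \<sigma>)"
      have "\<bar>s - t\<bar> \<le> \<bar>norm (\<omega> - p i r) / \<sigma> - norm (\<omega>' - p i r) / \<sigma>\<bar>"
          unfolding s_def t_def by linarith
      also have "\<dots> = \<bar>norm (\<omega> - p i r) - norm (\<omega>' - p i r)\<bar> / \<sigma>"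
        using \<open>0 < \<sigma>\<close> by (simp add: diff_divide_distrib[symmetric])
      also have "\<dots> \<le> norm (\<omega> - \<omega>') / \<sigma>"
        using \<open>0 < \<sigma>\<close> norm_triangle_ineq3[of "\<omega> - p i r" "\<omega>' - p i r"] by (simp add:
            divide_right_mono)
      finally have "\<bar>s - t\<bar> * norm (p i b - p i r) \<le> (norm (\<omega> - \<omega>') / \<sigma>) * (\<sigma> / (8
          * (card I + 1)))"
        using small[OF i that] \<open>0 < \<sigma>\<close> by (intro mult_mono) auto
      also have "\<dots> = norm (\<omega> - \<omega>') * (1 / (8 * (card I + 1)))" using \<open>0 < \<sigma>\<close> by simp
      finally show "norm (s *\<^sub>R (p i b - p i r) - t *\<^sub>R (p i b - p i r)) \<le> norm (\<omega> - \<omega>') * (1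
          / (8 * (card I + 1)))"
        by (simp add: scaleR_diff_left[symmetric] del: scaleR_diff_left)
    qed
    also have "\<dots> = norm (\<omega> - \<omega>') * (real (card I) * (1 / (8 * (card I + 1))))" by simp
    also have "\<dots> \<le> norm (\<omega> - \<omega>') * (1/8)" by (intro mult_left_mono card) auto
    finally show ?thesis by simp
  qed
  have nz: "\<omega> + V r \<omega> \<noteq> 0" if "r \<in> {a..b}" "norm \<omega> = 1" for r \<omega>
  proof
    assume "\<omega> + V r \<omega> = 0"
    then have "norm \<omega> = norm (V r \<omega>)" by (metis add.inverse_unique norm_minus_cancel)
    then show False using Vb[OF that(1), of \<omega>] that(2) by simp
  qed
  have nG: "norm (G x) = norm x" for x
  proof (cases "x = 0")
    case False
    then have "norm (sgn x) = 1" by (simp add: norm_sgn)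
    then show ?thesis using nz[OF R] by (simp add: G_def norm_sgn)
  qed (simp add: G_def)
  have "continuous_on UNIV G"
  proof -
    have "continuous_on (- {0}) G"
    proof -
      have cR: "continuous_on (- {0}) R" unfolding R_def by (intro continuous_intros)
      have "continuous_on (- {0}) (\<lambda>x. p i (R x))" if "i \<in> I" for i
        using continuous_on_compose2[OF cont[OF that] cR] R by blast
      moreover have "continuous_on (- {0}) (\<lambda>x::'a. sgn x)" by (intro continuous_intros) auto
      ultimately have "continuous_on (- {0}) (\<lambda>x. sgn x + V (R x) (sgn x))"
        unfolding V_def using \<open>0 < \<sigma>\<close> by (intro continuous_intros) auto
      moreover have "\<forall>x\<in>-{0}. sgn x + V (R x) (sgn x) \<noteq> 0"
        using nz[OF R] by (simp add: norm_sgn)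
      ultimately show ?thesis unfolding G_def
        by (intro continuous_on_scaleR[OF continuous_on_norm[OF continuous_on_id]] continuous_on_sgn)
    qed
    then have "isCont G x" if "x \<noteq> 0" for x
      using that continuous_on_eq_continuous_at[of "- {0}" G] by (simp add: open_Compl)
    \<comment> \<open>\<open>sgn\<close> jumps at the origin; continuity there comes from
      preservation of the norm alone.\<close>
    moreover have "isCont G 0"
    proof -
      have "(G \<longlongrightarrow> 0) (at 0)"
        by (rule Lim_null_comparison[of _ norm]) (auto simp: nG intro!: tendsto_eq_intros)
      moreover have "G 0 = 0" by (simp add: G_def)
      ultimately show ?thesis by (simp add: isCont_def)
    qed
    ultimately have "isCont G x" for x by (cases "x = 0") auto
    then show ?thesis by (simp add: continuous_at_imp_continuous_on)
  qed
  moreover have "inj G"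
  proof (rule injI)
    fix x y assume eq: "G x = G y"
    then have n: "norm x = norm y" using nG by metis
    show "x = y"
    proof (cases "x = 0")
      case False
      then have y: "y \<noteq> 0" using n by auto
      have "R x = R y" using n by (simp add: R_def)
      then have "sgn (sgn x + V (R x) (sgn x)) = sgn (sgn y + V (R x) (sgn y))"
        using eq n False y by (simp add: G_def)
      then have "sgn x = sgn y"
        using sgn_perturbation_inj[OF _ _ Vb[OF R] Vb[OF R] VL[OF R]] False y by (simp add: norm_sgn)
      then show ?thesis using n by (metis sgn_div_norm scaleR_cancel_left False inverse_nonzero_iff_nonzero norm_eq_zero)
    qed (use n in auto)
  qed
  moreover have "G x = x" if "b \<le> norm x" for x
  proof -
    have "R x = b" using that \<open>a \<le> b\<close> by (auto simp: R_def)
    then have "V (R x) (sgn x) = 0" by (simp add: V_def)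
    moreover have "x \<noteq> 0" using that \<open>0 < a\<close> \<open>a \<le> b\<close> by auto
    ultimately show ?thesis by (simp add: G_def sgn_div_norm)
  qed
  moreover have "G (r *\<^sub>R p i r) = r *\<^sub>R p i b" if i: "i \<in> I" and r: "r \<in> {a..b}" for i r
  proof -
    have r0: "r > 0" using r \<open>0 < a\<close> by auto
    have n: "norm (r *\<^sub>R p i r) = r" using norm[OF i r] r0 by simp
    then have R': "R (r *\<^sub>R p i r) = r" using Rid r by metis
    have s: "sgn (r *\<^sub>R p i r) = p i r" using norm[OF i r] r0 by (simp add: sgn_div_norm)
    have "V r (p i r) = (\<Sum>j\<in>{i}. max 0 (1 - norm (p i r - p j r) / \<sigma>) *\<^sub>R (p j b - p j r))"
      unfolding V_def
    proof (rule sum.mono_neutral_right[OF \<open>finite I\<close>])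
      show "\<forall>j\<in>I - {i}. max 0 (1 - norm (p i r - p j r) / \<sigma>) *\<^sub>R (p j b - p j r) = 0"
      proof
        fix j assume j: "j \<in> I - {i}"
        then have "1 - norm (p i r - p j r) / \<sigma> \<le> 0" using sep[OF i _ _ r, of j] \<open>0 < \<sigma>\<close> by
            auto
        then show "max 0 (1 - norm (p i r - p j r) / \<sigma>) *\<^sub>R (p j b - p j r) = 0" by (simp add: max_absorb1)
      qed
    qed (use i in auto)
    then have "sgn (p i r + V r (p i r)) = p i b"
      using norm[OF i, of b] \<open>a \<le> b\<close> by (simp add: sgn_div_norm)
    then show ?thesis unfolding G_def R' s n by simp
  qed
  moreover have "G (t *\<^sub>R x) = t *\<^sub>R G x" if x: "norm x \<le> a" and t: "0 \<le> t" "t \<le> 1" for x t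
  proof (cases "t = 0")
    case False
    have "norm (t *\<^sub>R x) \<le> a" using x t mult_left_le_one_le[of "norm x" t] by simp
    then have "R (t *\<^sub>R x) = a" "R x = a" using x \<open>a \<le> b\<close> by (auto simp: R_def)
    moreover have "sgn (t *\<^sub>R x) = sgn x" using False t by (simp add: sgn_scaleR)
    ultimately show ?thesis using t by (simp add: G_def)
  qed (simp add: G_def)
  ultimately show ?thesis unfolding untwists_def using nG by blast
qed

text \<open>Untwistings of adjacent shells compose, so by bisection it suffices to treat short
  intervals of radii around a given one, where the directions hardly move.\<close>

lemma untwists_exists:
  fixes p :: "'i \<Rightarrow> real \<Rightarrow> 'a::euclidean_space"
  assumes "finite I" "0 < \<alpha>" "\<alpha> \<le> \<beta>"
    and cont: "\<And>i. i \<in> I \<Longrightarrow> continuous_on {\<alpha>..\<beta>} (p i)"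
    and norm: "\<And>i r. i \<in> I \<Longrightarrow> r \<in> {\<alpha>..\<beta>} \<Longrightarrow> norm (p i r) = 1"
    and dist: "\<And>i j r. i \<in> I \<Longrightarrow> j \<in> I \<Longrightarrow> i \<noteq> j \<Longrightarrow> r \<in>
        {\<alpha>..\<beta>} \<Longrightarrow> p i r \<noteq> p j r"
  shows "\<exists>G. untwists I p \<alpha> \<beta> G"
proof -
  \<comment> \<open>\<open>Bolzano\<close> quantifies over all short intervals around a point, also
    those leaving \<open>{\<alpha>..\<beta>}\<close>; the premises exempt these.\<close>
  define P where "P a b \<longleftrightarrow> (\<alpha> \<le> a \<longrightarrow> b \<le> \<beta> \<longrightarrow>
      (\<exists>G. untwists I p a b G))" for a b
  have "P \<alpha> \<beta>"
  proof (rule Bolzano[OF \<open>\<alpha> \<le> \<beta>\<close>])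
    fix a b c assume P: "P a b" "P b c" "a \<le> b" "b \<le> c"
    show "P a c" unfolding P_def
    proof (intro impI)
      assume ac: "\<alpha> \<le> a" "c \<le> \<beta>"
      then obtain G G' where "untwists I p a b G" "untwists I p b c G'" using P unfolding P_def by auto
      then have "untwists I p a c (G' \<circ> G)"
        using P ac \<open>0 < \<alpha>\<close> norm by (intro untwists_trans[of I p a b G c G']) auto
      then show "\<exists>G. untwists I p a c G" by blast
    qed
  next
    fix x assume x: "\<alpha> \<le> x" "x \<le> \<beta>"
    have "\<exists>s>0. \<forall>ij\<in>{ij \<in> I \<times> I. fst ij \<noteq> snd ij}. 2 * s \<le> norm (p (fst ij) x - p
        (snd ij) x)"
    proof (rule finite_uniform_radius)
      fix ij assume "ij \<in> {ij \<in> I \<times> I. fst ij \<noteq> snd ij}"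
      then have "norm (p (fst ij) x - p (snd ij) x) > 0" using dist x by auto
      then show "\<exists>s>0. 2 * s \<le> norm (p (fst ij) x - p (snd ij) x)"
        by (intro exI[of _ "norm (p (fst ij) x - p (snd ij) x) / 2"]) auto
    qed (use \<open>finite I\<close> in auto)
    then obtain s where s: "s > 0" "\<And>i j. i \<in> I \<Longrightarrow> j \<in> I \<Longrightarrow> i \<noteq> j
        \<Longrightarrow> 2 * s \<le> norm (p i x - p j x)"
      by force
    define \<sigma> where "\<sigma> = min s 1"
    have \<sigma>: "0 < \<sigma>" "\<sigma> \<le> 1" "\<sigma> \<le> s" using s by (auto simp: \<sigma>_def)
    \<comment> \<open>Half of the bound required by \<open>untwists_small\<close>, because
      \<open>p i b\<close> and \<open>p i r\<close> are compared through
      \<open>p i x\<close>.\<close>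
    define \<eta> where "\<eta> = \<sigma> / (8 * (card I + 1)) / 2"
    have \<eta>: "0 < \<eta>" "\<eta> \<le> \<sigma>/16"
      using \<sigma> by (auto simp: \<eta>_def field_simps)
    have "\<exists>d>0. \<forall>i\<in>I. \<forall>r\<in>{\<alpha>..\<beta>}. \<bar>r - x\<bar> < d \<longrightarrow> norm
        (p i r - p i x) \<le> \<eta>"
    proof (rule finite_uniform_radius[OF \<open>finite I\<close>])
      fix i assume "i \<in> I"
      from cont[OF this] x \<eta>(1) obtain d where "d > 0" "\<And>r. r \<in> {\<alpha>..\<beta>} \<Longrightarrow> dist r x
          < d \<Longrightarrow> dist (p i r) (p i x) < \<eta>"
        unfolding continuous_on_iff by (metis atLeastAtMost_iff)
      then show "\<exists>d>0. \<forall>r\<in>{\<alpha>..\<beta>}. \<bar>r - x\<bar> < d \<longrightarrow> norm (p i r - p i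
          x) \<le> \<eta>"
        by (intro exI[of _ d]) (auto simp: dist_norm less_imp_le)
    qed auto
    then obtain d where d: "d > 0" "\<And>i r. i \<in> I \<Longrightarrow> r \<in> {\<alpha>..\<beta>} \<Longrightarrow>
        \<bar>r - x\<bar> < d \<Longrightarrow> norm (p i r - p i x) \<le> \<eta>"
      by blast
    have "P a b" if ab: "a \<le> x" "x \<le> b" "b - a < d" for a b
      unfolding P_def
    proof (intro impI)
      assume *: "\<alpha> \<le> a" "b \<le> \<beta>"
      have close: "norm (p i r - p i x) \<le> \<eta>" if "i \<in> I" "r \<in> {a..b}" for i r
        using that ab * by (intro d) auto
      show "\<exists>G. untwists I p a b G"
      proof (rule untwists_small[of I a b \<sigma> p])
        show "continuous_on {a..b} (p i)" if "i \<in> I" for i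
          using continuous_on_subset[OF cont[OF that]] * by auto
        show "\<sigma> \<le> norm (p i r - p j r)" if "i \<in> I" "j \<in> I" "i \<noteq> j" "r \<in> {a..b}" for i j r
        proof -
          have "norm (p i x - p j x) \<le> norm (p i r - p j r) + norm (p i r - p i x) + norm (p j r - p j x)"
            by norm
          then show ?thesis using close[of i r] close[of j r] s(2)[of i j] that \<eta> \<sigma> by linarith
        qed
        show "norm (p i b - p i r) \<le> \<sigma> / (8 * (card I + 1))" if "i \<in> I" "r \<in> {a..b}" for i r
        proof -
          have "p i b - p i r = (p i b - p i x) - (p i r - p i x)" by simp
          then have "norm (p i b - p i r) \<le> norm (p i b - p i x) + norm (p i r - p i x)"
            by (metis norm_triangle_ineq4)
          also have "\<dots> \<le> \<eta> + \<eta>" using close that ab by (intro add_mono) auto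
          also have "\<dots> = \<sigma> / (8 * (card I + 1))" unfolding \<eta>_def by (rule field_sum_of_halves)
          finally show ?thesis .
        qed
      qed (use assms * ab \<sigma> in auto)
    qed
    then show "\<exists>d>0. \<forall>a b. a \<le> x \<and> x \<le> b \<and> b - a < d \<longrightarrow> P a b" using d(1)
        by blast
  qed
  then show ?thesis unfolding P_def by simp
qed

text \<open>
  The curves may wind around each other infinitely often on their way to the origin. The radii
  \<open>\<epsilon>/2\<^sup>k\<close> cut this into finite braids, which are undone one after the other from the outside
  inwards; only finitely many of these homeomorphisms move a given point.
\<close>

lemma cone_embedding:
  fixes p :: "'i \<Rightarrow> real \<Rightarrow> 'a::euclidean_space"
  assumes "finite I" "0 < \<epsilon>"
    and cont: "\<And>i. i \<in> I \<Longrightarrow> continuous_on {0<..\<epsilon>} (p i)"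
    and norm: "\<And>i r. i \<in> I \<Longrightarrow> r \<in> {0<..\<epsilon>} \<Longrightarrow> norm (p i r) = 1"
    and dist: "\<And>i j r. i \<in> I \<Longrightarrow> j \<in> I \<Longrightarrow> i \<noteq> j \<Longrightarrow> r \<in>
        {0<..\<epsilon>} \<Longrightarrow> p i r \<noteq> p j r"
  obtains h where "continuous_on UNIV h" "inj h" "\<And>x. norm (h x) = norm x"
    "\<And>x. \<epsilon> \<le> norm x \<Longrightarrow> h x = x"
    "\<And>i r. i \<in> I \<Longrightarrow> r \<in> {0<..\<epsilon>} \<Longrightarrow> h (r *\<^sub>R p i r) = r *\<^sub>R p
        i \<epsilon>"
proof -
  define R :: "nat \<Rightarrow> real" where "R k = \<epsilon> / 2 ^ k" for k
  have R: "0 < R k" "R (Suc k) \<le> R k" "R k \<le> \<epsilon>" for k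
    using \<open>0 < \<epsilon>\<close> by (auto simp: R_def field_simps)
  have "\<exists>G. untwists I p (R (Suc k)) (R k) G" for k
  proof -
    have *: "{R (Suc k)..R k} \<subseteq> {0<..\<epsilon>}" using R[of k] R(1)[of "Suc k"] by auto
    show ?thesis
    proof (rule untwists_exists[OF \<open>finite I\<close> R(1,2)])
    show "continuous_on {R (Suc k)..R k} (p i)" if "i \<in> I" for i
      using continuous_on_subset[OF cont[OF that] *] .
    qed (use norm dist * in blast)+
  qed
  then obtain G where G: "\<And>k. untwists I p (R (Suc k)) (R k) (G k)" by metis
  \<comment> \<open>The new factor \<open>G k\<close> is applied first and fixes all points of norm
    at least \<open>R k\<close>. Hence the sequence is eventually constant at every nonzero
    point.\<close>
  define C where "C = rec_nat id (\<lambda>k c. c \<circ> G k)"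
  have C0: "C 0 = id" and CS: "C (Suc k) = C k \<circ> G k" for k by (simp_all add: C_def)
  have C: "untwists I p (R k) \<epsilon> (C k)" for k
  proof (induction k)
    case 0
    have "inj (id :: 'a \<Rightarrow> 'a)" "continuous_on UNIV (id :: 'a \<Rightarrow> 'a)" by (auto simp: continuous_on_id)
    then show ?case by (simp add: C0 untwists_def R_def)
  next
    case (Suc k)
    show ?case unfolding CS
      using R[of k] R(1)[of "Suc k"] norm by (intro untwists_trans[OF G Suc]) auto
  qed
  have step: "C m x = C k x" if "k \<le> m" "R k \<le> norm x" for k m x
    using that(1)
  proof (induction m rule: dec_induct)
    case (step m)
    have "R m \<le> R k" using step.hyps \<open>0 < \<epsilon>\<close> by (auto simp: R_def frac_le power_increasing)
    then have "G m x = x" using G[of m] that(2) unfolding untwists_def by auto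
    then show ?case using step CS by simp
  qed simp
  have ex: "\<exists>k. R k < norm x" if "x \<noteq> 0" for x :: 'a
  proof -
    obtain k where "\<epsilon> / norm x < 2 ^ k" using real_arch_pow[of 2 "\<epsilon> / norm x"] by auto
    then show ?thesis using that by (auto simp: R_def field_simps)
  qed
  define h where "h x = (if x = 0 then 0 else C (LEAST k. R k < norm x) x)" for x
  have hC: "h x = C k x" if "R k < norm x" for k x
  proof -
    have "x \<noteq> 0" using that R(1)[of k] by auto
    have "R (LEAST k. R k < norm x) < norm x" using that by (rule LeastI)
    moreover have "(LEAST k. R k < norm x) \<le> k" using that by (rule Least_le)
    ultimately show ?thesis using step[of "LEAST k. R k < norm x" k x] \<open>x \<noteq> 0\<close> by (simp add: h_def)
  qed
  have nh: "norm (h x) = norm x" for x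
    using C unfolding h_def untwists_def by simp
  show ?thesis
  proof
    show "norm (h x) = norm x" for x by (rule nh)
    show "inj h"
    proof (rule injI)
      fix x y assume eq: "h x = h y"
      then have n: "norm x = norm y" using nh by metis
      show "x = y"
      proof (cases "x = 0")
        case False
        then obtain k where "R k < norm x" using ex by blast
        then have "C k x = C k y" using hC eq n by metis
        then show ?thesis using C[of k] unfolding untwists_def inj_def by blast
      qed (use n in auto)
    qed
    have "isCont h x" for x
    proof (cases "x = 0")
      case True
      have "(h \<longlongrightarrow> 0) (at 0)"
        by (rule Lim_null_comparison[of _ norm]) (auto simp: nh intro!: tendsto_eq_intros)
      moreover have "h 0 = 0" by (simp add: h_def)
      ultimately show ?thesis using True by (simp add: isCont_def)
    next
      case False
      then obtain k where k: "R k < norm x" using ex by blast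
      have "open {y. R k < norm y}" by (intro open_Collect_less continuous_intros)
      moreover have "continuous_on {y. R k < norm y} h"
      proof (rule continuous_on_eq)
        show "continuous_on {y. R k < norm y} (C k)"
          using C[of k] continuous_on_subset unfolding untwists_def by blast
      qed (simp add: hC)
      ultimately show ?thesis using k continuous_on_eq_continuous_at by blast
    qed
    then show "continuous_on UNIV h" by (simp add: continuous_at_imp_continuous_on)
    show "h x = x" if "\<epsilon> \<le> norm x" for x
    proof -
      have "x \<noteq> 0" using that \<open>0 < \<epsilon>\<close> by auto
      then show ?thesis using C that unfolding h_def untwists_def by simp
    qed
    show "h (r *\<^sub>R p i r) = r *\<^sub>R p i \<epsilon>" if i: "i \<in> I" and r: "r \<in> {0<..\<epsilon>}" for i r
    proof -
      have n: "norm (r *\<^sub>R p i r) = r" using norm[OF i r] r by simp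
      then have "r *\<^sub>R p i r \<noteq> 0" using r by force
      then obtain k where k: "R k < norm (r *\<^sub>R p i r)" using ex by blast
      then have "r \<in> {R k..\<epsilon>}" using n r by simp
      then show ?thesis unfolding hC[OF k] using C[of k] i unfolding untwists_def by blast
    qed
  qed
qed

section \<open>Subdivisions and chords of graphs\<close>

text \<open>Two parametrizations of one arc differ by a continuous injection of
  \<open>{0..1}\<close> onto itself. It is strictly monotone, so it permutes 0 and 1, and
  \<open>endpoints\<close>, which collects the ends of all parametrizations, has only two
  elements.\<close>

lemma endpoints_path_image:
  assumes g: "arc g"
  shows "endpoints (path_image g) = {pathstart g, pathfinish g}"
proof -
  have "{pathstart k, pathfinish k} \<subseteq> {pathstart g, pathfinish g}"
    if k: "arc k" "path_image k = path_image g" for k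
  proof -
    obtain h where h: "homeomorphism {0..1} (path_image g) g h" using homeomorphism_arc[OF g] .
    define \<phi> where "\<phi> = h \<circ> k"
    have cont: "continuous_on {0..1} \<phi>"
      unfolding \<phi>_def using h k
      by (intro continuous_on_compose)
         (auto simp: arc_def path_def path_image_def homeomorphism_def)
    have img: "\<phi> ` {0..1} = {0..1}"
    proof -
      have "k ` {0..1} = path_image g" "h ` path_image g = {0..1}"
        using h k unfolding homeomorphism_def by (simp_all add: path_image_def)
      then show ?thesis by (metis \<phi>_def image_comp)
    qed
    have gphi: "g (\<phi> x) = k x" if "x \<in> {0..1}" for x
      using h k that unfolding \<phi>_def homeomorphism_def comp_def by (metis imageI path_image_def)
    have "inj_on \<phi> {0..1}"
      by (rule inj_onI) (metis gphi arc_imp_inj_on[OF k(1)] inj_on_def)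
    then have mono: "strict_mono_on {0..1} \<phi> \<or> strict_antimono_on {0..1} \<phi>"
      using injective_eq_monotone_map[OF is_interval_cc cont] by simp
    have "0 \<in> \<phi> ` {0..1}" "1 \<in> \<phi> ` {0..1}" unfolding img by simp_all
    then obtain a b where ab: "a \<in> {0..1}" "\<phi> a = 0" "b \<in> {0..1}" "\<phi> b = 1" by auto
    have "a \<in> {0, 1} \<and> b \<in> {0, 1}"
    proof -
      have "\<phi> 0 \<in> \<phi> ` {0..1}" "\<phi> 1 \<in> \<phi> ` {0..1}" by simp_all
      then have P: "\<phi> 0 \<in> {0..1}" "\<phi> 1 \<in> {0..1}" unfolding img by simp_all
      show ?thesis
      proof (rule ccontr)
        assume "\<not> ?thesis"
        then consider "0 < a" "a < 1" | "0 < b" "b < 1" using ab by force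
        then show False
        proof cases
          case 1
          then have "\<phi> 0 < 0 \<or> \<phi> 1 < 0"
            using mono ab unfolding monotone_on_def by (metis atLeastAtMost_iff order_refl zero_le_one)
          then show ?thesis using P by auto
        next
          case 2
          then have "\<phi> 0 > 1 \<or> \<phi> 1 > 1"
            using mono ab unfolding monotone_on_def by (metis atLeastAtMost_iff order_refl zero_le_one)
          then show ?thesis using P by auto
        qed
      qed
    qed
    moreover have "a \<noteq> b" using ab by auto
    ultimately have "{a, b} = {0, 1}" by auto
    then have "{\<phi> 0, \<phi> 1} = {0, 1}" using ab by (metis doubleton_eq_iff)
    then have "{g (\<phi> 0), g (\<phi> 1)} = {g 0, g 1}" by (metis image_empty image_insert)
    then have "{k 0, k 1} = {g 0, g 1}" using gphi by simp
    then show ?thesis by (simp add: pathstart_def pathfinish_def)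
  qed
  then show ?thesis unfolding endpoints_def using g by blast
qed

lemma endpoints_subarc:
  assumes "arc g" "0 \<le> a" "a < b" "b \<le> 1"
  shows "simple_arc (g ` {a..b})" "endpoints (g ` {a..b}) = {g a, g b}"
proof -
  have "arc (subpath a b g)" using assms by (intro arc_subpath_arc) auto
  moreover have "path_image (subpath a b g) = g ` {a..b}" using assms by (simp add: path_image_subpath)
  ultimately show "simple_arc (g ` {a..b})" "endpoints (g ` {a..b}) = {g a, g b}"
    using endpoints_path_image[of "subpath a b g"] unfolding simple_arc_def by auto
qed

lemma endpoints_closed_segment:
  fixes a b :: "real^3"
  assumes "a \<noteq> b"
  shows "simple_arc (closed_segment a b)" "endpoints (closed_segment a b) = {a, b}"
  using endpoints_path_image[OF arc_linepath[OF assms]] arc_linepath[OF assms]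
  unfolding simple_arc_def by (auto simp: path_image_linepath)

section \<open>Parametrized edges and subdivisions of graphs\<close>

locale parametrized_graph =
  fixes \<Gamma> :: space_graph and \<gamma> :: "(real^3) set \<Rightarrow> real \<Rightarrow> real^3"
  assumes graph: "continuous_graph \<Gamma>"
    and arc: "A \<in> edges \<Gamma> \<Longrightarrow> arc (\<gamma> A)"
    and img: "A \<in> edges \<Gamma> \<Longrightarrow> path_image (\<gamma> A) = A"

lemma continuous_graph_parametrized:
  assumes "continuous_graph \<Gamma>"
  obtains \<gamma> where "parametrized_graph \<Gamma> \<gamma>"
proof -
  have "\<forall>A\<in>edges \<Gamma>. \<exists>g. arc g \<and> path_image g = A"
    using assms unfolding continuous_graph_def simple_arc_def by auto
  then obtain \<gamma> where "\<forall>A\<in>edges \<Gamma>. arc (\<gamma> A) \<and> path_image (\<gamma> A) = A" by metis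
  then have "parametrized_graph \<Gamma> \<gamma>" using assms by unfold_locales auto
  then show thesis by (rule that)
qed

context parametrized_graph
begin

lemma img': "A \<in> edges \<Gamma> \<Longrightarrow> \<gamma> A ` {0..1} = A"
  using img by (simp add: path_image_def)

lemma in_edge: "A \<in> edges \<Gamma> \<Longrightarrow> x \<in> {0..1} \<Longrightarrow> \<gamma> A x \<in> A"
  using img' by blast

lemma ends: "A \<in> edges \<Gamma> \<Longrightarrow> endpoints A = {\<gamma> A 0, \<gamma> A 1}"
  using endpoints_path_image[OF arc, of A] img[of A] by (simp add: pathstart_def pathfinish_def)

lemma inj: "A \<in> edges \<Gamma> \<Longrightarrow> x \<in> {0..1} \<Longrightarrow> y \<in> {0..1} \<Longrightarrow>
    \<gamma> A x = \<gamma> A y \<longleftrightarrow> x = y"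
  using arc_imp_inj_on[OF arc] by (metis inj_onD)

lemma cont: "A \<in> edges \<Gamma> \<Longrightarrow> continuous_on {0..1} (\<gamma> A)"
  using arc_imp_path[OF arc] by (simp add: path_def)

lemma edge_Int_verts: "A \<in> edges \<Gamma> \<Longrightarrow> A \<inter> verts \<Gamma> = endpoints A"
  using graph unfolding continuous_graph_def by simp

lemma end_vert: "A \<in> edges \<Gamma> \<Longrightarrow> \<gamma> A 0 \<in> verts \<Gamma>" "A \<in> edges \<Gamma>
    \<Longrightarrow> \<gamma> A 1 \<in> verts \<Gamma>"
  using edge_Int_verts[of A] ends[of A] by auto

lemma vert_time:
  assumes "A \<in> edges \<Gamma>" "x \<in> {0..1}" "\<gamma> A x \<in> verts \<Gamma>"
  shows "x = 0 \<or> x = 1"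
proof -
  have "\<gamma> A x \<in> endpoints A" using edge_Int_verts[OF assms(1)] in_edge[OF assms(1,2)] assms(3) by blast
  then have "\<gamma> A x = \<gamma> A 0 \<or> \<gamma> A x = \<gamma> A 1" using ends[OF assms(1)] by simp
  then show ?thesis using inj[OF assms(1,2)] by auto
qed

lemma edges_meet:
  assumes "A \<in> edges \<Gamma>" "B \<in> edges \<Gamma>" "A \<noteq> B" "z \<in> A" "z \<in> B"
  shows "z \<in> verts \<Gamma>"
proof -
  have "A \<inter> B \<subseteq> endpoints A" using graph assms(1-3) unfolding continuous_graph_def by simp
  then show ?thesis using assms ends[OF assms(1)] end_vert[OF assms(1)] by auto
qed

lemma finite_graph: "finite (verts \<Gamma>)" "finite (edges \<Gamma>)"
  using graph unfolding continuous_graph_def by auto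

end

locale subdivided_graph = parametrized_graph +
  fixes n :: "(real^3) set \<Rightarrow> nat" and \<tau> :: "(real^3) set \<Rightarrow> nat \<Rightarrow> real"
  assumes \<tau>_0: "A \<in> edges \<Gamma> \<Longrightarrow> \<tau> A 0 = 0"
    and \<tau>_n: "A \<in> edges \<Gamma> \<Longrightarrow> \<tau> A (n A) = 1"
    and \<tau>_Suc: "A \<in> edges \<Gamma> \<Longrightarrow> i < n A \<Longrightarrow> \<tau> A i < \<tau> A (Suc i)"
begin

definition piece :: "(real^3) set \<Rightarrow> nat \<Rightarrow> (real^3) set" where
  "piece A i = \<gamma> A ` {\<tau> A i..\<tau> A (Suc i)}"

definition refined :: space_graph where
  "refined = \<lparr>verts = verts \<Gamma> \<union> {\<gamma> A (\<tau> A i) |A i. A \<in> edges \<Gamma> \<and> i \<le> n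
      A},
     edges = {piece A i |A i. A \<in> edges \<Gamma> \<and> i < n A}\<rparr>"

lemma \<tau>_less: "A \<in> edges \<Gamma> \<Longrightarrow> i < j \<Longrightarrow> j \<le> n A \<Longrightarrow> \<tau> A
    i < \<tau> A j"
proof (induction j)
  case (Suc j)
  then show ?case using \<tau>_Suc[of A j] by (cases "i = j") auto
qed simp

lemma \<tau>_le: "A \<in> edges \<Gamma> \<Longrightarrow> i \<le> j \<Longrightarrow> j \<le> n A \<Longrightarrow> \<tau>
    A i \<le> \<tau> A j"
  using \<tau>_less[of A i j] by (cases "i = j") auto

lemma n_pos: "A \<in> edges \<Gamma> \<Longrightarrow> 0 < n A"
  using \<tau>_0 \<tau>_n by (metis gr0I zero_neq_one)

lemma \<tau>_range: "A \<in> edges \<Gamma> \<Longrightarrow> i \<le> n A \<Longrightarrow> \<tau> A i \<in> {0..1}"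
  using \<tau>_le[of A 0 i] \<tau>_le[of A i "n A"] \<tau>_0 \<tau>_n by simp

lemma \<tau>_eq: "A \<in> edges \<Gamma> \<Longrightarrow> i \<le> n A \<Longrightarrow> j \<le> n A \<Longrightarrow>
    \<tau> A i = \<tau> A j \<longleftrightarrow> i = j"
  using \<tau>_less by (metis less_irrefl linorder_neqE_nat)

lemma \<tau>_end: "A \<in> edges \<Gamma> \<Longrightarrow> i \<le> n A \<Longrightarrow> \<tau> A i = 0
    \<longleftrightarrow> i = 0" "A \<in> edges \<Gamma> \<Longrightarrow> i \<le> n A \<Longrightarrow> \<tau> A i = 1
    \<longleftrightarrow> i = n A"
  using \<tau>_eq[of A i 0] \<tau>_eq[of A i "n A"] \<tau>_0 \<tau>_n by auto

lemma piece_subset: "A \<in> edges \<Gamma> \<Longrightarrow> i < n A \<Longrightarrow> piece A i \<subseteq> A"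
  unfolding piece_def using \<tau>_range[of A i] \<tau>_range[of A "Suc i"] in_edge by fastforce

lemma piece_arc:
  assumes "A \<in> edges \<Gamma>" "i < n A"
  shows "simple_arc (piece A i)" "endpoints (piece A i) = {\<gamma> A (\<tau> A i), \<gamma> A (\<tau> A (Suc i))}"
  unfolding piece_def using endpoints_subarc[OF arc] assms \<tau>_range[of A i] \<tau>_range[of A "Suc i"] \<tau>_Suc
  by auto

lemma pieces_cover:
  assumes A: "A \<in> edges \<Gamma>"
  shows "(\<Union>i<n A. piece A i) = A"
proof -
  have "(\<Union>i<k. {\<tau> A i..\<tau> A (Suc i)}) = {0..\<tau> A k}" if "0 < k" "k \<le> n A" for k
    using that
  proof (induction k)
    case (Suc k)
    show ?case
    proof (cases "k = 0")
      case False
      then have "(\<Union>i<k. {\<tau> A i..\<tau> A (Suc i)}) = {0..\<tau> A k}" using Suc by simp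
      then show ?thesis
        using \<tau>_le[OF A, of k "Suc k"] \<tau>_range[OF A, of k] Suc.prems by (auto simp: lessThan_Suc)
    qed (simp add: \<tau>_0[OF A] lessThan_Suc)
  qed simp
  from this[of "n A"] have "(\<Union>i<n A. {\<tau> A i..\<tau> A (Suc i)}) = {0..1}" using \<tau>_n[OF A] n_pos[OF A] by
      simp
  then show ?thesis using img'[OF A] unfolding piece_def by (metis image_UN)
qed

lemma time_in_piece:
  assumes A: "A \<in> edges \<Gamma>" and i: "i < n A" and j: "j \<le> n A" and t: "\<tau> A j \<in> {\<tau> A i..\<tau> A
      (Suc i)}"
  shows "j = i \<or> j = Suc i"
proof (rule ccontr)
  assume "\<not> ?thesis"
  then have "j < i \<or> Suc i < j" by auto
  then show False using \<tau>_less[OF A, of j i] \<tau>_less[OF A, of "Suc i" j] i j t by auto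
qed

lemma piece_verts:
  assumes A: "A \<in> edges \<Gamma>" and i: "i < n A" and x: "x \<in> {\<tau> A i..\<tau> A (Suc i)}" and v: "\<gamma> A x
      \<in> verts refined"
  shows "x = \<tau> A i \<or> x = \<tau> A (Suc i)"
proof -
  have x01: "x \<in> {0..1}" using x \<tau>_range[OF A, of i] \<tau>_range[OF A, of "Suc i"] i by auto
  have old: ?thesis if "\<gamma> A x \<in> verts \<Gamma>"
    using vert_time[OF A x01 that] x \<tau>_range[OF A, of i] \<tau>_range[OF A, of "Suc i"] i by auto
  show ?thesis
  proof (cases "\<gamma> A x \<in> verts \<Gamma>")
    case False
    then obtain B j where B: "B \<in> edges \<Gamma>" "j \<le> n B" "\<gamma> A x = \<gamma> B (\<tau> B j)"
      using v by (auto simp: refined_def)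
    have "A = B"
      using edges_meet[OF A B(1)] in_edge[OF A x01] in_edge[OF B(1) \<tau>_range[OF B(1,2)]] B(3) False by auto
    then have "x = \<tau> A j" using inj[OF A x01, of "\<tau> A j"] \<tau>_range B by simp
    then show ?thesis using time_in_piece[OF A i, of j] x B \<open>A = B\<close> by blast
  qed (rule old)
qed

lemma piece_Int_verts:
  assumes A: "A \<in> edges \<Gamma>" and i: "i < n A"
  shows "piece A i \<inter> verts refined = endpoints (piece A i)"
proof
  show "piece A i \<inter> verts refined \<subseteq> endpoints (piece A i)"
  proof
    fix z assume "z \<in> piece A i \<inter> verts refined"
    then obtain x where "x \<in> {\<tau> A i..\<tau> A (Suc i)}" "z = \<gamma> A x" "\<gamma> A x \<in> verts refined"
      by (auto simp: piece_def)
    then show "z \<in> endpoints (piece A i)" using piece_verts[OF A i] piece_arc(2)[OF A i] by blast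
  qed
  have "\<tau> A i \<le> \<tau> A (Suc i)" using \<tau>_Suc[OF A i] by simp
  moreover have "\<gamma> A (\<tau> A j) \<in> verts refined" if "j \<le> n A" for j
    using that A by (auto simp: refined_def)
  then have "\<gamma> A (\<tau> A i) \<in> verts refined" "\<gamma> A (\<tau> A (Suc i)) \<in> verts refined" using i by auto
  ultimately show "endpoints (piece A i) \<subseteq> piece A i \<inter> verts refined"
    unfolding piece_arc(2)[OF A i] unfolding piece_def by auto
qed

lemma pieces_meet:
  assumes A: "A \<in> edges \<Gamma>" and i: "i < n A" and B: "B \<in> edges \<Gamma>" and j: "j < n B"
    and ne: "(A, i) \<noteq> (B, j)" and z: "z \<in> piece A i" "z \<in> piece B j"
  shows "z \<in> verts refined"
proof (cases "A = B")
  case False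
  then show ?thesis
    using edges_meet[OF A B False] piece_subset[OF A i] piece_subset[OF B j] z by (auto simp: refined_def)
next
  case True
  have *: "z \<in> verts refined" if ij: "i < j" "j < n A" and z: "z \<in> piece A i" "z \<in> piece A j" for i j
  proof -
    obtain x where x: "x \<in> {\<tau> A i..\<tau> A (Suc i)}" "z = \<gamma> A x" using z unfolding piece_def by auto
    obtain y where y: "y \<in> {\<tau> A j..\<tau> A (Suc j)}" "z = \<gamma> A y" using z unfolding piece_def by auto
    have "x \<in> {0..1}" "y \<in> {0..1}"
      using x y \<tau>_range[OF A, of i] \<tau>_range[OF A, of "Suc i"] \<tau>_range[OF A, of j] \<tau>_range[OF A, of "Suc
          j"] ij by auto
    then have "x = y" using inj[OF A] x y by metis
    then have "x = \<tau> A j" using x y \<tau>_le[OF A, of "Suc i" j] ij by auto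
    then show ?thesis using x A ij by (auto simp: refined_def intro: less_imp_le)
  qed
  show ?thesis using *[of i j] *[of j i] ne True i j z by (metis linorder_neqE_nat)
qed

text \<open>Pieces are bare point sets, so counting the edges of \<open>refined\<close> requires
  that different indices give different sets. Coinciding pieces would consist of vertices only,
  hence be finite, but a nondegenerate piece is infinite.\<close>

lemma piece_inj:
  assumes A: "A \<in> edges \<Gamma>" and i: "i < n A" and B: "B \<in> edges \<Gamma>" and j: "j < n B"
    and eq: "piece A i = piece B j"
  shows "A = B" "i = j"
proof -
  have "(A, i) = (B, j)"
  proof (rule ccontr)
    assume "(A, i) \<noteq> (B, j)"
    then have "piece A i \<subseteq> verts refined" using pieces_meet[OF A i B j] eq by blast
    then have "finite (piece A i)" using piece_Int_verts[OF A i] piece_arc[OF A i]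
      by (metis finite.emptyI finite_insert inf.absorb_iff1)
    moreover have "inj_on (\<gamma> A) {\<tau> A i..\<tau> A (Suc i)}"
      using arc_imp_inj_on[OF arc[OF A]] \<tau>_range[OF A, of i] \<tau>_range[OF A, of "Suc i"] i
      by (elim inj_on_subset) auto
    ultimately have "finite {\<tau> A i..\<tau> A (Suc i)}" unfolding piece_def using finite_imageD by blast
    then show False using \<tau>_Suc[OF A i] infinite_Icc by blast
  qed
  then show "A = B" "i = j" by auto
qed

lemma support_refined: "support refined = support \<Gamma>"
proof -
  have "\<Union> (edges refined) = (\<Union>A\<in>edges \<Gamma>. \<Union>i<n A. piece A i)" by (auto simp: refined_def)
  also have "\<dots> = \<Union> (edges \<Gamma>)" using pieces_cover by auto
  finally have "\<Union> (edges refined) = \<Union> (edges \<Gamma>)" .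
  moreover have "verts \<Gamma> \<subseteq> verts refined" "verts refined \<subseteq> verts \<Gamma> \<union> \<Union>
      (edges \<Gamma>)"
    using in_edge \<tau>_range by (auto simp: refined_def)
  ultimately show ?thesis unfolding support_def by blast
qed

lemma refined_graph: "continuous_graph refined"
  unfolding continuous_graph_def
proof (intro conjI ballI impI)
  have "{\<gamma> A (\<tau> A i) |A i. A \<in> edges \<Gamma> \<and> i \<le> n A} = (\<Union>A\<in>edges \<Gamma>.
      (\<lambda>i. \<gamma> A (\<tau> A i)) ` {..n A})" by auto
  then show "finite (verts refined)" using finite_graph by (simp add: refined_def)
  show "verts refined \<noteq> {}" using graph by (auto simp: refined_def continuous_graph_def)
  have "edges refined = (\<Union>A\<in>edges \<Gamma>. piece A ` {..<n A})" by (auto simp: refined_def)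
  then show "finite (edges refined)" using finite_graph by simp
  show "connected (support refined)"
    using graph by (simp add: support_refined continuous_graph_def)
  fix C assume "C \<in> edges refined"
  then obtain A i where C: "C = piece A i" "A \<in> edges \<Gamma>" "i < n A" by (auto simp: refined_def)
  show "simple_arc C" using piece_arc C by simp
  show "C \<inter> verts refined = endpoints C" using piece_Int_verts C by simp
  fix D assume "D \<in> edges refined" and "C \<noteq> D"
  moreover from this obtain B j where D: "D = piece B j" "B \<in> edges \<Gamma>" "j < n B" by (auto simp: refined_def)
  ultimately have "C \<inter> D \<subseteq> verts refined"
    using pieces_meet[OF C(2,3) D(2,3)] C D by blast
  then show "C \<inter> D \<subseteq> endpoints C \<inter> endpoints D"
    using piece_Int_verts[OF C(2,3)] piece_Int_verts[OF D(2,3)] C(1) D(1) by blast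
qed

lemma valence_old:
  assumes q: "q \<in> verts \<Gamma>"
  shows "valence refined q = valence \<Gamma> q"
proof -
  \<comment> \<open>The two ends of an edge are different points, so an edge at \<open>q\<close> has
    exactly one piece there: its first if it starts at \<open>q\<close>, otherwise its last.\<close>
  define k where "k A = (if \<gamma> A 0 = q then 0 else n A - 1)" for A
  have k: "k A < n A" if "A \<in> edges \<Gamma>" for A using n_pos[OF that] by (simp add: k_def)
  have "bij_betw (\<lambda>A. piece A (k A)) (edges_at \<Gamma> q) (edges_at refined q)"
    unfolding bij_betw_def
  proof
    show "inj_on (\<lambda>A. piece A (k A)) (edges_at \<Gamma> q)"
    proof (rule inj_onI)
      fix A B assume "A \<in> edges_at \<Gamma> q" "B \<in> edges_at \<Gamma> q" "piece A (k A) = piece B (k B)"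
      then show "A = B" using piece_inj(1)[OF _ k _ k] by (simp add: edges_at_def)
    qed
    show "(\<lambda>A. piece A (k A)) ` edges_at \<Gamma> q = edges_at refined q"
    proof
      show "(\<lambda>A. piece A (k A)) ` edges_at \<Gamma> q \<subseteq> edges_at refined q"
      proof clarify
        fix A assume "A \<in> edges_at \<Gamma> q"
        then have A: "A \<in> edges \<Gamma>" and e: "q = \<gamma> A 0 \<or> q = \<gamma> A 1" using ends by (auto simp:
            edges_at_def)
        have "q = \<gamma> A (\<tau> A (k A)) \<or> q = \<gamma> A (\<tau> A (Suc (k A)))"
          using e \<tau>_0[OF A] \<tau>_n[OF A] n_pos[OF A] by (auto simp: k_def)
        then show "piece A (k A) \<in> edges_at refined q"
          using A k[OF A] piece_arc[OF A k[OF A]] by (auto simp: edges_at_def refined_def)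
      qed
      show "edges_at refined q \<subseteq> (\<lambda>A. piece A (k A)) ` edges_at \<Gamma> q"
      proof
        fix C assume "C \<in> edges_at refined q"
        then obtain A i where C: "C = piece A i" "A \<in> edges \<Gamma>" "i < n A" "q \<in> endpoints (piece A i)"
          by (auto simp: edges_at_def refined_def)
        then obtain j where j: "j = i \<or> j = Suc i" "q = \<gamma> A (\<tau> A j)" using piece_arc[OF C(2,3)] by auto
        then have jn: "j \<le> n A" using C by auto
        then have "\<tau> A j = 0 \<or> \<tau> A j = 1" using vert_time[OF C(2) \<tau>_range[OF C(2)]] j q by auto
        then have e: "j = 0 \<and> q = \<gamma> A 0 \<or> j = n A \<and> q = \<gamma> A 1" using \<tau>_end[OF C(2) jn] j(2)
            by auto
        moreover have "\<gamma> A 0 \<noteq> \<gamma> A 1" using inj[OF C(2)] by auto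
        ultimately have "i = k A" using j C(3) by (auto simp: k_def)
        moreover have "A \<in> edges_at \<Gamma> q" using C(2) ends[OF C(2)] e by (auto simp: edges_at_def)
        ultimately show "C \<in> (\<lambda>A. piece A (k A)) ` edges_at \<Gamma> q" using C(1) by blast
      qed
    qed
  qed
  then show ?thesis unfolding valence_def by (metis bij_betw_same_card)
qed

lemma new_vertex:
  assumes A: "A \<in> edges \<Gamma>" and k: "0 < k" "k < n A"
  shows "edges_at refined (\<gamma> A (\<tau> A k)) = {piece A (k - 1), piece A k}"
    and "\<gamma> A (\<tau> A k) \<notin> verts \<Gamma>"
    and "valence refined (\<gamma> A (\<tau> A k)) = 2"
proof -
  let ?q = "\<gamma> A (\<tau> A k)"
  have k01: "\<tau> A k \<in> {0..1}" using \<tau>_range[OF A] k by simp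
  show new: "?q \<notin> verts \<Gamma>"
    using vert_time[OF A k01] \<tau>_end[OF A, of k] k by auto
  show eq: "edges_at refined ?q = {piece A (k - 1), piece A k}"
  proof
    show "{piece A (k - 1), piece A k} \<subseteq> edges_at refined ?q"
    proof -
      have k': "k - 1 < n A" using k by simp
      have "piece A k \<in> edges refined" "piece A (k - 1) \<in> edges refined"
        using A k(2) k' unfolding refined_def by auto
      then show ?thesis using piece_arc(2)[OF A k(2)] piece_arc(2)[OF A k'] k by (simp add: edges_at_def)
    qed
    show "edges_at refined ?q \<subseteq> {piece A (k - 1), piece A k}"
    proof
      fix C assume "C \<in> edges_at refined ?q"
      then obtain B i where C: "C = piece B i" "B \<in> edges \<Gamma>" "i < n B" "?q \<in> endpoints (piece B i)"
        by (auto simp: edges_at_def refined_def)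
      then obtain j where j: "j = i \<or> j = Suc i" "?q = \<gamma> B (\<tau> B j)" using piece_arc[OF C(2,3)] by auto
      then have jn: "j \<le> n B" using C by auto
      have "A = B"
        using edges_meet[OF A C(2)] in_edge[OF A k01] in_edge[OF C(2) \<tau>_range[OF C(2) jn]] j(2) new by auto
      then have "\<tau> A k = \<tau> A j" using inj[OF A k01, of "\<tau> A j"] \<tau>_range[OF C(2) jn] j(2) by simp
      then have "k = j" using \<tau>_eq[OF A, of k j] k jn \<open>A = B\<close> by simp
      then show "C \<in> {piece A (k - 1), piece A k}" using j(1) C(1) \<open>A = B\<close> by auto
    qed
  qed
  have "piece A (k - 1) \<noteq> piece A k" using piece_inj(2)[OF A _ A, of "k - 1" k] k by fastforce
  then show "valence refined ?q = 2" unfolding valence_def eq by simp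
qed

lemma refined_verts_cases:
  assumes "q \<in> verts refined"
  obtains "q \<in> verts \<Gamma>" | A k where "A \<in> edges \<Gamma>" "0 < k" "k < n A" "q = \<gamma> A (\<tau> A k)"
proof (cases "q \<in> verts \<Gamma>")
  case False
  then obtain A k where A: "A \<in> edges \<Gamma>" "k \<le> n A" "q = \<gamma> A (\<tau> A k)" using assms by (auto simp:
      refined_def)
  then have "k \<noteq> 0" "k \<noteq> n A" using False end_vert[OF A(1)] \<tau>_0[OF A(1)] \<tau>_n[OF A(1)] by metis+
  then show thesis using that(2) A by simp
qed (rule that)

lemma topological_verts_refined: "topological_verts refined = topological_verts \<Gamma>"
proof -
  have "verts \<Gamma> \<subseteq> verts refined" by (auto simp: refined_def)
  then show ?thesis unfolding topological_verts_def
    using valence_old new_vertex(3) by (auto elim: refined_verts_cases)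
qed

end

section \<open>Chord graphs and a criterion for approximating graphs\<close>

definition chord :: "(real^3) set \<Rightarrow> (real^3) set" where
  "chord A = convex hull (endpoints A)"

definition chord_graph :: "space_graph \<Rightarrow> space_graph" where
  "chord_graph \<Gamma> = \<lparr>verts = verts \<Gamma>, edges = chord ` edges \<Gamma>\<rparr>"

lemma topological_edge_path_image:
  assumes F: "continuous_on (support \<Gamma>) F" "inj_on F (support \<Gamma>)" "F ` support \<Gamma> \<subseteq> support P"
    and tv: "topological_verts P = topological_verts \<Gamma>" and fixed: "\<And>v. v \<in> topological_verts \<Gamma>
        \<Longrightarrow> F v = v"
    and g: "topological_edge_path \<Gamma> g"
  shows "topological_edge_path P (F \<circ> g)"
proof -
  have sub: "path_image g \<subseteq> support \<Gamma>" and g': "simple_path g"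
    using g unfolding topological_edge_path_def by auto
  have tsub: "topological_verts \<Gamma> \<subseteq> support \<Gamma>" by (auto simp: topological_verts_def support_def)
  have "simple_path (F \<circ> g)"
    using simple_path_continuous_image[OF g'] continuous_on_subset[OF F(1) sub] inj_on_subset[OF F(2) sub] by blast
  moreover have "path_image (F \<circ> g) \<subseteq> support P"
    using sub F(3) by (auto simp: path_image_compose)
  moreover have "(F \<circ> g) ` {0<..<1} \<inter> topological_verts \<Gamma> = {}"
  proof -
    have "F (g t) \<notin> topological_verts \<Gamma>" if t: "t \<in> {0<..<1}" for t
    proof
      assume v: "F (g t) \<in> topological_verts \<Gamma>"
      have "g t \<in> support \<Gamma>" using sub t unfolding path_image_def by (auto simp: image_subset_iff)
      then have "g t = F (g t)" using F(2) fixed[OF v] v tsub by (metis inj_onD subsetD)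
      then show False using g v t unfolding topological_edge_path_def by (metis IntI empty_iff imageI)
    qed
    then show ?thesis by auto
  qed
  moreover have "if topological_verts \<Gamma> = {} then pathfinish (F \<circ> g) = pathstart (F \<circ> g)
      else {pathstart (F \<circ> g), pathfinish (F \<circ> g)} \<subseteq> topological_verts \<Gamma>"
    using g fixed unfolding topological_edge_path_def
    by (auto simp: pathstart_compose pathfinish_compose split: if_splits)
  ultimately show ?thesis unfolding topological_edge_path_def tv by blast
qed

text \<open>Composition with \<open>F\<close> and \<open>F'\<close> exchanges the topological edge
  paths of the two graphs, so \<open>image F\<close> is the required bijection. That
  \<open>F\<close> fixes the vertices of \<open>P\<close> gives both the common ends and the order
  along each edge.\<close>

lemma approximatingI:
  assumes P: "polygonal_graph P"
    and tv: "topological_verts P = topological_verts \<Gamma>"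
    and val: "\<And>q. q \<in> topological_verts \<Gamma> \<Longrightarrow> valence P q = valence \<Gamma> q"
    and F: "homeomorphism (support \<Gamma>) (support P) F F'"
    and fixed: "\<And>v. v \<in> verts P \<Longrightarrow> v \<in> support \<Gamma> \<and> F v = v"
  shows "approximating \<Gamma> P"
proof -
  have F1: "continuous_on (support \<Gamma>) F" "F ` support \<Gamma> = support P" and injF: "inj_on F (support \<Gamma>)"
    and F2: "continuous_on (support P) F'" "F' ` support P = support \<Gamma>" and injF': "inj_on F' (support P)"
    and FF': "\<And>y. y \<in> support P \<Longrightarrow> F (F' y) = y" and F'F: "\<And>x. x \<in> support \<Gamma>
        \<Longrightarrow> F' (F x) = x"
    using F unfolding homeomorphism_def by (auto intro: inj_on_inverseI)
  have tvP: "topological_verts \<Gamma> \<subseteq> verts P" unfolding tv[symmetric] by (auto simp: topological_verts_def)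
  have fixed': "F' v = v" if "v \<in> topological_verts \<Gamma>" for v
    using fixed[of v] that tvP F'F by (metis subsetD)
  have imgs: "topological_edge_path P (F \<circ> g)" if "topological_edge_path \<Gamma> g" for g
    using topological_edge_path_image[OF F1(1) injF _ tv _ that] F1(2) fixed tvP by blast
  have imgs': "topological_edge_path \<Gamma> (F' \<circ> h)" if "topological_edge_path P h" for h
    using topological_edge_path_image[OF F2(1) injF' _ tv[symmetric] _ that] F2(2) fixed' tv by auto
  have sub: "A \<subseteq> support \<Gamma>" if "A \<in> topological_edges \<Gamma>" for A
    using that unfolding topological_edges_def topological_edge_path_def by auto
  have "bij_betw (image F) (topological_edges \<Gamma>) (topological_edges P)"
    unfolding bij_betw_def
  proof
    show "inj_on (image F) (topological_edges \<Gamma>)"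
    proof (rule inj_onI)
      fix A B assume "A \<in> topological_edges \<Gamma>" "B \<in> topological_edges \<Gamma>" "F ` A = F ` B"
      then show "A = B" using inj_on_image_eq_iff[OF injF sub sub] by simp
    qed
    show "image F ` topological_edges \<Gamma> = topological_edges P"
    proof
      show "image F ` topological_edges \<Gamma> \<subseteq> topological_edges P"
      proof
        fix B assume "B \<in> image F ` topological_edges \<Gamma>"
        then obtain g where g: "B = F ` path_image g" "topological_edge_path \<Gamma> g"
          unfolding topological_edges_def by auto
        then have "B = path_image (F \<circ> g)" by (simp add: path_image_compose)
        then show "B \<in> topological_edges P" using imgs[OF g(2)] unfolding topological_edges_def by blast
      qed
      show "topological_edges P \<subseteq> image F ` topological_edges \<Gamma>"
      proof
        fix B assume "B \<in> topological_edges P"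
        then obtain h where h: "B = path_image h" "topological_edge_path P h"
          unfolding topological_edges_def by auto
        have "path_image h \<subseteq> support P" using h(2) unfolding topological_edge_path_def by simp
        then have "F ` path_image (F' \<circ> h) = B"
          unfolding path_image_compose h(1) image_comp using FF' by (force simp: image_iff)
        moreover have "path_image (F' \<circ> h) \<in> topological_edges \<Gamma>"
          using imgs'[OF h(2)] unfolding topological_edges_def by blast
        ultimately show "B \<in> image F ` topological_edges \<Gamma>" by blast
      qed
    qed
  qed
  moreover have "\<exists>g h. topological_edge_path \<Gamma> g \<and> path_image g = A \<and> topological_edge_path P h
      \<and>
      path_image h = F ` A \<and> (\<forall>t\<in>{0..1}. h t \<in> verts P \<longrightarrow> g t = h t)"
    if A: "A \<in> topological_edges \<Gamma>" for A
  proof -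
    obtain g where g: "A = path_image g" "topological_edge_path \<Gamma> g" using A unfolding topological_edges_def by auto
    \<comment> \<open>\<open>F\<close> fixes the vertex \<open>F (g t)\<close>, so by injectivity
      this vertex is \<open>g t\<close> itself: \<open>g\<close> and its composition with
      \<open>F\<close> pass it at the same time.\<close>
    have "g t = F (g t)" if t: "t \<in> {0..1}" and v: "F (g t) \<in> verts P" for t
    proof -
      have "g t \<in> support \<Gamma>" using sub[OF A] g(1) t unfolding path_image_def by blast
      moreover have "F (F (g t)) = F (g t)" "F (g t) \<in> support \<Gamma>" using fixed[OF v] by auto
      ultimately show ?thesis using inj_onD[OF injF, of "F (g t)" "g t"] by simp
    qed
    then show ?thesis using g imgs[OF g(2)]
      by (intro exI[of _ g] exI[of _ "F \<circ> g"]) (auto simp: path_image_compose)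
  qed
  ultimately show ?thesis unfolding approximating_def using P tv val by blast
qed

context parametrized_graph
begin

lemma chord_eq: "A \<in> edges \<Gamma> \<Longrightarrow> chord A = closed_segment (\<gamma> A 0) (\<gamma> A 1)"
  by (simp add: chord_def ends segment_convex_hull)

lemma ends_ne: "A \<in> edges \<Gamma> \<Longrightarrow> \<gamma> A 0 \<noteq> \<gamma> A 1"
  using inj[of A 0 1] by auto

lemma chord_endpoints: "A \<in> edges \<Gamma> \<Longrightarrow> simple_arc (chord A) \<and> endpoints (chord A) = endpoints
    A"
  using endpoints_closed_segment[OF ends_ne] by (simp add: chord_eq ends)

lemma edge_to_chord:
  assumes A: "A \<in> edges \<Gamma>"
  shows "\<exists>f. continuous_on A f \<and> inj_on f A \<and> f ` A = chord A \<and> (\<forall>v\<in>endpoints A. f v = v)"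
proof -
  obtain k where k: "homeomorphism {0..1} A (\<gamma> A) k" using homeomorphism_arc[OF arc[OF A]] img[OF A] by auto
  define f where "f = linepath (\<gamma> A 0) (\<gamma> A 1) \<circ> k"
  have kA: "k ` A = {0..1}" "inj_on k A" "continuous_on A k" and k\<gamma>: "\<And>x. x \<in> {0..1} \<Longrightarrow> k
      (\<gamma> A x) = x"
    using k unfolding homeomorphism_def by (auto intro: inj_on_inverseI)
  have L: "arc (linepath (\<gamma> A 0) (\<gamma> A 1))" using ends_ne[OF A] by simp
  have "continuous_on A f" unfolding f_def
    using kA by (intro continuous_on_compose) (auto intro: continuous_on_linepath)
  moreover have "inj_on f A" unfolding f_def
    using kA arc_imp_inj_on[OF L] by (intro comp_inj_on) auto
  moreover have "f ` A = chord A" unfolding f_def image_comp[symmetric] kA(1) chord_eq[OF A]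
    by (simp add: path_image_def[symmetric] path_image_linepath)
  moreover have "f v = v" if "v \<in> endpoints A" for v
    using that k\<gamma> by (auto simp: ends[OF A] f_def linepath_def)
  ultimately show ?thesis by blast
qed

text \<open>Maps of the edges onto their chords fix the end points, hence glue to one continuous
  map. It is injective because chords meet only where the edges do, and compactness makes it a
  homeomorphism of the supports.\<close>

lemma chord_graph_polygonal:
  assumes cc: "\<And>A B. A \<in> edges \<Gamma> \<Longrightarrow> B \<in> edges \<Gamma> \<Longrightarrow> A \<noteq> B
      \<Longrightarrow> chord A \<inter> chord B \<subseteq> endpoints A \<inter> endpoints B"
    and cv: "\<And>A. A \<in> edges \<Gamma> \<Longrightarrow> chord A \<inter> verts \<Gamma> \<subseteq> endpoints A"
  shows "polygonal_graph (chord_graph \<Gamma>)"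
    and "\<And>q. edges_at (chord_graph \<Gamma>) q = chord ` edges_at \<Gamma> q"
    and "inj_on chord (edges \<Gamma>)"
    and "\<exists>F F'. homeomorphism (support \<Gamma>) (support (chord_graph \<Gamma>)) F F' \<and> (\<forall>v\<in>verts
        \<Gamma>. F v = v)"
proof -
  show "edges_at (chord_graph \<Gamma>) q = chord ` edges_at \<Gamma> q" for q
    using chord_endpoints by (auto simp: edges_at_def chord_graph_def)
  show "inj_on chord (edges \<Gamma>)"
  \<comment> \<open>Different edges with one chord would, by \<open>cc\<close>, have a chord
    contained in its two end points.\<close>
  proof (rule inj_onI, rule ccontr)
    fix A B assume AB: "A \<in> edges \<Gamma>" "B \<in> edges \<Gamma>" "chord A = chord B" "A \<noteq> B"
    then have "chord A \<subseteq> endpoints A" using cc by blast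
    then have "finite (chord A)" using ends[OF AB(1)] by (simp add: finite_subset)
    then show False using ends_ne[OF AB(1)] by (simp add: chord_eq[OF AB(1)])
  qed
  obtain f where f: "\<And>A. A \<in> edges \<Gamma> \<Longrightarrow> continuous_on A (f A) \<and> inj_on (f A) A \<and> f
      A ` A = chord A \<and> (\<forall>v\<in>endpoints A. f A v = v)"
    using edge_to_chord by metis
  define F where "F x = (if x \<in> verts \<Gamma> then x else f (SOME A. A \<in> edges \<Gamma> \<and> x \<in> A) x)" for x
  note AV = edge_Int_verts
  \<comment> \<open>The chosen edge does not matter: different edges meet only at vertices, where
    all the maps are the identity.\<close>
  have FA: "F x = f A x" if "A \<in> edges \<Gamma>" "x \<in> A" for A x
  proof (cases "x \<in> verts \<Gamma>")
    case True
    then have "x \<in> endpoints A" using AV[OF that(1)] that(2) by blast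
    then show ?thesis using f[OF that(1)] True by (simp add: F_def)
  next
    case False
    have "(SOME A. A \<in> edges \<Gamma> \<and> x \<in> A) = A"
      using that edges_meet False by (intro some_equality) blast+
    then show ?thesis using False by (simp add: F_def)
  qed
  have FV: "F v = v" if "v \<in> verts \<Gamma>" for v using that by (simp add: F_def)
  have contF: "continuous_on (support \<Gamma>) F"
  proof -
    have "continuous_on (\<Union>A\<in>edges \<Gamma>. A) F"
    proof (rule continuous_on_closed_Union[OF finite_graph(2)])
      fix A assume A: "A \<in> edges \<Gamma>"
      show "closed A" using closed_arc_image[OF arc[OF A]] img[OF A] by simp
      show "continuous_on A F" using f[OF A] FA[OF A] by (simp cong: continuous_on_cong_simp)
    qed
    moreover have "closed (\<Union>A\<in>edges \<Gamma>. A)"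
      using finite_graph(2) closed_arc_image[OF arc] img by (intro closed_UN) auto
    moreover have "continuous_on (verts \<Gamma>) F" "closed (verts \<Gamma>)"
      using finite_graph(1) by (auto intro: continuous_on_finite finite_imp_closed)
    ultimately show ?thesis unfolding support_def using continuous_on_closed_Un[of "verts \<Gamma>" "\<Union>A\<in>edges
        \<Gamma>. A" F] by simp
  qed
  have imgF: "F ` support \<Gamma> = support (chord_graph \<Gamma>)"
  proof -
    have "F ` A = chord A" if "A \<in> edges \<Gamma>" for A using f[OF that] FA[OF that] by (metis image_cong)
    moreover have "F ` verts \<Gamma> = verts \<Gamma>" using FV by force
    ultimately show ?thesis unfolding support_def chord_graph_def by (auto simp: image_Un image_Union)
  qed
  have injF: "inj_on F (support \<Gamma>)"
  proof -
    have vA: "v \<in> A" if "A \<in> edges \<Gamma>" "v \<in> endpoints A" for A v using AV that by blast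
    have *: "x = y" if "A \<in> edges \<Gamma>" "x \<in> A" "y \<in> verts \<Gamma>" "F x = F y" for A x y
    proof -
      have "F x \<in> chord A" using f[OF that(1)] FA[OF that(1,2)] that(2) by auto
      then have y: "y \<in> endpoints A" using that cv FV by auto
      then have "f A x = f A y" using that FA[OF that(1) vA[OF that(1) y]] FA[OF that(1,2)] by simp
      then show ?thesis using f[OF that(1)] that(2) vA[OF that(1) y] by (meson inj_onD)
    qed
    have **: "x = y" if A: "A \<in> edges \<Gamma>" "x \<in> A" and B: "B \<in> edges \<Gamma>" "y \<in> B" and eq: "F x = F
        y" for A B x y
    proof (cases "A = B")
      case True
      then show ?thesis using f[OF A(1)] FA[OF A] FA[OF B] A B eq by (metis inj_onD)
    next
      case False
      have x: "F x \<in> chord A" using f[OF A(1)] FA[OF A] A(2) by auto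
      have y: "F y \<in> chord B" using f[OF B(1)] FA[OF B] B(2) by auto
      have "F x \<in> endpoints A \<inter> endpoints B" using x y eq cc[OF A(1) B(1) False] by auto
      then have v: "F x \<in> verts \<Gamma>" using AV[OF A(1)] by blast
      then have "F (F x) = F x" using FV by blast
      then have "x = F x" "y = F x" using *[OF A v] *[OF B v] eq by auto
      then show ?thesis by simp
    qed
    show ?thesis
    proof (rule inj_onI)
      fix x y assume xy: "x \<in> support \<Gamma>" "y \<in> support \<Gamma>" "F x = F y"
      then show "x = y" unfolding support_def using * ** FV by (metis UnE UnionE)
    qed
  qed
  have comp: "compact (support \<Gamma>)"
  proof -
    have "compact A" if "A \<in> edges \<Gamma>" for A using compact_arc_image[OF arc[OF that]] img[OF that] by simp
    then show ?thesis unfolding support_def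
      by (intro compact_Un finite_imp_compact[OF finite_graph(1)] compact_Union finite_graph(2))
  qed
  obtain F' where "homeomorphism (support \<Gamma>) (support (chord_graph \<Gamma>)) F F'"
    using homeomorphism_compact[OF comp contF imgF injF] by blast
  then show "\<exists>F F'. homeomorphism (support \<Gamma>) (support (chord_graph \<Gamma>)) F F' \<and>
      (\<forall>v\<in>verts \<Gamma>. F v = v)"
    using FV by blast
  have "connected (support \<Gamma>)" using graph unfolding continuous_graph_def by simp
  then have conn: "connected (support (chord_graph \<Gamma>))"
    using connected_continuous_image[OF contF] imgF by simp
  show "polygonal_graph (chord_graph \<Gamma>)"
    unfolding polygonal_graph_def continuous_graph_def
  proof (intro conjI ballI impI)
    show "finite (verts (chord_graph \<Gamma>))" "finite (edges (chord_graph \<Gamma>))" "verts (chord_graph \<Gamma>)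
        \<noteq> {}"
      using finite_graph graph by (auto simp: chord_graph_def continuous_graph_def)
    fix C assume "C \<in> edges (chord_graph \<Gamma>)"
    then obtain A where A: "A \<in> edges \<Gamma>" "C = chord A" by (auto simp: chord_graph_def)
    show "simple_arc C" using chord_endpoints A by simp
    show "\<exists>a b. C = closed_segment a b" using chord_eq A by blast
    have "endpoints A \<subseteq> chord A" unfolding chord_def by (rule hull_subset)
    then show "C \<inter> verts (chord_graph \<Gamma>) = endpoints C"
      using cv[OF A(1)] AV[OF A(1)] chord_endpoints[OF A(1)] A(2) by (auto simp: chord_graph_def)
    fix D assume D: "D \<in> edges (chord_graph \<Gamma>)" "C \<noteq> D"
    then obtain B where B: "B \<in> edges \<Gamma>" "D = chord B" by (auto simp: chord_graph_def)
    show "C \<inter> D \<subseteq> endpoints C \<inter> endpoints D"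
      using cc[OF A(1) B(1)] chord_endpoints[OF A(1)] chord_endpoints[OF B(1)] A B D(2) by auto
  qed (use conn in simp)
qed

end

section \<open>Embedded approximating graphs of small mesh\<close>

lemma dist_add_segment:
  fixes a :: "'a::euclidean_space"
  shows "z \<in> closed_segment a c \<Longrightarrow> dist a c = dist a z + dist z c"
  by (metis between between_mem_segment)

text \<open>Triangle inequalities at the crossing point: the diagonals of a quadrilateral are
  together at least as long as two opposite sides.\<close>

lemma crossing_segments:
  fixes a :: "'a::euclidean_space"
  assumes "z \<in> closed_segment a c" "z \<in> closed_segment b d"
  shows "dist a b + dist c d \<le> dist a c + dist b d"
  using dist_add_segment[OF assms(1)] dist_add_segment[OF assms(2)]
    dist_triangle[of a b z] dist_triangle[of c d z]
  by (simp add: dist_commute)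

text \<open>Both segments lie on the ray from \<open>x\<close> through \<open>z\<close>, so the
  shorter one is contained in the longer one.\<close>

lemma overlapping_segments:
  fixes x :: "'a::euclidean_space"
  assumes "z \<in> closed_segment x y" "z \<in> closed_segment x y'" "z \<noteq> x"
  shows "y \<in> closed_segment x y' \<or> y' \<in> closed_segment x y"
proof -
  have *: "v \<in> closed_segment x w"
    if st: "s \<le> t" "0 < s" "t \<le> 1" "s *\<^sub>R (w - x) = t *\<^sub>R (v - x)" for s t v w
  proof -
    have "v - x = (1/t) *\<^sub>R (t *\<^sub>R (v - x))" using st by simp
    also have "\<dots> = (s/t) *\<^sub>R (w - x)" unfolding st(4)[symmetric] by simp
    finally have "v = x + (s/t) *\<^sub>R (w - x)" by (simp add: algebra_simps)
    then have "v = (1 - s/t) *\<^sub>R x + (s/t) *\<^sub>R w" by (simp add: algebra_simps)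
    then show ?thesis using st by (auto simp: in_segment intro!: exI[of _ "s/t"])
  qed
  obtain s where s: "0 \<le> s" "s \<le> 1" "z = x + s *\<^sub>R (y - x)"
    using assms(1) by (auto simp: in_segment algebra_simps)
  obtain t where t: "0 \<le> t" "t \<le> 1" "z = x + t *\<^sub>R (y' - x)"
    using assms(2) by (auto simp: in_segment algebra_simps)
  have "0 < s" "0 < t" using s t assms(3) by (auto simp: less_le)
  moreover have "s *\<^sub>R (y - x) = t *\<^sub>R (y' - x)" using s t by simp
  ultimately show ?thesis using *[of s t y y'] *[of t s y' y] s t by (cases "s \<le> t") auto
qed

text \<open>
  Segments of two kinds: between two nodes at distance at most \<open>\<delta>\<close>, or from a vertex to a node at
  distance exactly \<open>\<epsilon>\<close>. They only meet at common end points because two crossing segments would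
  produce three nodes that are pairwise at distance at most \<open>\<delta>\<close>.
\<close>

locale segment_net =
  fixes V N :: "('a::euclidean_space) set" and \<epsilon> \<delta> :: real
  assumes pos: "0 < \<epsilon>" "0 < \<delta>" "\<delta> \<le> \<epsilon>"
    and VV: "q \<in> V \<Longrightarrow> q' \<in> V \<Longrightarrow> q \<noteq> q' \<Longrightarrow> 2 * \<epsilon> < dist
        q q'"
    and VN: "q \<in> V \<Longrightarrow> x \<in> N \<Longrightarrow> \<epsilon> \<le> dist q x"
    and triangle_free: "x \<in> N \<Longrightarrow> y \<in> N \<Longrightarrow> z \<in> N \<Longrightarrow> x \<noteq> y
        \<Longrightarrow> y \<noteq> z \<Longrightarrow> x \<noteq> z \<Longrightarrow>
       dist x y \<le> \<delta> \<Longrightarrow> dist y z \<le> \<delta> \<Longrightarrow> \<not> dist x z \<le> \<delta>"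
begin

text \<open>Unordered pairs, so that a segment and its reverse are the same link; the segment itself
  is the convex hull of the pair.\<close>

definition link :: "'a set \<Rightarrow> bool" where
  "link e \<longleftrightarrow> (\<exists>x y. e = {x, y} \<and> x \<noteq> y \<and> x \<in> N \<and> y \<in> N \<and> dist
      x y \<le> \<delta>) \<or>
     (\<exists>q x. e = {q, x} \<and> q \<in> V \<and> x \<in> N \<and> dist q x = \<epsilon>)"

text \<open>If the four nodes are different, \<open>crossing_segments\<close> applied to both
  pairings gives two further short sides. These share a node and close a forbidden triangle with one
  of the segments. If a node is shared, an overlap would make the third side short as well.\<close>

lemma short_short:
  assumes e: "x \<in> N" "y \<in> N" "x \<noteq> y" "dist x y \<le> \<delta>" and e': "x' \<in> N" "y' \<in> N" "x' \<noteq>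
      y'" "dist x' y' \<le> \<delta>"
    and ne: "{x, y} \<noteq> {x', y'}" and z: "z \<in> closed_segment x y" "z \<in> closed_segment x' y'"
  shows "z \<in> {x, y} \<inter> {x', y'}"
proof -
  have shared: "z = u" if "z \<in> closed_segment u v" "z \<in> closed_segment u v'"
      "u \<in> N" "v \<in> N" "v' \<in> N" "u \<noteq> v" "u \<noteq> v'" "v \<noteq> v'" "dist u v \<le> \<delta>" "dist u
          v' \<le> \<delta>" for u v v'
  proof (rule ccontr)
    assume "z \<noteq> u"
    from overlapping_segments[OF that(1,2) this] have "dist v v' \<le> \<delta>"
    proof
      assume "v \<in> closed_segment u v'"
      from dist_add_segment[OF this] show ?thesis using that(10) zero_le_dist[of u v] by linarith
    next
      assume "v' \<in> closed_segment u v"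
      from dist_add_segment[OF this] show ?thesis using that(9) zero_le_dist[of u v'] dist_commute[of v v'] by linarith
    qed
    then show False using triangle_free[of v u v'] that by (simp add: dist_commute)
  qed
  have z': "z \<in> closed_segment y' x'" and zy: "z \<in> closed_segment y x"
    using z by (simp_all add: closed_segment_commute)
  have yx: "dist y x \<le> \<delta>" "dist y' x' \<le> \<delta>" using e e' by (simp_all add: dist_commute)
  show ?thesis
  proof (cases "{x, y} \<inter> {x', y'} = {}")
    case True
    then have d: "x \<noteq> x'" "x \<noteq> y'" "y \<noteq> x'" "y \<noteq> y'" by auto
    have "dist x x' \<le> \<delta> \<or> dist y y' \<le> \<delta>" using crossing_segments[OF z] e e' by linarith
    moreover have "dist x y' \<le> \<delta> \<or> dist y x' \<le> \<delta>"
      using crossing_segments[OF z(1) z'] e yx by linarith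
    ultimately consider "dist x x' \<le> \<delta>" "dist x y' \<le> \<delta>" | "dist x x' \<le> \<delta>" "dist y x' \<le>
        \<delta>"
      | "dist y y' \<le> \<delta>" "dist x y' \<le> \<delta>" | "dist y y' \<le> \<delta>" "dist y x' \<le> \<delta>" by
          blast
    then have False
    proof cases
      case 1
      then show ?thesis using triangle_free[of x x' y'] e e' d by blast
    next
      case 2
      then show ?thesis using triangle_free[of x y x'] e e' d by blast
    next
      case 3
      then show ?thesis using triangle_free[of x y y'] e e' d by blast
    next
      case 4
      then show ?thesis using triangle_free[of y x' y'] e e' d by blast
    qed
    then show ?thesis ..
  next
    case False
    then consider "x = x'" "y \<noteq> y'" | "x = y'" "y \<noteq> x'" | "y = x'" "x \<noteq> y'" | "y = y'" "x \<noteq> x'"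
      using ne by auto
    then show ?thesis
    proof cases
      case 1
      then show ?thesis using shared[of x y y'] z e e' by blast
    next
      case 2
      then show ?thesis using shared[of x y x'] z(1) z' e e' yx by blast
    next
      case 3
      then show ?thesis using shared[of y x y'] zy z(2) e e' yx by blast
    next
      case 4
      then show ?thesis using shared[of y x x'] zy z' e e' yx by blast
    qed
  qed
qed

text \<open>Nodes have distance at least \<epsilon> from \<open>q\<close>, and \<epsilon> is the
  length of the long segment. If \<open>x\<close> is a third node, these two cancel in
  \<open>crossing_segments\<close>, which brings \<open>x\<close> within \<delta> of both
  \<open>y\<close> and \<open>y'\<close>.\<close>

lemma long_short:
  assumes e: "q \<in> V" "x \<in> N" "dist q x = \<epsilon>" and e': "y \<in> N" "y' \<in> N" "y \<noteq> y'" "dist y y'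
      \<le> \<delta>"
    and z: "z \<in> closed_segment q x" "z \<in> closed_segment y y'"
  shows "z = x \<and> (x = y \<or> x = y')"
proof -
  have shared: "z = x" if "z \<in> closed_segment x v" "x \<noteq> v" "v \<in> N" "dist x v \<le> \<delta>" for v
  proof (rule ccontr)
    assume "z \<noteq> x"
    have "z \<in> closed_segment x q" using z(1) by (simp add: closed_segment_commute)
    from overlapping_segments[OF this that(1) \<open>z \<noteq> x\<close>] show False
    proof
      assume "q \<in> closed_segment x v"
      from dist_add_segment[OF this] VN[OF e(1) that(3)] show False
        using that e(3) pos by (simp add: dist_commute)
    next
      assume "v \<in> closed_segment x q"
      from dist_add_segment[OF this] VN[OF e(1) that(3)] show False
        using that e(3) by (simp add: dist_commute)
    qed
  qed
  show ?thesis
  proof (cases "x = y \<or> x = y'")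
    case True
    then show ?thesis using shared[of y] shared[of y'] z e' by (auto simp: closed_segment_commute dist_commute)
  next
    case False
    have z': "z \<in> closed_segment y' y" using z(2) by (simp add: closed_segment_commute)
    have "dist x y' \<le> \<delta>" using crossing_segments[OF z] VN[OF e(1) e'(1)] e e' by linarith
    moreover have "dist x y \<le> \<delta>"
      using crossing_segments[OF z(1) z'] VN[OF e(1) e'(2)] e e' by (simp add: dist_commute)
    ultimately show ?thesis using triangle_free[of x y y'] e e' False by (auto simp: dist_commute)
  qed
qed

text \<open>Different vertices are more than 2 \<epsilon> apart, so their segments cannot reach each
  other. Overlapping segments from the same vertex coincide because their lengths are equal.\<close>

lemma long_long:
  assumes e: "q \<in> V" "x \<in> N" "dist q x = \<epsilon>" and e': "q' \<in> V" "x' \<in> N" "dist q' x' = \<epsilon>"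
    and ne: "{q, x} \<noteq> {q', x'}" and z: "z \<in> closed_segment q x" "z \<in> closed_segment q' x'"
  shows "z = q \<and> q = q'"
proof (cases "q = q'")
  case True
  then have x: "x \<noteq> x'" using ne by auto
  show ?thesis
  proof (rule ccontr)
    assume "\<not> (z = q \<and> q = q')"
    then have "z \<noteq> q" using True by simp
    from overlapping_segments[OF z(1) z(2)[folded True] this] show False
    proof
      assume "x \<in> closed_segment q x'"
      from dist_add_segment[OF this] show False using e e' True x by simp
    next
      assume "x' \<in> closed_segment q x"
      from dist_add_segment[OF this] show False using e e' True x by simp
    qed
  qed
next
  case False
  then show ?thesis using crossing_segments[OF z] VV[OF e(1) e'(1)] e e' zero_le_dist[of x x'] by linarith
qed

lemma links_meet:
  assumes "link e" "link e'" "e \<noteq> e'"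
  shows "convex hull e \<inter> convex hull e' \<subseteq> e \<inter> e'"
proof
  fix z assume z: "z \<in> convex hull e \<inter> convex hull e'"
  consider (ss) x y x' y' where "e = {x, y}" "x \<noteq> y" "x \<in> N" "y \<in> N" "dist x y \<le> \<delta>"
        "e' = {x', y'}" "x' \<noteq> y'" "x' \<in> N" "y' \<in> N" "dist x' y' \<le> \<delta>"
    | (ls) q x x' y' where "e = {q, x}" "q \<in> V" "x \<in> N" "dist q x = \<epsilon>"
        "e' = {x', y'}" "x' \<noteq> y'" "x' \<in> N" "y' \<in> N" "dist x' y' \<le> \<delta>"
    | (sl) x y q' x' where "e = {x, y}" "x \<noteq> y" "x \<in> N" "y \<in> N" "dist x y \<le> \<delta>"
        "e' = {q', x'}" "q' \<in> V" "x' \<in> N" "dist q' x' = \<epsilon>"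
    | (ll) q x q' x' where "e = {q, x}" "q \<in> V" "x \<in> N" "dist q x = \<epsilon>"
        "e' = {q', x'}" "q' \<in> V" "x' \<in> N" "dist q' x' = \<epsilon>"
    using assms(1,2) unfolding link_def by blast
  then show "z \<in> e \<inter> e'"
  proof cases
    case ss
    then show ?thesis using short_short[of x y x' y' z] z assms(3) by (simp add: segment_convex_hull)
  next
    case ls
    then show ?thesis using long_short[of q x x' y' z] z by (auto simp: segment_convex_hull)
  next
    case sl
    then show ?thesis using long_short[of q' x' x y z] z by (auto simp: segment_convex_hull)
  next
    case ll
    then show ?thesis using long_long[of q x q' x' z] z assms(3) by (simp add: segment_convex_hull)
  qed
qed

text \<open>A node inside a short segment would form a forbidden triangle with its ends; the other
  cases contradict the distances from the vertices.\<close>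

lemma link_avoids:
  assumes "link e" "v \<in> V \<union> N" "v \<in> convex hull e"
  shows "v \<in> e"
proof (rule ccontr)
  assume v: "v \<notin> e"
  from assms(1) consider x y where "e = {x, y}" "x \<noteq> y" "x \<in> N" "y \<in> N" "dist x y \<le> \<delta>"
    | q x where "e = {q, x}" "q \<in> V" "x \<in> N" "dist q x = \<epsilon>"
    unfolding link_def by blast
  then show False
  proof cases
    case 1
    then have s: "dist x y = dist x v + dist v y"
      using assms(3) dist_add_segment[of v x y] by (simp add: segment_convex_hull)
    show False
    proof (cases "v \<in> V")
      case True
      then show ?thesis using VN[OF True] 1 s pos by (smt (verit) dist_commute)
    next
      case False
      then have "v \<in> N" using assms(2) by simp
      moreover have "dist x v \<le> \<delta>" "dist v y \<le> \<delta>" using s 1 by (smt (verit) zero_le_dist)+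
      ultimately show ?thesis using triangle_free[of x v y] 1 v by auto
    qed
  next
    case 2
    then have s: "\<epsilon> = dist q v + dist v x"
      using assms(3) dist_add_segment[of v q x] by (simp add: segment_convex_hull)
    show False
    proof (cases "v \<in> V")
      case True
      then show ?thesis using VV[OF 2(2) True] 2 v s pos zero_le_dist[of v x] by auto
    next
      case False
      then have "\<epsilon> \<le> dist q v" using assms(2) VN 2 by simp
      then have "dist v x \<le> 0" using s by simp
      then show ?thesis using 2 v by simp
    qed
  qed
qed

end

text \<open>A chain with the least number of steps admits no shortcuts.\<close>

lemma minimal_chain:
  fixes g :: "real \<Rightarrow> 'a::metric_space"
  assumes cont: "continuous_on {s..t} g" and st: "s < t" and "0 < \<delta>"
  obtains n \<tau> where "\<tau> 0 = s" "\<tau> n = t"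
    "\<And>i. i < n \<Longrightarrow> \<tau> i < \<tau> (Suc i)" "\<And>i. i < n \<Longrightarrow> dist (g (\<tau> i)) (g
        (\<tau> (Suc i))) \<le> \<delta>"
    "\<And>i j. Suc i < j \<Longrightarrow> j \<le> n \<Longrightarrow> \<delta> < dist (g (\<tau> i)) (g (\<tau> j))"
proof -
  define chain where "chain n \<tau> \<longleftrightarrow> \<tau> 0 = s \<and> \<tau> n = t \<and>
    (\<forall>i<n. \<tau> i < \<tau> (Suc i) \<and> dist (g (\<tau> i)) (g (\<tau> (Suc i))) \<le> \<delta>)" for n :: nat
        and \<tau> :: "nat \<Rightarrow> real"
  have "\<exists>n \<tau>. chain n \<tau>"
  proof -
    \<comment> \<open>By uniform continuity sufficiently small equal time steps give some chain, so
      that a shortest one exists.\<close>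
    obtain \<eta> where \<eta>: "\<eta> > 0" "\<And>x y. x \<in> {s..t} \<Longrightarrow> y \<in> {s..t} \<Longrightarrow>
        dist y x < \<eta> \<Longrightarrow> dist (g y) (g x) < \<delta>"
      using compact_uniformly_continuous[OF cont] \<open>0 < \<delta>\<close> unfolding uniformly_continuous_on_def by
          (metis compact_Icc)
    obtain n :: nat where n: "(t - s) / \<eta> < real n" using reals_Archimedean2 by blast
    moreover have "0 < (t - s) / \<eta>" using st \<eta> by simp
    ultimately have n0: "0 < n" by (metis less_trans of_nat_0_less_iff)
    define h where "h = (t - s) / n"
    have h: "0 < h" "h < \<eta>" "n * h = t - s" using n n0 st \<eta>(1) by (auto simp: h_def field_simps)
    define \<tau> where "\<tau> i = s + i * h" for i :: nat
    have rng: "\<tau> i \<in> {s..t}" if "i \<le> n" for i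
    proof -
      have "i * h \<le> n * h" using that h by (intro mult_right_mono) auto
      then show ?thesis using h by (auto simp: \<tau>_def)
    qed
    have "chain n \<tau>" unfolding chain_def
    proof (intro conjI allI impI)
      show "\<tau> 0 = s" "\<tau> n = t" using h by (simp_all add: \<tau>_def)
      fix i assume i: "i < n"
      show "\<tau> i < \<tau> (Suc i)" using h by (simp add: \<tau>_def distrib_right)
      have "dist (\<tau> i) (\<tau> (Suc i)) < \<eta>" using h by (simp add: \<tau>_def dist_real_def distrib_right)
      then show "dist (g (\<tau> i)) (g (\<tau> (Suc i))) \<le> \<delta>"
        using \<eta>(2)[OF rng rng, of "Suc i" i] i by (simp add: less_imp_le)
    qed
    then show ?thesis by blast
  qed
  then have ex: "\<exists>\<tau>. chain (LEAST n. \<exists>\<tau>. chain n \<tau>) \<tau>" by (rule LeastI_ex)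
  define n where "n = (LEAST n. \<exists>\<tau>. chain n \<tau>)"
  have min: "n \<le> m" if "chain m \<sigma>" for m \<sigma> unfolding n_def using that by (intro Least_le) blast
  obtain \<tau> where \<tau>: "chain n \<tau>" using ex unfolding n_def by blast
  have mono: "\<tau> i < \<tau> j" if "i < j" "j \<le> n" for i j
    using that
  proof (induction j)
    case (Suc j)
    then show ?case using \<tau> unfolding chain_def by (cases "i = j") (auto intro: less_trans)
  qed simp
  have "\<delta> < dist (g (\<tau> i)) (g (\<tau> j))" if ij: "Suc i < j" "j \<le> n" for i j
  proof (rule ccontr)
    assume short: "\<not> ?thesis"
    \<comment> \<open>A direct step from \<open>i\<close> to \<open>j\<close> skips the
      \<open>j - Suc i\<close> points strictly between them. As \<open>Suc i < j\<close>, this is at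
      least one point, contrary to minimality.\<close>
    define \<sigma> where "\<sigma> k = (if k \<le> i then \<tau> k else \<tau> (k + (j - Suc i)))" for k
    have "chain (n - (j - Suc i)) \<sigma>" unfolding chain_def
    proof (intro conjI allI impI)
      show "\<sigma> 0 = s" "\<sigma> (n - (j - Suc i)) = t" using \<tau> ij by (auto simp: \<sigma>_def chain_def)
      fix k assume k: "k < n - (j - Suc i)"
      consider "k < i" | "k = i" | "i < k" by linarith
      then show "\<sigma> k < \<sigma> (Suc k)"
      proof cases
        case 2
        then show ?thesis using mono[of i j] ij by (simp add: \<sigma>_def)
      qed (use k \<tau> in \<open>auto simp: \<sigma>_def chain_def\<close>)
      consider "k < i" | "k = i" | "i < k" by linarith
      then show "dist (g (\<sigma> k)) (g (\<sigma> (Suc k))) \<le> \<delta>"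
      proof cases
        case 2
        then show ?thesis using short ij by (simp add: \<sigma>_def)
      qed (use k \<tau> in \<open>auto simp: \<sigma>_def chain_def\<close>)
    qed
    then show False using min ij by fastforce
  qed
  then show thesis using \<tau> by (intro that[of \<tau> n]) (auto simp: chain_def)
qed

text \<open>\<open>s\<close> is the last time in the closed ball about \<open>g 0\<close>, and
  \<open>t\<close> is the first time after \<open>s\<close> in the closed ball about
  \<open>g 1\<close>. Looking for \<open>t\<close> only after \<open>s\<close> keeps the arc between
  them outside both open balls, however often the curve returns.\<close>

lemma last_exit:
  fixes g :: "real \<Rightarrow> 'a::metric_space"
  assumes cont: "continuous_on {0..1} g" and "0 < \<epsilon>" and far: "2 * \<epsilon> < dist (g 0) (g 1)"
  obtains s t where "0 < s" "s < t" "t < 1" "dist (g 0) (g s) = \<epsilon>" "dist (g 1) (g t) = \<epsilon>"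
    "\<And>x. x \<in> {s..t} \<Longrightarrow> \<epsilon> \<le> dist (g 0) (g x)" "\<And>x. x \<in> {s..t} \<Longrightarrow>
        \<epsilon> \<le> dist (g 1) (g x)"
proof -
  have contd: "continuous_on {0..1} (\<lambda>x. dist c (g x))" for c using cont by (intro continuous_intros)
  have comp: "compact {x \<in> {a..b}. dist c (g x) \<le> \<epsilon>}" if "{a..b} \<subseteq> {0..1}" for a b c
  proof -
    have "closed {x \<in> {a..b}. dist c (g x) \<le> \<epsilon>}"
      using continuous_closed_preimage[OF continuous_on_subset[OF contd that] closed_atLeastAtMost, of "{..\<epsilon>}" c]
      by (simp add: vimage_def Int_def)
    then show ?thesis
      by (rule compact_eq_bounded_closed[THEN iffD2, OF conjI[rotated]])
         (rule bounded_subset[OF bounded_closed_interval[of a b]], auto)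
  qed
  define S where "S = {x \<in> {0..1}. dist (g 0) (g x) \<le> \<epsilon>}"
  have "0 \<in> S" using \<open>0 < \<epsilon>\<close> by (simp add: S_def)
  then obtain s where s: "s \<in> S" "\<And>x. x \<in> S \<Longrightarrow> x \<le> s"
    using compact_attains_sup[of S] comp[of 0 1 "g 0"] unfolding S_def by force
  have s01: "0 \<le> s" "s \<le> 1" using s by (auto simp: S_def)
  have "\<exists>x\<ge>s. x \<le> 1 \<and> dist (g 0) (g x) = \<epsilon>"
    using s far s01 zero_le_dist[of "g 0" "g 1"] \<open>0 < \<epsilon>\<close> continuous_on_subset[OF contd, of "{s..1}"]
    by (intro IVT') (auto simp: S_def)
  then obtain x where "x \<ge> s" "x \<le> 1" "dist (g 0) (g x) = \<epsilon>" by blast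
  moreover from this have "x = s" using s s01 by (intro antisym s(2)) (auto simp: S_def)
  ultimately have ds: "dist (g 0) (g s) = \<epsilon>" by simp
  have sb: "\<epsilon> < dist (g 1) (g s)"
    using far ds dist_triangle[of "g 0" "g 1" "g s"] by (simp add: dist_commute)
  define T where "T = {x \<in> {s..1}. dist (g 1) (g x) \<le> \<epsilon>}"
  have "1 \<in> T" using \<open>0 < \<epsilon>\<close> s01 by (simp add: T_def)
  then obtain t where t: "t \<in> T" "\<And>x. x \<in> T \<Longrightarrow> t \<le> x"
    using compact_attains_inf[of T] comp[of s 1 "g 1"] s01 unfolding T_def by force
  have t01: "s \<le> t" "t \<le> 1" using t by (auto simp: T_def)
  have "\<exists>x\<ge>s. x \<le> t \<and> dist (g 1) (g x) = \<epsilon>"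
    using t t01 s01 sb continuous_on_subset[OF contd, of "{s..t}"]
    by (intro IVT2') (auto simp: T_def)
  then obtain y where y: "y \<ge> s" "y \<le> t" "dist (g 1) (g y) = \<epsilon>" by blast
  then have "t \<le> y" using t01 by (intro t(2)) (auto simp: T_def)
  then have "y = t" using y by simp
  then have dt: "dist (g 1) (g t) = \<epsilon>" using y by simp
  have "s \<noteq> 0" "t \<noteq> 1" "s \<noteq> t" using ds dt sb \<open>0 < \<epsilon>\<close> by auto
  then have st: "0 < s" "s < t" "t < 1" using s01 t01 by auto
  show thesis
  proof (rule that[OF st ds dt])
    fix x assume x: "x \<in> {s..t}"
    show "\<epsilon> \<le> dist (g 0) (g x)"
    proof (rule ccontr)
      assume *: "\<not> ?thesis"
      then have "x \<in> S" using x s01 t01 by (auto simp: S_def)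
      then have "x = s" using s(2) x by force
      then show False using * ds by simp
    qed
    show "\<epsilon> \<le> dist (g 1) (g x)"
    proof (rule ccontr)
      assume *: "\<not> ?thesis"
      then have "x \<in> T" using x s01 t01 by (auto simp: T_def)
      then have "x = t" using t(2) x by force
      then show False using * dt by simp
    qed
  qed
qed

section \<open>Chord graphs of fine subdivisions\<close>

context subdivided_graph
begin

lemma chord_piece: "A \<in> edges \<Gamma> \<Longrightarrow> i < n A \<Longrightarrow> chord (piece A i) = closed_segment
    (\<gamma> A (\<tau> A i)) (\<gamma> A (\<tau> A (Suc i)))"
  by (simp add: chord_def piece_arc segment_convex_hull)

text \<open>A piece of an edge that is cut at least once has an end that lies on no other edge. This
  separates parallel edges, whose uncut chords would coincide.\<close>

lemma piece_endpoints_inj: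
  assumes A: "A \<in> edges \<Gamma>" "i < n A" and B: "B \<in> edges \<Gamma>" "j < n B" and "2 \<le> n A"
    and eq: "endpoints (piece A i) = endpoints (piece B j)"
  shows "piece A i = piece B j"
proof -
  have eq': "{\<gamma> A (\<tau> A i), \<gamma> A (\<tau> A (Suc i))} = {\<gamma> B (\<tau> B j), \<gamma> B (\<tau> B (Suc
      j))}"
    using eq piece_arc[OF A] piece_arc[OF B] by simp
  define k where "k = (if i = 0 then 1 else i)"
  have k: "0 < k" "k < n A" "k = i \<or> k = Suc i" using A \<open>2 \<le> n A\<close> by (auto simp: k_def)
  have "\<gamma> A (\<tau> A k) \<in> {\<gamma> B (\<tau> B j), \<gamma> B (\<tau> B (Suc j))}" using k(3) eq' by blast
  then have "\<gamma> A (\<tau> A k) \<in> B" using B \<tau>_range[OF B(1), of j] \<tau>_range[OF B(1), of "Suc j"]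
      in_edge[OF B(1)] by auto
  moreover have "\<gamma> A (\<tau> A k) \<in> A" using in_edge[OF A(1) \<tau>_range[OF A(1)]] k by simp
  ultimately have AB: "A = B" using edges_meet[OF A(1) B(1)] new_vertex(2)[OF A(1) k(1,2)] by blast
  have "{\<tau> A i, \<tau> A (Suc i)} = {\<tau> A j, \<tau> A (Suc j)}"
    using eq' inj[OF A(1)] \<tau>_range[OF A(1), of i] \<tau>_range[OF A(1), of "Suc i"] \<tau>_range[OF A(1), of j]
        \<tau>_range[OF A(1), of "Suc j"]
      A B unfolding AB doubleton_eq_iff by auto
  then have "i = j" using \<tau>_eq[OF A(1)] A B unfolding AB doubleton_eq_iff by auto
  then show ?thesis using AB by simp
qed

lemma chord_graph_approximating:
  assumes cc: "\<And>C D. C \<in> edges refined \<Longrightarrow> D \<in> edges refined \<Longrightarrow> C \<noteq> D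
      \<Longrightarrow> chord C \<inter> chord D \<subseteq> endpoints C \<inter> endpoints D"
    and cv: "\<And>C. C \<in> edges refined \<Longrightarrow> chord C \<inter> verts refined \<subseteq> endpoints C"
  shows "approximating \<Gamma> (chord_graph refined)"
    and "\<And>q. edges_at (chord_graph refined) q = chord ` edges_at refined q"
    and "\<And>q. valence (chord_graph refined) q = valence refined q"
proof -
  obtain \<gamma>' where "parametrized_graph refined \<gamma>'" using continuous_graph_parametrized[OF refined_graph] .
  note R = parametrized_graph.chord_graph_polygonal[OF this cc cv]
  show e: "edges_at (chord_graph refined) q = chord ` edges_at refined q" for q using R(2) by blast
  have i: "inj_on chord (edges refined)" using R(3) by blast
  have v: "valence (chord_graph refined) q = valence refined q" for q
    unfolding valence_def e by (rule card_image) (rule inj_on_subset[OF i], auto simp: edges_at_def)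
  then show "valence (chord_graph refined) q = valence refined q" for q .
  have tv: "topological_verts (chord_graph refined) = topological_verts \<Gamma>"
    using topological_verts_refined v unfolding topological_verts_def by (simp add: chord_graph_def)
  obtain F F' where F: "homeomorphism (support refined) (support (chord_graph refined)) F F'" "\<forall>v\<in>verts refined.
      F v = v"
    using R(4) by blast
  show "approximating \<Gamma> (chord_graph refined)"
  proof (rule approximatingI[OF R(1) tv])
    show "homeomorphism (support \<Gamma>) (support (chord_graph refined)) F F'" using F support_refined by simp
    show "valence (chord_graph refined) q = valence \<Gamma> q" if "q \<in> topological_verts \<Gamma>" for q
      using valence_old that v by (simp add: topological_verts_def)
    show "v \<in> support \<Gamma> \<and> F v = v" if "v \<in> verts (chord_graph refined)" for v
      using that F(2) support_refined unfolding support_def by (auto simp: chord_graph_def)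
  qed
qed

end

lemma finite_dist_bound:
  assumes "finite X" "\<And>i. i \<in> X \<Longrightarrow> compact (P i) \<and> closed (Q i) \<and> P i \<inter> Q i = {}"
  shows "\<exists>d>0. \<forall>i\<in>X. \<forall>x\<in>P i. \<forall>y\<in>Q i. d < dist x (y :: 'a::heine_borel)"
proof (rule finite_uniform_radius[OF assms(1)])
  fix i assume "i \<in> X"
  then obtain d where d: "d > 0" "\<forall>x\<in>P i. \<forall>y\<in>Q i. d \<le> dist x y"
    using separate_compact_closed[of "P i" "Q i"] assms(2) by blast
  then show "\<exists>d>0. \<forall>x\<in>P i. \<forall>y\<in>Q i. d < dist x y"
    by (intro exI[of _ "d/2"]) (force intro: less_le_trans)
qed force

context parametrized_graph
begin

lemma compact_edge: "A \<in> edges \<Gamma> \<Longrightarrow> compact A"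
  using compact_arc_image[OF arc] img by metis

lemma vertex_separation:
  obtains \<epsilon> where "0 < \<epsilon>"
    "\<And>q q'. q \<in> verts \<Gamma> \<Longrightarrow> q' \<in> verts \<Gamma> \<Longrightarrow> q \<noteq> q'
        \<Longrightarrow> 2 * \<epsilon> < dist q q'"
    "\<And>q A z. q \<in> verts \<Gamma> \<Longrightarrow> A \<in> edges \<Gamma> \<Longrightarrow> q \<notin> A
        \<Longrightarrow> z \<in> A \<Longrightarrow> \<epsilon> < dist q z"
proof -
  let ?V = "verts \<Gamma>" and ?E = "edges \<Gamma>"
  have "\<exists>e>0. \<forall>i\<in>{i\<in>?V \<times> ?V. fst i \<noteq> snd i}. \<forall>x\<in>{fst i}.
      \<forall>y\<in>{snd i}. e < dist x y"
    using finite_graph by (intro finite_dist_bound) auto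
  then obtain e1 where e1: "e1 > 0" "\<And>q q'. q \<in> ?V \<Longrightarrow> q' \<in> ?V \<Longrightarrow> q \<noteq> q'
      \<Longrightarrow> e1 < dist q q'" by force
  have "\<exists>e>0. \<forall>i\<in>{i\<in>?V \<times> ?E. fst i \<notin> snd i}. \<forall>x\<in>{fst i}.
      \<forall>y\<in>snd i. e < dist x y"
    using finite_graph compact_edge by (intro finite_dist_bound) (auto intro: compact_imp_closed)
  then obtain e2 where e2: "e2 > 0" "\<And>q A z. q \<in> ?V \<Longrightarrow> A \<in> ?E \<Longrightarrow> q \<notin> A
      \<Longrightarrow> z \<in> A \<Longrightarrow> e2 < dist q z" by force
  show thesis
  proof (rule that[of "min (e1/2) e2"])
    show "2 * min (e1/2) e2 < dist q q'" if "q \<in> ?V" "q' \<in> ?V" "q \<noteq> q'" for q q' using e1(2)[OF that] by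
        linarith
    show "min (e1/2) e2 < dist q z" if "q \<in> ?V" "A \<in> ?E" "q \<notin> A" "z \<in> A" for q A z using e2(2)[OF that]
        by linarith
  qed (use e1 e2 in simp)
qed

text \<open>The mesh is needed in time, while the construction controls distances in space; uniform
  continuity of the inverse parametrization converts one into the other.\<close>

lemma inverse_modulus:
  assumes A: "A \<in> edges \<Gamma>" and "0 < \<eta>"
  shows "\<exists>d>0. \<forall>x\<in>{0..1}. \<forall>y\<in>{0..1}. dist (\<gamma> A x) (\<gamma> A y) \<le> d
      \<longrightarrow> \<bar>x - y\<bar> < \<eta>"
proof -
  obtain k where k: "homeomorphism {0..1} A (\<gamma> A) k" using homeomorphism_arc[OF arc[OF A]] img[OF A] by auto
  have "uniformly_continuous_on A k"
    using k compact_arc_image[OF arc[OF A]] img[OF A]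
    by (intro compact_uniformly_continuous) (auto simp: homeomorphism_def)
  then obtain d where d: "d > 0" "\<And>x y. x \<in> A \<Longrightarrow> y \<in> A \<Longrightarrow> dist y x < d
      \<Longrightarrow> dist (k y) (k x) < \<eta>"
    unfolding uniformly_continuous_on_def using \<open>0 < \<eta>\<close> by metis
  have "\<bar>x - y\<bar> < \<eta>" if "x \<in> {0..1}" "y \<in> {0..1}" "dist (\<gamma> A x) (\<gamma> A y) \<le> d/2" for
      x y
  proof -
    have "dist (k (\<gamma> A x)) (k (\<gamma> A y)) < \<eta>" using that d(1) in_edge[OF A] by (intro d(2)) auto
    moreover have "k (\<gamma> A x) = x" "k (\<gamma> A y) = y" using k that unfolding homeomorphism_def by auto
    ultimately show ?thesis by (simp add: dist_real_def)
  qed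
  then show ?thesis using d(1) by (intro exI[of _ "d/2"]) auto
qed

text \<open>The chain points satisfy \<open>triangle_free\<close>: points of different edges are
  more than \<delta> apart, and on one edge only neighbours in the minimal chain come within
  \<delta>. Three different indices cannot pairwise differ by at most 1.\<close>

lemma fine_approximation:
  assumes "0 < \<eta>"
  obtains n \<tau> where "subdivided_graph \<Gamma> \<gamma> n \<tau>"
    "approximating \<Gamma> (chord_graph (subdivided_graph.refined \<Gamma> \<gamma> n \<tau>))"
    "\<And>q. edges_at (chord_graph (subdivided_graph.refined \<Gamma> \<gamma> n \<tau>)) q = chord ` edges_at
        (subdivided_graph.refined \<Gamma> \<gamma> n \<tau>) q"
    "\<And>q. valence (chord_graph (subdivided_graph.refined \<Gamma> \<gamma> n \<tau>)) q = valence
        (subdivided_graph.refined \<Gamma> \<gamma> n \<tau>) q"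
    "\<And>A i. A \<in> edges \<Gamma> \<Longrightarrow> i < n A \<Longrightarrow> \<tau> A (Suc i) - \<tau> A i < \<eta>"
proof -
  let ?V = "verts \<Gamma>" and ?E = "edges \<Gamma>"
  obtain e where e: "0 < e" "\<And>q q'. q \<in> ?V \<Longrightarrow> q' \<in> ?V \<Longrightarrow> q \<noteq> q'
      \<Longrightarrow> 2 * e < dist q q'"
    "\<And>q A z. q \<in> ?V \<Longrightarrow> A \<in> ?E \<Longrightarrow> q \<notin> A \<Longrightarrow> z \<in> A
        \<Longrightarrow> e < dist q z" using vertex_separation by metis
  have "\<exists>d>0. \<forall>A\<in>?E. \<forall>x\<in>{0..1}. \<forall>y\<in>{0..1}. dist (\<gamma> A x) (\<gamma> A y)
      \<le> d \<longrightarrow> \<bar>x - y\<bar> < \<eta>"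
  proof (rule finite_uniform_radius[OF finite_graph(2)])
    show "\<exists>d>0. \<forall>x\<in>{0..1}. \<forall>y\<in>{0..1}. dist (\<gamma> A x) (\<gamma> A y) \<le> d
        \<longrightarrow> \<bar>x - y\<bar> < \<eta>" if "A \<in> ?E" for A
      using inverse_modulus[OF that \<open>0 < \<eta>\<close>] .
  qed force
  then obtain e3 where e3: "e3 > 0"
    "\<And>A x y. A \<in> ?E \<Longrightarrow> x \<in> {0..1} \<Longrightarrow> y \<in> {0..1} \<Longrightarrow> dist
        (\<gamma> A x) (\<gamma> A y) \<le> e3 \<Longrightarrow> \<bar>x - y\<bar> < \<eta>" by blast
  \<comment> \<open>The bound \<open>e\<close> isolates the vertices; the bound \<open>e3\<close>
    makes every step of length at most \<epsilon> take less than \<eta> of time, including the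
    straight steps at the vertices.\<close>
  define \<epsilon> where "\<epsilon> = min e e3"
  have \<epsilon>: "0 < \<epsilon>" "\<epsilon> \<le> e" "\<epsilon> \<le> e3" using e e3 by (auto simp: \<epsilon>_def)
  define middle where "middle A s t \<longleftrightarrow> 0 < s \<and> s < t \<and> t < 1 \<and> dist (\<gamma> A 0)
      (\<gamma> A s) = \<epsilon> \<and> dist (\<gamma> A 1) (\<gamma> A t) = \<epsilon> \<and>
      (\<forall>x\<in>{s..t}. \<epsilon> \<le> dist (\<gamma> A 0) (\<gamma> A x) \<and> \<epsilon> \<le> dist (\<gamma> A
          1) (\<gamma> A x))" for A s t
  have "\<exists>s t. middle A s t" if A: "A \<in> ?E" for A
  proof -
    have "2 * \<epsilon> < dist (\<gamma> A 0) (\<gamma> A 1)"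
      using e(2)[OF end_vert(1)[OF A] end_vert(2)[OF A]] ends_ne[OF A] \<epsilon>(2) by linarith
    from last_exit[OF cont[OF A] \<epsilon>(1) this] show ?thesis unfolding middle_def by (metis (no_types, lifting))
  qed
  then obtain s t where "\<And>A. A \<in> ?E \<Longrightarrow> middle A (s A) (t A)" by metis
  then have st: "\<And>A. A \<in> ?E \<Longrightarrow> 0 < s A" "\<And>A. A \<in> ?E \<Longrightarrow> s A < t A" "\<And>A.
      A \<in> ?E \<Longrightarrow> t A < 1"
    and ds: "\<And>A. A \<in> ?E \<Longrightarrow> dist (\<gamma> A 0) (\<gamma> A (s A)) = \<epsilon>" and dt: "\<And>A. A
        \<in> ?E \<Longrightarrow> dist (\<gamma> A 1) (\<gamma> A (t A)) = \<epsilon>"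
    and far: "\<And>A x. A \<in> ?E \<Longrightarrow> x \<in> {s A..t A} \<Longrightarrow> \<epsilon> \<le> dist (\<gamma> A
        0) (\<gamma> A x)"
      "\<And>A x. A \<in> ?E \<Longrightarrow> x \<in> {s A..t A} \<Longrightarrow> \<epsilon> \<le> dist (\<gamma> A 1)
          (\<gamma> A x)"
    unfolding middle_def by metis+
  have sub: "{s A..t A} \<subseteq> {0..1}" if "A \<in> ?E" for A using st[OF that] by auto
  have "\<exists>d>0. \<forall>i\<in>{i\<in>?E \<times> ?E. fst i \<noteq> snd i}. \<forall>x\<in>\<gamma> (fst i) ` {s (fst
      i)..t (fst i)}. \<forall>y\<in>\<gamma> (snd i) ` {s (snd i)..t (snd i)}. d < dist x y"
  proof (rule finite_dist_bound)
    fix i assume *: "i \<in> {i\<in>?E \<times> ?E. fst i \<noteq> snd i}"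
    obtain A B where AB: "i = (A, B)" by (cases i)
    then have i: "i = (A, B)" "A \<in> ?E" "B \<in> ?E" "A \<noteq> B" using * by simp_all
    have c: "compact (\<gamma> A ` {s A..t A})" if "A \<in> ?E" for A
      using continuous_on_subset[OF cont[OF that] sub[OF that]] by (intro compact_continuous_image) auto
    have "\<gamma> A x \<noteq> \<gamma> B y" if x: "x \<in> {s A..t A}" and y: "y \<in> {s B..t B}" for x y
    proof
      assume eq: "\<gamma> A x = \<gamma> B y"
      have x01: "x \<in> {0..1}" and y01: "y \<in> {0..1}" using sub[OF i(2)] sub[OF i(3)] x y by blast+
      have "\<gamma> A x \<in> ?V" using edges_meet[OF i(2-4)] in_edge[OF i(2) x01] in_edge[OF i(3) y01] eq by auto
      then show False using vert_time[OF i(2) x01] st[OF i(2)] x by auto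
    qed
    then show "compact (\<gamma> (fst i) ` {s (fst i)..t (fst i)}) \<and> closed (\<gamma> (snd i) ` {s (snd i)..t (snd i)})
        \<and>
        \<gamma> (fst i) ` {s (fst i)..t (fst i)} \<inter> \<gamma> (snd i) ` {s (snd i)..t (snd i)} = {}"
      using c[OF i(2)] compact_imp_closed[OF c[OF i(3)]] unfolding i(1) by auto
  qed (use finite_graph in simp)
  then obtain m where m: "m > 0"
    "\<And>A B x y. A \<in> ?E \<Longrightarrow> B \<in> ?E \<Longrightarrow> A \<noteq> B \<Longrightarrow> x \<in> {s A..t
        A} \<Longrightarrow> y \<in> {s B..t B} \<Longrightarrow> m < dist (\<gamma> A x) (\<gamma> B y)"
    by force
  \<comment> \<open>The number \<open>m\<close> separates the middle arcs of different edges, so a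
    step of length at most \<delta> never connects two of them.\<close>
  define \<delta> where "\<delta> = min \<epsilon> m"
  have \<delta>: "0 < \<delta>" "\<delta> \<le> \<epsilon>" "\<delta> \<le> m" using \<epsilon> m by (auto simp:
      \<delta>_def)
  define chain where "chain A k \<sigma> \<longleftrightarrow> \<sigma> 0 = s A \<and> \<sigma> k = t A \<and>
      (\<forall>i<k. \<sigma> i < \<sigma> (Suc i)) \<and>
      (\<forall>i<k. dist (\<gamma> A (\<sigma> i)) (\<gamma> A (\<sigma> (Suc i))) \<le> \<delta>) \<and>
      (\<forall>i j. Suc i < j \<longrightarrow> j \<le> k \<longrightarrow> \<delta> < dist (\<gamma> A (\<sigma> i))
          (\<gamma> A (\<sigma> j)))" for A k and \<sigma> :: "nat \<Rightarrow> real"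
  have "\<exists>k \<sigma>. chain A k \<sigma>" if A: "A \<in> ?E" for A
    using minimal_chain[OF continuous_on_subset[OF cont[OF A] sub[OF A]] st(2)[OF A] \<delta>(1)]
    unfolding chain_def by (metis (no_types, lifting))
  then obtain k \<sigma> where chain: "\<And>A. A \<in> ?E \<Longrightarrow> chain A (k A) (\<sigma> A)" by metis
  have \<sigma>: "\<sigma> A 0 = s A" "\<sigma> A (k A) = t A" if "A \<in> ?E" for A using chain[OF that] unfolding
      chain_def by auto
  have \<sigma>_Suc: "\<sigma> A i < \<sigma> A (Suc i)" "dist (\<gamma> A (\<sigma> A i)) (\<gamma> A (\<sigma> A (Suc i)))
      \<le> \<delta>" if "A \<in> ?E" "i < k A" for A i
    using chain[OF that(1)] that(2) unfolding chain_def by auto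
  have \<sigma>_far: "\<delta> < dist (\<gamma> A (\<sigma> A i)) (\<gamma> A (\<sigma> A j))" if "A \<in> ?E" "Suc i < j"
      "j \<le> k A" for A i j
    using chain[OF that(1)] that(2,3) unfolding chain_def by auto
  have \<sigma>_mono: "\<sigma> A i \<le> \<sigma> A j" if "A \<in> ?E" "i \<le> j" "j \<le> k A" for A i j
    using that(2,3)
  proof (induction j rule: dec_induct)
    case (step j)
    then show ?case using \<sigma>_Suc(1)[OF that(1), of j] by simp
  qed simp
  have \<sigma>_range: "\<sigma> A i \<in> {s A..t A}" if "A \<in> ?E" "i \<le> k A" for A i
    using \<sigma>_mono[OF that(1), of 0 i] \<sigma>_mono[OF that(1), of i "k A"] \<sigma>[OF that(1)] that(2) by simp
  \<comment> \<open>The two extra steps join the chain to the end points of the edge and shift its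
    indices by one. They also guarantee \<open>2 \<le> n A\<close>, as
    \<open>piece_endpoints_inj\<close> requires.\<close>
  define n where "n A = k A + 2" for A
  define \<tau> where "\<tau> A i = (if i = 0 then 0 else if i \<le> Suc (k A) then \<sigma> A (i - 1) else 1)" for A i
  interpret S: subdivided_graph \<Gamma> \<gamma> n \<tau>
  proof
    fix A i assume A: "A \<in> ?E"
    show "\<tau> A 0 = 0" "\<tau> A (n A) = 1" by (auto simp: \<tau>_def n_def)
    assume i: "i < n A"
    consider "i = 0" | "0 < i" "i \<le> k A" | "i = Suc (k A)" using i unfolding n_def by linarith
    then show "\<tau> A i < \<tau> A (Suc i)"
    proof cases
      case 2
      then show ?thesis using \<sigma>_Suc(1)[OF A, of "i - 1"] by (auto simp: \<tau>_def)
    qed (use st[OF A] \<sigma>[OF A] in \<open>auto simp: \<tau>_def\<close>)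
  qed
  define N where "N = {\<gamma> A (\<sigma> A i) |A i. A \<in> ?E \<and> i \<le> k A}"
  have adj: "A = B \<and> i \<le> Suc j \<and> j \<le> Suc i"
    if "A \<in> ?E" "i \<le> k A" "B \<in> ?E" "j \<le> k B" "dist (\<gamma> A (\<sigma> A i)) (\<gamma> B (\<sigma> B j))
        \<le> \<delta>" for A B i j
  proof (cases "A = B")
    case True
    then show ?thesis using \<sigma>_far[OF that(1), of i j] \<sigma>_far[OF that(1), of j i] that
      by (simp add: dist_commute) (meson not_less_eq not_le_imp_less not_less)
  next
    case False
    then show ?thesis using m(2)[OF that(1,3) _ \<sigma>_range[OF that(1,2)] \<sigma>_range[OF that(3,4)]] that(5)
        \<delta>(3) by simp
  qed
  interpret net: segment_net ?V N \<epsilon> \<delta>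
  proof
    show "0 < \<epsilon>" "0 < \<delta>" "\<delta> \<le> \<epsilon>" by (fact \<epsilon>(1) \<delta>)+
    show "2 * \<epsilon> < dist q q'" if "q \<in> ?V" "q' \<in> ?V" "q \<noteq> q'" for q q' using e(2)[OF that]
        \<epsilon>(2) by simp
    show "\<epsilon> \<le> dist q x" if q: "q \<in> ?V" and x: "x \<in> N" for q x
    proof -
      obtain A i where A: "A \<in> ?E" "i \<le> k A" "x = \<gamma> A (\<sigma> A i)" using x by (auto simp: N_def)
      have r: "\<sigma> A i \<in> {s A..t A}" using \<sigma>_range A by simp
      show ?thesis
      proof (cases "q \<in> A")
        case True
        then have "q = \<gamma> A 0 \<or> q = \<gamma> A 1" using edge_Int_verts[OF A(1)] ends[OF A(1)] q by blast
        then show ?thesis using far[OF A(1) r] A(3) by auto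
      next
        case False
        have "\<gamma> A (\<sigma> A i) \<in> A" using in_edge[OF A(1)] sub[OF A(1)] r by blast
        then show ?thesis using e(3)[OF q A(1) False] A(3) \<epsilon>(2) by fastforce
      qed
    qed
    fix x y z assume N: "x \<in> N" "y \<in> N" "z \<in> N" and ne: "x \<noteq> y" "y \<noteq> z" "x \<noteq> z"
      and d: "dist x y \<le> \<delta>" "dist y z \<le> \<delta>"
    show "\<not> dist x z \<le> \<delta>"
    proof
      assume d': "dist x z \<le> \<delta>"
      obtain A i where x: "A \<in> ?E" "i \<le> k A" "x = \<gamma> A (\<sigma> A i)" using N(1) by (auto simp: N_def)
      obtain B j where y: "B \<in> ?E" "j \<le> k B" "y = \<gamma> B (\<sigma> B j)" using N(2) by (auto simp: N_def)
      obtain C l where z: "C \<in> ?E" "l \<le> k C" "z = \<gamma> C (\<sigma> C l)" using N(3) by (auto simp: N_def)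
      have 1: "A = B \<and> i \<le> Suc j \<and> j \<le> Suc i" using adj[OF x(1,2) y(1,2)] d(1) x y by simp
      have 2: "B = C \<and> j \<le> Suc l \<and> l \<le> Suc j" using adj[OF y(1,2) z(1,2)] d(2) y z by simp
      have 3: "A = C \<and> i \<le> Suc l \<and> l \<le> Suc i" using adj[OF x(1,2) z(1,2)] d' x z by simp
      have "i \<noteq> j" "j \<noteq> l" "i \<noteq> l" using ne 1 2 x y z by auto
      then show False using 1 2 3 by linarith
    qed
  qed
  have linkC: "net.link (endpoints (S.piece A i))" and short: "dist (\<gamma> A (\<tau> A i)) (\<gamma> A (\<tau> A (Suc
      i))) \<le> \<epsilon>"
    if A: "A \<in> ?E" and i: "i < n A" for A i
  proof -
    have e: "endpoints (S.piece A i) = {\<gamma> A (\<tau> A i), \<gamma> A (\<tau> A (Suc i))}" using S.piece_arc[OF A i]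
        by simp
    have ne: "\<gamma> A (\<tau> A i) \<noteq> \<gamma> A (\<tau> A (Suc i))"
      using inj[OF A] S.\<tau>_range[OF A] S.\<tau>_Suc[OF A i] i by (metis Suc_leI less_imp_le less_irrefl)
    have N: "\<gamma> A (\<sigma> A j) \<in> N" if "j \<le> k A" for j using A that by (auto simp: N_def)
    consider "i = 0" | "0 < i" "i \<le> k A" | "i = Suc (k A)" using i unfolding n_def by linarith
    then have "net.link (endpoints (S.piece A i)) \<and> dist (\<gamma> A (\<tau> A i)) (\<gamma> A (\<tau> A (Suc i)))
        \<le> \<epsilon>"
    proof cases
      case 1
      then have "\<tau> A i = 0" "\<tau> A (Suc i) = s A" using \<sigma>[OF A] by (auto simp: \<tau>_def)
      moreover have "\<gamma> A (s A) \<in> N" using N[of 0] \<sigma>[OF A] by simp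
      ultimately show ?thesis unfolding e net.link_def using ds[OF A] end_vert(1)[OF A] by auto
    next
      case 2
      then have "\<tau> A i = \<sigma> A (i - 1)" "\<tau> A (Suc i) = \<sigma> A (Suc (i - 1))" "i - 1 < k A" by (auto simp:
          \<tau>_def)
      then have d: "dist (\<gamma> A (\<tau> A i)) (\<gamma> A (\<tau> A (Suc i))) \<le> \<delta>"
        and "\<gamma> A (\<tau> A i) \<in> N" "\<gamma> A (\<tau> A (Suc i)) \<in> N"
        using \<sigma>_Suc(2)[OF A, of "i - 1"] N[of "i - 1"] N[of "Suc (i - 1)"] by auto
      then show ?thesis unfolding e net.link_def using ne \<delta>(2) by auto
    next
      case 3
      then have \<tau>: "\<tau> A i = t A" "\<tau> A (Suc i) = 1" using \<sigma>[OF A] by (auto simp: \<tau>_def)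
      moreover have "\<gamma> A (t A) \<in> N" using N[of "k A"] \<sigma>[OF A] by simp
      moreover have "{\<gamma> A (t A), \<gamma> A 1} = {\<gamma> A 1, \<gamma> A (t A)}" by auto
      ultimately show ?thesis unfolding e \<tau> net.link_def using dt[OF A] end_vert(2)[OF A]
        by (auto simp: dist_commute)
    qed
    then show "net.link (endpoints (S.piece A i))" "dist (\<gamma> A (\<tau> A i)) (\<gamma> A (\<tau> A (Suc i))) \<le>
        \<epsilon>" by auto
  qed
  have VN: "verts S.refined \<subseteq> ?V \<union> N"
  proof
    fix q assume "q \<in> verts S.refined"
    then show "q \<in> ?V \<union> N"
    proof (cases rule: S.refined_verts_cases)
      case (2 A j)
      then have "\<tau> A j = \<sigma> A (j - 1)" "j - 1 \<le> k A" by (auto simp: \<tau>_def n_def)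
      then show ?thesis using 2 by (auto simp: N_def)
    qed auto
  qed
  have pieceE: "\<exists>A i. C = S.piece A i \<and> A \<in> ?E \<and> i < n A" if "C \<in> edges S.refined" for C
    using that by (auto simp: S.refined_def)
  have cc: "chord C \<inter> chord D \<subseteq> endpoints C \<inter> endpoints D"
    if C: "C \<in> edges S.refined" and D: "D \<in> edges S.refined" and "C \<noteq> D" for C D
  proof -
    obtain A i where A: "C = S.piece A i" "A \<in> ?E" "i < n A" using pieceE[OF C] by blast
    obtain B j where B: "D = S.piece B j" "B \<in> ?E" "j < n B" using pieceE[OF D] by blast
    have "endpoints C \<noteq> endpoints D"
      using S.piece_endpoints_inj[OF A(2,3) B(2,3)] A(1) B(1) \<open>C \<noteq> D\<close> by (auto simp: n_def)
    then show ?thesis unfolding chord_def using net.links_meet linkC[OF A(2,3)] linkC[OF B(2,3)] A(1) B(1) by blast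
  qed
  have cv: "chord C \<inter> verts S.refined \<subseteq> endpoints C" if C: "C \<in> edges S.refined" for C
    using pieceE[OF C] linkC net.link_avoids VN unfolding chord_def by blast
  have mesh: "\<tau> A (Suc i) - \<tau> A i < \<eta>" if A: "A \<in> ?E" and i: "i < n A" for A i
    using e3(2)[OF A S.\<tau>_range[OF A] S.\<tau>_range[OF A], of i "Suc i"] short[OF A i] \<epsilon>(3) i by auto
  show thesis
    by (rule that[OF S.subdivided_graph_axioms]) (use S.chord_graph_approximating[OF cc cv] mesh in blast)+
qed

end

section \<open>Turning of approximating graphs\<close>

text \<open>Outside \<open>{..<d}\<close> tuples take the fixed value \<open>undefined\<close>, so
  this is a product of compact sets over all natural numbers and Tychonoff's theorem
  applies.\<close>

lemma compact_sphere_tuples: "compact (sphere_tuples d)"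
proof -
  have "sphere_tuples d = (\<Pi>\<^sub>E i\<in>UNIV. if i < d then sphere 0 1 else {undefined})"
  proof (rule set_eqI)
    fix f :: "nat \<Rightarrow> real^3"
    have "f \<in> sphere_tuples d \<longleftrightarrow> (\<forall>i. (i < d \<longrightarrow> f i \<in> sphere 0 1) \<and>
        (\<not> i < d \<longrightarrow> f i = undefined))"
      unfolding sphere_tuples_def PiE_iff extensional_def by blast
    also have "\<dots> \<longleftrightarrow> f \<in> (\<Pi>\<^sub>E i\<in>UNIV. if i < d then sphere 0 1 else {undefined})"
      unfolding PiE_iff by simp
    finally show "f \<in> sphere_tuples d \<longleftrightarrow> f \<in> (\<Pi>\<^sub>E i\<in>UNIV. if i < d then sphere 0 1
        else {undefined})" .
  qed
  moreover have "compactin (product_topology (\<lambda>i. euclidean) UNIV) (\<Pi>\<^sub>E i\<in>UNIV. if i < d then sphere 0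
      1 else {undefined :: real^3})"
    unfolding compactin_PiE by auto
  ultimately show ?thesis by (simp add: euclidean_product_topology)
qed

lemma unit_tangent_segment:
  shows "unit_tangent q (closed_segment q b) = sgn (b - q)"
proof -
  have "b' = b" if "closed_segment q b = closed_segment q b'" for b'
    using that by (auto simp: doubleton_eq_iff)
  then show ?thesis unfolding unit_tangent_def by (intro the_equality) auto
qed

lemma edge_at_segment:
  assumes "polygonal_graph P" "A \<in> edges_at P q"
  shows "\<exists>b. b \<noteq> q \<and> A = closed_segment q b"
proof -
  have AP: "A \<in> edges P" and q: "q \<in> endpoints A" using assms(2) by (auto simp: edges_at_def)
  then obtain a b where ab: "A = closed_segment a b" using assms(1) unfolding polygonal_graph_def by blast
  have A: "simple_arc A" using assms(1) AP unfolding polygonal_graph_def continuous_graph_def by simp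
  have "a \<noteq> b"
  proof
    assume "a = b"
    obtain g where g: "arc g" "path_image g = A" using A unfolding simple_arc_def by blast
    then have "pathstart g \<in> A" "pathfinish g \<in> A" by auto
    then show False using arc_distinct_ends[OF g(1)] ab \<open>a = b\<close> by simp
  qed
  then have "q = a \<or> q = b" using endpoints_closed_segment(2) ab q by blast
  then show ?thesis using ab \<open>a \<noteq> b\<close> closed_segment_commute by metis
qed

definition tangent_tuple :: "space_graph \<Rightarrow> real^3 \<Rightarrow> nat \<Rightarrow> real^3" where
  "tangent_tuple P q = (\<lambda>i\<in>{..<valence P q}. unit_tangent q ((SOME f. bij_betw f {..<valence P q} (edges_at P
      q)) i))"

lemma vertex_curvature_tuple: "vertex_curvature c P q = c (valence P q) (tangent_tuple P q)"
  by (simp add: vertex_curvature_def tangent_tuple_def Let_def)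

lemma edges_at_enumeration:
  assumes "polygonal_graph P"
  shows "bij_betw (SOME f. bij_betw f {..<valence P q} (edges_at P q)) {..<valence P q} (edges_at P q)"
proof -
  have "finite (edges_at P q)"
    using assms unfolding polygonal_graph_def continuous_graph_def edges_at_def by simp
  then have "\<exists>f. bij_betw f {..<valence P q} (edges_at P q)"
    unfolding valence_def using ex_bij_betw_nat_finite by (metis atLeast0LessThan)
  then show ?thesis by (rule someI_ex)
qed

lemma tangent_tuple_sphere:
  assumes "polygonal_graph P"
  shows "tangent_tuple P q \<in> sphere_tuples (valence P q)"
proof -
  have "norm (unit_tangent q A) = 1" if "A \<in> edges_at P q" for A
    using edge_at_segment[OF assms that] unit_tangent_segment by (auto simp: norm_sgn)
  then show ?thesis
    unfolding tangent_tuple_def sphere_tuples_def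
    using bij_betwE[OF edges_at_enumeration[OF assms, of q]] by (intro restrict_PiE_iff[THEN iffD2]) auto
qed

text \<open>A continuous function on the compact set of tuples is bounded, and the bound depends on
  \<open>d\<close> alone, not on the graph. For \<open>d = 0\<close> there is just one
  tuple.\<close>

lemma vertex_curvature_bounded_below:
  assumes "curvature_notion c"
  shows "\<exists>C. \<forall>P q. polygonal_graph P \<longrightarrow> valence P q = d \<longrightarrow> C \<le>
      vertex_curvature c P q"
proof (cases "d = 0")
  case True
  have "tangent_tuple P q = (\<lambda>_. undefined)" if "valence P q = 0" for P q
    using that by (auto simp: tangent_tuple_def)
  then show ?thesis using True by (intro exI[of _ "c 0 (\<lambda>_. undefined)"]) (simp add: vertex_curvature_tuple)
next
  case False
  then have "continuous_on (sphere_tuples d) (c d)" using assms unfolding curvature_notion_def by auto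
  then have "bounded (c d ` sphere_tuples d)"
    using compact_continuous_image compact_sphere_tuples compact_imp_bounded by blast
  then obtain a where "\<And>T. T \<in> sphere_tuples d \<Longrightarrow> \<bar>c d T\<bar> \<le> a" unfolding bounded_iff
      by auto
  then have "- a \<le> vertex_curvature c P q" if "polygonal_graph P" "valence P q = d" for P q
    using tangent_tuple_sphere[OF that(1), of q] that(2) unfolding vertex_curvature_tuple by force
  then show ?thesis by blast
qed

text \<open>A chord of the unit circle is not longer than its arc: 2 sin x \<le> 2 x, with x half of
  the angle.\<close>

lemma norm_diff_le_arccos:
  fixes a b :: "'a::real_inner"
  assumes "norm a = 1" "norm b = 1"
  shows "norm (a - b) \<le> arccos (a \<bullet> b)"
proof -
  have ab: "\<bar>a \<bullet> b\<bar> \<le> 1" using Cauchy_Schwarz_ineq2[of a b] assms by simp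
  define x where "x = arccos (a \<bullet> b) / 2"
  have x: "0 \<le> x" "cos (2 * x) = a \<bullet> b" using ab arccos_lbound[of "a \<bullet> b"] by (simp_all add: x_def)
  have "(norm (a - b))\<^sup>2 = 2 - 2 * (a \<bullet> b)"
  proof -
    have "a \<bullet> a = 1" "b \<bullet> b = 1" using assms by (simp_all add: dot_square_norm)
    then show ?thesis unfolding power2_norm_eq_inner
      by (simp add: inner_diff_left inner_diff_right inner_commute)
  qed
  also have "\<dots> = (2 * sin x)\<^sup>2" using cos_double_sin[of x] x by (simp add: power_mult_distrib)
  also have "\<dots> \<le> (2 * x)\<^sup>2" using abs_sin_x_le_abs_x[of x] by (simp only: abs_le_square_iff[symmetric]
      abs_mult)
  finally show ?thesis using x power2_le_imp_le[of "norm (a - b)" "2 * x"] by (simp add: x_def)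
qed

text \<open>Both tangents point away from \<open>q\<close>; reversing one of them turns the exterior
  angle into the angle between consecutive directions of the polygon.\<close>

lemma bivalent_curvature:
  assumes c: "curvature_notion c" and P: "polygonal_graph P"
    and e: "edges_at P q = {closed_segment q x, closed_segment q y}"
    and ne: "x \<noteq> q" "y \<noteq> q" "x \<noteq> y"
  shows "norm (sgn (y - q) - sgn (q - x)) \<le> vertex_curvature c P q"
proof -
  have v: "valence P q = 2" using ne by (auto simp: valence_def e doubleton_eq_iff)
  define f where "f = (SOME f. bij_betw f {..<valence P q} (edges_at P q))"
  have f: "bij_betw f {..<2} (edges_at P q)" using edges_at_enumeration[OF P, of q] v unfolding f_def by simp
  then have f01: "f 0 \<in> edges_at P q" "f 1 \<in> edges_at P q" "f 0 \<noteq> f 1"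
    using bij_betwE[OF f] inj_on_eq_iff[OF bij_betw_imp_inj_on[OF f], of 0 1] by auto
  have T: "tangent_tuple P q 0 = unit_tangent q (f 0)" "tangent_tuple P q 1 = unit_tangent q (f 1)"
    unfolding tangent_tuple_def f_def v by auto
  have "\<forall>T\<in>sphere_tuples 2. c 2 T = arccos (T 0 \<bullet> (- T 1))" using c unfolding curvature_notion_def by
      (elim conjE)
  moreover have "tangent_tuple P q \<in> sphere_tuples 2" using tangent_tuple_sphere[OF P, of q] unfolding v .
  ultimately have c2: "vertex_curvature c P q = arccos (unit_tangent q (f 0) \<bullet> (- unit_tangent q (f 1)))"
    unfolding vertex_curvature_tuple v T[symmetric] by (rule bspec)
  have s: "- sgn (x - q) = sgn (q - x)" by (metis minus_diff_eq sgn_minus)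
  \<comment> \<open>The enumeration in \<open>vertex_curvature\<close> is an arbitrary choice, so
    the two edges may come in either order; the angle is symmetric.\<close>
  from f01 e consider "f 0 = closed_segment q x" "f 1 = closed_segment q y"
    | "f 0 = closed_segment q y" "f 1 = closed_segment q x" by auto
  then have "vertex_curvature c P q = arccos (sgn (y - q) \<bullet> sgn (q - x))"
    by cases (simp_all add: c2 unit_tangent_segment s[symmetric] inner_commute)
  then show ?thesis using norm_diff_le_arccos[of "sgn (y - q)" "sgn (q - x)"] ne by (simp add: norm_sgn)
qed

definition direction :: "(real \<Rightarrow> 'a::real_normed_vector) \<Rightarrow> (nat \<Rightarrow> real) \<Rightarrow>
    nat \<Rightarrow> 'a" where
  "direction g \<tau> i = sgn (g (\<tau> (Suc i)) - g (\<tau> i))"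

text \<open>Subdivision keeps the valences of old vertices, so their contribution is bounded below
  independently of the mesh. New vertices on other edges contribute nonnegative angles, which are
  dropped.\<close>

lemma (in subdivided_graph) edge_variation_le_curvature:
  assumes c: "curvature_notion c" and app: "approximating \<Gamma> (chord_graph refined)"
    and at: "\<And>q. edges_at (chord_graph refined) q = chord ` edges_at refined q"
    and val: "\<And>q. valence (chord_graph refined) q = valence refined q"
    and B: "\<And>P q. polygonal_graph P \<Longrightarrow> B (valence P q) \<le> vertex_curvature c P q"
    and A: "A \<in> edges \<Gamma>"
  shows "(\<Sum>q\<in>verts \<Gamma>. B (valence \<Gamma> q)) + (\<Sum>k\<in>{1..<n A}. norm (direction (\<gamma> A) (\<tau>
      A) k - direction (\<gamma> A) (\<tau> A) (k - 1)))
    \<le> polygonal_curvature c (chord_graph refined)"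
proof -
  let ?P = "chord_graph refined"
  have P: "polygonal_graph ?P" using app unfolding approximating_def by blast
  have vc: "norm (direction (\<gamma> A) (\<tau> A) k - direction (\<gamma> A) (\<tau> A) (k - 1)) \<le> vertex_curvature c
      ?P (\<gamma> A (\<tau> A k))"
    if A: "A \<in> edges \<Gamma>" and k: "0 < k" "k < n A" for A k
  proof -
    let ?q = "\<gamma> A (\<tau> A k)" and ?x = "\<gamma> A (\<tau> A (k - 1))" and ?y = "\<gamma> A (\<tau> A (Suc k))"
    have pt: "\<gamma> A (\<tau> A i) \<noteq> \<gamma> A (\<tau> A j)" if "i < j" "j \<le> n A" for i j
      using inj[OF A \<tau>_range[OF A] \<tau>_range[OF A], of i j] \<tau>_eq[OF A, of i j] that by simp
    have ne: "?x \<noteq> ?q" "?y \<noteq> ?q" "?x \<noteq> ?y"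
      using pt[of "k - 1" k] pt[of k "Suc k"] pt[of "k - 1" "Suc k"] k by auto
    have "edges_at ?P ?q = {closed_segment ?x ?q, closed_segment ?q ?y}"
      unfolding at new_vertex(1)[OF A k] using chord_piece[OF A, of k] chord_piece[OF A, of "k - 1"] k by simp
    then have "edges_at ?P ?q = {closed_segment ?q ?x, closed_segment ?q ?y}"
      by (simp only: closed_segment_commute[of ?x ?q])
    from bivalent_curvature[OF c P this ne] show ?thesis using k by (simp add: direction_def)
  qed
  define new where "new = verts refined - verts \<Gamma>"
  have V: "verts ?P = verts \<Gamma> \<union> new" "verts \<Gamma> \<inter> new = {}"
    unfolding new_def by (auto simp: chord_graph_def refined_def)
  have fin: "finite new" using refined_graph unfolding new_def continuous_graph_def by simp
  let ?N = "(\<lambda>k. \<gamma> A (\<tau> A k)) ` {1..<n A}"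
  have N: "?N \<subseteq> new" unfolding new_def using new_vertex(2)[OF A] A
    by (auto simp: refined_def) (metis less_imp_le)
  have injN: "inj_on (\<lambda>k. \<gamma> A (\<tau> A k)) {1..<n A}"
    by (rule inj_onI) (use inj[OF A \<tau>_range[OF A] \<tau>_range[OF A]] \<tau>_eq[OF A] in auto)
  have "(\<Sum>k\<in>{1..<n A}. norm (direction (\<gamma> A) (\<tau> A) k - direction (\<gamma> A) (\<tau> A) (k - 1)))
      \<le> (\<Sum>k\<in>{1..<n A}. vertex_curvature c ?P (\<gamma> A (\<tau> A k)))"
    by (rule sum_mono) (use vc[OF A] in auto)
  also have "\<dots> = (\<Sum>q\<in>?N. vertex_curvature c ?P q)" using sum.reindex[OF injN, of "vertex_curvature c ?P"] by
      simp
  also have "\<dots> \<le> (\<Sum>q\<in>new. vertex_curvature c ?P q)"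
  proof (rule sum_mono2[OF fin N])
    fix q assume "q \<in> new - ?N"
    then have q: "q \<in> verts refined" "q \<notin> verts \<Gamma>" by (auto simp: new_def)
    from q(1) show "0 \<le> vertex_curvature c ?P q"
    proof (cases rule: refined_verts_cases)
      case (2 B k)
      then show ?thesis using vc[OF 2(1-3)] norm_ge_zero order_trans by blast
    qed (use q in simp)
  qed
  finally have new: "(\<Sum>k\<in>{1..<n A}. norm (direction (\<gamma> A) (\<tau> A) k - direction (\<gamma> A) (\<tau> A)
      (k - 1)))
      \<le> (\<Sum>q\<in>new. vertex_curvature c ?P q)" .
  have "(\<Sum>q\<in>verts \<Gamma>. B (valence \<Gamma> q)) \<le> (\<Sum>q\<in>verts \<Gamma>. vertex_curvature c ?P q)"
    by (rule sum_mono) (metis B[OF P] val valence_old)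
  then show ?thesis
    unfolding polygonal_curvature_def V(1) sum.union_disjoint[OF finite_graph(1) fin V(2)] using new by linarith
qed

definition time_chain :: "real \<Rightarrow> real \<Rightarrow> nat \<Rightarrow> (nat \<Rightarrow> real) \<Rightarrow>
    bool" where
  "time_chain a b n \<tau> \<longleftrightarrow> \<tau> 0 = a \<and> \<tau> n = b \<and> (\<forall>i<n. \<tau> i < \<tau>
      (Suc i))"

text \<open>\<open>K\<close> is chosen before the mesh: it is an upper bound of the polygonal
  curvatures minus the lower bounds at the old vertices. For each mesh only one chain is obtained,
  since the supremum sees embedded polygons only.\<close>

lemma (in parametrized_graph) finite_variation:
  assumes c: "curvature_notion c" and fin: "total_curvature c \<Gamma> < \<infinity>" and A: "A \<in> edges \<Gamma>"
  shows "\<exists>K. \<forall>\<eta>>0. \<exists>n \<tau>. time_chain 0 1 n \<tau> \<and> (\<forall>i<n. \<tau> (Suc i) -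
      \<tau> i < \<eta>) \<and>
    (\<Sum>k\<in>{1..<n}. norm (direction (\<gamma> A) \<tau> k - direction (\<gamma> A) \<tau> (k - 1))) \<le> K"
proof -
  have "\<exists>M. \<forall>P. approximating \<Gamma> P \<longrightarrow> polygonal_curvature c P \<le> M"
  proof (cases "total_curvature c \<Gamma>")
    case (real M)
    then have "polygonal_curvature c P \<le> M" if "approximating \<Gamma> P" for P
      using that SUP_upper[of P "{P. approximating \<Gamma> P}" "\<lambda>P. ereal (polygonal_curvature c P)"]
      unfolding total_curvature_def by simp
    then show ?thesis by blast
  next
    \<comment> \<open>This value occurs only for the empty supremum, and then every bound
      serves.\<close>
    case MInf
    then have "\<not> approximating \<Gamma> P" for P
      using SUP_upper[of P "{P. approximating \<Gamma> P}" "\<lambda>P. ereal (polygonal_curvature c P)"]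
      unfolding total_curvature_def by auto
    then show ?thesis by blast
  qed (use fin in simp)
  then obtain M where M: "\<And>P. approximating \<Gamma> P \<Longrightarrow> polygonal_curvature c P \<le> M" by blast
  have "\<exists>B. \<forall>d P q. polygonal_graph P \<longrightarrow> valence P q = d \<longrightarrow> B d \<le>
      vertex_curvature c P q"
    using vertex_curvature_bounded_below[OF c] by metis
  then obtain B where B: "\<And>P q. polygonal_graph P \<Longrightarrow> B (valence P q) \<le> vertex_curvature c P q" by
      blast
  have "\<exists>n \<tau>. time_chain 0 1 n \<tau> \<and> (\<forall>i<n. \<tau> (Suc i) - \<tau> i < \<eta>) \<and>
    (\<Sum>k\<in>{1..<n}. norm (direction (\<gamma> A) \<tau> k - direction (\<gamma> A) \<tau> (k - 1))) \<le> M -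
        (\<Sum>q\<in>verts \<Gamma>. B (valence \<Gamma> q))"
    if "\<eta> > 0" for \<eta>
  proof -
    obtain n \<tau> where S: "subdivided_graph \<Gamma> \<gamma> n \<tau>"
      and app: "approximating \<Gamma> (chord_graph (subdivided_graph.refined \<Gamma> \<gamma> n \<tau>))"
      and at: "\<And>q. edges_at (chord_graph (subdivided_graph.refined \<Gamma> \<gamma> n \<tau>)) q = chord ` edges_at
          (subdivided_graph.refined \<Gamma> \<gamma> n \<tau>) q"
      and val: "\<And>q. valence (chord_graph (subdivided_graph.refined \<Gamma> \<gamma> n \<tau>)) q = valence
          (subdivided_graph.refined \<Gamma> \<gamma> n \<tau>) q"
      and mesh: "\<And>A i. A \<in> edges \<Gamma> \<Longrightarrow> i < n A \<Longrightarrow> \<tau> A (Suc i) - \<tau> A i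
          < \<eta>"
      using fine_approximation[OF \<open>\<eta> > 0\<close>] by (metis (no_types, lifting))
    interpret S: subdivided_graph \<Gamma> \<gamma> n \<tau> by (rule S)
    have "time_chain 0 1 (n A) (\<tau> A)" unfolding time_chain_def
      using S.\<tau>_0[OF A] S.\<tau>_n[OF A] S.\<tau>_Suc[OF A] by blast
    moreover have "(\<Sum>k\<in>{1..<n A}. norm (direction (\<gamma> A) (\<tau> A) k - direction (\<gamma> A) (\<tau> A) (k
        - 1))) \<le> M - (\<Sum>q\<in>verts \<Gamma>. B (valence \<Gamma> q))"
      using S.edge_variation_le_curvature[OF c app at val B A] M[OF app] by linarith
    ultimately show ?thesis using mesh[OF A] by blast
  qed
  then show ?thesis by blast
qed

section \<open>Acute arcs\<close>

text \<open>For nondegenerate chords, both directed along the arc, the inequality says that their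
  angle is at most \<pi>/3. Written without division and non-strictly, it includes degenerate chords
  and survives limits.\<close>

definition acute_on :: "real \<Rightarrow> real \<Rightarrow> (real \<Rightarrow> 'a::real_inner) \<Rightarrow> bool" where
  "acute_on a b g \<longleftrightarrow> (\<forall>s t s' t'. a \<le> s \<longrightarrow> s \<le> t \<longrightarrow> t \<le>
      b \<longrightarrow> a \<le> s' \<longrightarrow> s' \<le> t' \<longrightarrow> t' \<le> b \<longrightarrow>
     norm (g t - g s) * norm (g t' - g s') \<le> 2 * ((g t - g s) \<bullet> (g t' - g s')))"

lemma acute_on_subset: "acute_on a b g \<Longrightarrow> a \<le> c \<Longrightarrow> d \<le> b \<Longrightarrow> acute_on c
    d g"
  unfolding acute_on_def by (meson order_trans)

lemma time_chain_less: "time_chain a b n \<tau> \<Longrightarrow> i < j \<Longrightarrow> j \<le> n \<Longrightarrow> \<tau>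
    i < \<tau> j"
proof (induction j)
  case (Suc j)
  then show ?case unfolding time_chain_def by (cases "i = j") (auto intro: less_trans)
qed simp

lemma time_chain_le: "time_chain a b n \<tau> \<Longrightarrow> i \<le> j \<Longrightarrow> j \<le> n \<Longrightarrow>
    \<tau> i \<le> \<tau> j"
  using time_chain_less[of a b n \<tau> i j] by (cases "i = j") auto

lemma time_chain_above:
  assumes \<tau>: "time_chain a b n \<tau>" and mesh: "\<And>i. i < n \<Longrightarrow> \<tau> (Suc i) - \<tau> i < \<eta>"
      and s: "s \<in> {a..b}" and "0 < \<eta>"
  shows "\<exists>i\<le>n. s \<le> \<tau> i \<and> \<tau> i < s + \<eta>"
proof -
  have ex: "s \<le> \<tau> n" using \<tau> s by (simp add: time_chain_def)
  define i where "i = (LEAST i. s \<le> \<tau> i)"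
  have i: "s \<le> \<tau> i" unfolding i_def using ex by (rule LeastI)
  have "i \<le> n" unfolding i_def using ex by (rule Least_le)
  moreover have "\<tau> i < s + \<eta>"
  proof (cases i)
    case 0
    then show ?thesis using \<tau> s \<open>0 < \<eta>\<close> by (simp add: time_chain_def)
  next
    case (Suc j)
    then have "j < (LEAST i. s \<le> \<tau> i)" by (simp add: i_def[symmetric])
    from not_less_Least[OF this] have "\<not> s \<le> \<tau> j" .
    then show ?thesis using mesh[of j] Suc \<open>i \<le> n\<close> by simp
  qed
  ultimately show ?thesis using i by blast
qed

lemma time_chain_below:
  assumes \<tau>: "time_chain a b n \<tau>" and mesh: "\<And>i. i < n \<Longrightarrow> \<tau> (Suc i) - \<tau> i < \<eta>"
      and s: "s \<in> {a..b}" and "0 < \<eta>"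
  shows "\<exists>i\<le>n. \<tau> i \<le> s \<and> s - \<eta> < \<tau> i"
proof -
  define i where "i = (LEAST i. s < \<tau> i \<or> i = n)"
  have i: "s < \<tau> i \<or> i = n" unfolding i_def by (rule LeastI[of _ n]) simp
  have "i \<le> n" unfolding i_def by (rule Least_le) simp
  show ?thesis
  proof (cases "s < \<tau> i")
    case False
    then have "\<tau> i = b" using i \<tau> by (simp add: time_chain_def)
    then show ?thesis using False s \<open>0 < \<eta>\<close> \<open>i \<le> n\<close> by (intro exI[of _ i]) auto
  next
    case True
    have "\<tau> 0 \<le> s" using \<tau> s by (simp add: time_chain_def)
    then have "i \<noteq> 0" using True by (metis leD)
    then obtain j where j: "i = Suc j" using not0_implies_Suc by blast
    then have "j < (LEAST i. s < \<tau> i \<or> i = n)" by (simp add: i_def[symmetric])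
    from not_less_Least[OF this] have "\<not> s < \<tau> j" by simp
    then show ?thesis using mesh[of j] j \<open>i \<le> n\<close> True by (intro exI[of _ j]) auto
  qed
qed

text \<open>The norm is subadditive and the inner product bilinear, so acuteness passes from the
  summands to the sums.\<close>

lemma inner_sums_ge:
  fixes v w :: "'i \<Rightarrow> 'a::real_inner"
  assumes "\<And>p q. p \<in> I \<Longrightarrow> q \<in> J \<Longrightarrow> norm (v p) * norm (w q) \<le> 2 * (v p
      \<bullet> w q)"
  shows "norm (sum v I) * norm (sum w J) \<le> 2 * (sum v I \<bullet> sum w J)"
proof -
  have "norm (sum v I) * norm (sum w J) \<le> (\<Sum>p\<in>I. norm (v p)) * (\<Sum>q\<in>J. norm (w q))"
    by (intro mult_mono norm_sum sum_nonneg) auto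
  also have "\<dots> = (\<Sum>p\<in>I. \<Sum>q\<in>J. norm (v p) * norm (w q))" by (rule sum_product)
  also have "\<dots> \<le> (\<Sum>p\<in>I. \<Sum>q\<in>J. 2 * (v p \<bullet> w q))" by (intro sum_mono assms)
  also have "\<dots> = 2 * (sum v I \<bullet> sum w J)"
    unfolding inner_sum_left[of v] by (simp only: inner_sum_right sum_distrib_left)
  finally show ?thesis .
qed

text \<open>Unit vectors at distance at most 1 have inner product at least 1/2, which is the origin
  of the factor 2. The chords telescope into sides of the polygon, and \<open>inner_sums_ge\<close>
  does the rest.\<close>

lemma close_directions_acute:
  assumes "\<And>p q. p \<in> {i..<j} \<Longrightarrow> q \<in> {i'..<j'} \<Longrightarrow> norm (direction g \<tau> p -
      direction g \<tau> q) \<le> 1"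
    and "i \<le> j" "i' \<le> j'"
  shows "norm (g (\<tau> j) - g (\<tau> i)) * norm (g (\<tau> j') - g (\<tau> i')) \<le> 2 * ((g (\<tau> j) - g (\<tau> i))
      \<bullet> (g (\<tau> j') - g (\<tau> i')))"
proof -
  define v where "v p = g (\<tau> (Suc p)) - g (\<tau> p)" for p
  have tele: "g (\<tau> j) - g (\<tau> i) = sum v {i..<j}" if "i \<le> j" for i j
    using sum_Suc_diff'[OF that, of "\<lambda>p. g (\<tau> p)"] by (simp add: v_def)
  have "norm (v p) * norm (v q) \<le> 2 * (v p \<bullet> v q)" if "p \<in> {i..<j}" "q \<in> {i'..<j'}" for p q
  proof (cases "v p = 0 \<or> v q = 0")
    case False
    have n: "norm (sgn (v p)) = 1" "norm (sgn (v q)) = 1" using False by (auto simp: norm_sgn)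
    then have nn: "sgn (v p) \<bullet> sgn (v p) = 1" "sgn (v q) \<bullet> sgn (v q) = 1" by (simp_all add: dot_square_norm)
    have "norm (sgn (v p) - sgn (v q)) \<le> 1" using assms(1)[OF that] by (simp add: direction_def v_def)
    then have "(norm (sgn (v p) - sgn (v q)))\<^sup>2 \<le> 1" by (simp add: power_le_one)
    then have "1 \<le> 2 * (sgn (v p) \<bullet> sgn (v q))"
      unfolding power2_norm_eq_inner inner_diff_left inner_diff_right using nn by (simp add: inner_commute)
    then have "norm (v p) * norm (v q) * 1 \<le> norm (v p) * norm (v q) * (2 * (sgn (v p) \<bullet> sgn (v q)))"
      by (intro mult_left_mono) auto
    also have "\<dots> = 2 * ((norm (v p) *\<^sub>R sgn (v p)) \<bullet> (norm (v q) *\<^sub>R sgn (v q)))" by simp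
    also have "\<dots> = 2 * (v p \<bullet> v q)" using False by (simp add: sgn_div_norm)
    finally show ?thesis by simp
  qed auto
  then show ?thesis unfolding tele[OF assms(2)] tele[OF assms(3)] by (rule inner_sums_ge)
qed

text \<open>Suppose that chains of arbitrarily small mesh had all their directions inside
  \<open>{l..r}\<close> within distance 1 of each other. Then chords between chain points would
  satisfy the acute inequality, and in the limit so would the two chords that violate it.\<close>

lemma not_acute_turning:
  fixes g :: "real \<Rightarrow> 'a::real_inner"
  assumes cont: "continuous_on {0..1} g" and lr: "0 \<le> l" "l \<le> r" "r \<le> 1" and bad: "\<not> acute_on l r g"
  shows "\<exists>\<eta>>0. \<forall>n \<tau>. time_chain 0 1 n \<tau> \<longrightarrow> (\<forall>i<n. \<tau> (Suc i) -
      \<tau> i < \<eta>) \<longrightarrow>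
    (\<exists>i j. i \<le> j \<and> j < n \<and> l \<le> \<tau> i \<and> \<tau> (Suc j) \<le> r \<and> 1 < norm (direction g
        \<tau> j - direction g \<tau> i))"
proof (rule ccontr)
  assume contra: "\<not> ?thesis"
  obtain s t s' t' where st: "l \<le> s" "s \<le> t" "t \<le> r" "l \<le> s'" "s' \<le> t'" "t' \<le> r"
    and viol: "\<not> norm (g t - g s) * norm (g t' - g s') \<le> 2 * ((g t - g s) \<bullet> (g t' - g s'))"
    using bad unfolding acute_on_def by blast
  have "s \<noteq> t" "s' \<noteq> t'" using viol by auto
  then have lt: "s < t" "s' < t'" using st by auto
  \<comment> \<open>Half of the shorter interval: the chain point just after \<open>s\<close> then
    precedes the one just before \<open>t\<close>, and likewise for \<open>s'\<close> and
    \<open>t'\<close>.\<close>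
  define \<eta>0 where "\<eta>0 = min (t - s) (t' - s') / 2"
  define \<eta> where "\<eta> m = \<eta>0 / real (Suc m)" for m
  have \<eta>0: "0 < \<eta>0" "2 * \<eta>0 \<le> t - s" "2 * \<eta>0 \<le> t' - s'" using lt by (auto simp: \<eta>0_def)
  have \<eta>: "0 < \<eta> m" "\<eta> m \<le> \<eta>0" for m using \<eta>0(1) by (auto simp: \<eta>_def field_simps)
  have "\<exists>x y x' y'. (s \<le> x \<and> x \<le> s + \<eta> m) \<and> (t - \<eta> m \<le> y \<and> y \<le> t) \<and>
      (s' \<le> x' \<and> x' \<le> s' + \<eta> m) \<and> (t' - \<eta> m \<le> y' \<and> y' \<le> t') \<and>
      norm (g y - g x) * norm (g y' - g x') \<le> 2 * ((g y - g x) \<bullet> (g y' - g x'))" for m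
  proof -
    obtain n \<tau> where \<tau>: "time_chain 0 1 n \<tau>" and mesh: "\<And>i. i < n \<Longrightarrow> \<tau> (Suc i) -
        \<tau> i < \<eta> m"
      and no: "\<And>i j. i \<le> j \<Longrightarrow> j < n \<Longrightarrow> l \<le> \<tau> i \<Longrightarrow> \<tau> (Suc
          j) \<le> r \<Longrightarrow> norm (direction g \<tau> j - direction g \<tau> i) \<le> 1"
      using contra \<eta>(1)[of m] by (metis not_le)
    have in01: "s \<in> {0..1}" "t \<in> {0..1}" "s' \<in> {0..1}" "t' \<in> {0..1}" using st lr by auto
    obtain i where i: "i \<le> n" "s \<le> \<tau> i" "\<tau> i < s + \<eta> m" using time_chain_above[OF \<tau> mesh in01(1)
        \<eta>(1)] by blast
    obtain j where j: "j \<le> n" "\<tau> j \<le> t" "t - \<eta> m < \<tau> j" using time_chain_below[OF \<tau> mesh in01(2)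
        \<eta>(1)] by blast
    obtain i' where i': "i' \<le> n" "s' \<le> \<tau> i'" "\<tau> i' < s' + \<eta> m" using time_chain_above[OF \<tau> mesh
        in01(3) \<eta>(1)] by blast
    obtain j' where j': "j' \<le> n" "\<tau> j' \<le> t'" "t' - \<eta> m < \<tau> j'" using time_chain_below[OF \<tau> mesh
        in01(4) \<eta>(1)] by blast
    have "\<tau> i < \<tau> j" "\<tau> i' < \<tau> j'" using i j i' j' \<eta>(2)[of m] \<eta>0 by linarith+
    then have ij: "i \<le> j" "i' \<le> j'"
      using time_chain_le[OF \<tau>, of j i] time_chain_le[OF \<tau>, of j' i'] i(1) i'(1) by force+
    have inside: "l \<le> \<tau> p \<and> \<tau> (Suc p) \<le> r \<and> p < n" if "p \<in> {i..<j} \<or> p \<in> {i'..<j'}"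
        for p
    proof -
      have "l \<le> \<tau> p"
        using that time_chain_le[OF \<tau>, of i p] time_chain_le[OF \<tau>, of i' p] i i' j j' st by fastforce
      moreover have "\<tau> (Suc p) \<le> r"
        using that time_chain_le[OF \<tau>, of "Suc p" j] time_chain_le[OF \<tau>, of "Suc p" j'] i i' j j' st by fastforce
      ultimately show ?thesis using that j j' by auto
    qed
    have "norm (direction g \<tau> p - direction g \<tau> q) \<le> 1" if "p \<in> {i..<j}" "q \<in> {i'..<j'}" for p q
      using no[of p q] no[of q p] inside[of p] inside[of q] that by (metis le_cases norm_minus_commute)
    from close_directions_acute[OF this ij]
    show ?thesis using i j i' j' less_imp_le by blast
  qed
  then obtain x y x' y' where X: "\<And>m. s \<le> x m \<and> x m \<le> s + \<eta> m" and Y: "\<And>m. t - \<eta> m \<le> y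
      m \<and> y m \<le> t"
    and X': "\<And>m. s' \<le> x' m \<and> x' m \<le> s' + \<eta> m" and Y': "\<And>m. t' - \<eta> m \<le> y' m \<and> y' m
        \<le> t'"
    and ineq: "\<And>m. norm (g (y m) - g (x m)) * norm (g (y' m) - g (x' m)) \<le> 2 * ((g (y m) - g (x m)) \<bullet> (g
        (y' m) - g (x' m)))"
    by metis
  have \<eta>lim: "\<eta> \<longlonglongrightarrow> 0" unfolding \<eta>_def by (rule LIMSEQ_Suc) (rule lim_const_over_n)
  have "(\<lambda>m. s + \<eta> m) \<longlonglongrightarrow> s" "(\<lambda>m. t - \<eta> m) \<longlonglongrightarrow> t"
      "(\<lambda>m. s' + \<eta> m) \<longlonglongrightarrow> s'" "(\<lambda>m. t' - \<eta> m) \<longlonglongrightarrow> t'"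
    using \<eta>lim by (auto intro!: tendsto_eq_intros)
  then have lims: "x \<longlonglongrightarrow> s" "y \<longlonglongrightarrow> t" "x' \<longlonglongrightarrow> s'" "y'
      \<longlonglongrightarrow> t'"
    using X Y X' Y' by (auto intro: tendsto_sandwich[of "\<lambda>_. s" _ _ "\<lambda>m. s + \<eta> m"]
      tendsto_sandwich[of "\<lambda>m. t - \<eta> m" _ _ "\<lambda>m. t"] tendsto_sandwich[of "\<lambda>_. s'" _ _
          "\<lambda>m. s' + \<eta> m"]
      tendsto_sandwich[of "\<lambda>m. t' - \<eta> m" _ _ "\<lambda>m. t'"])
  have glim: "(\<lambda>m. g (z m)) \<longlonglongrightarrow> g u" if "z \<longlonglongrightarrow> u" "u \<in> {0..1}"
      "\<And>m. z m \<in> {0..1}" for z u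
    using continuous_on_tendsto_compose[OF cont that(1,2)] that(3) by simp
  have "x m \<in> {0..1}" "y m \<in> {0..1}" "x' m \<in> {0..1}" "y' m \<in> {0..1}" for m
    using X[of m] Y[of m] X'[of m] Y'[of m] \<eta>(2)[of m] \<eta>0 st lr by auto
  then have G: "(\<lambda>m. g (x m)) \<longlonglongrightarrow> g s" "(\<lambda>m. g (y m)) \<longlonglongrightarrow> g t"
      "(\<lambda>m. g (x' m)) \<longlonglongrightarrow> g s'" "(\<lambda>m. g (y' m)) \<longlonglongrightarrow> g t'"
    using lims st lr by (auto intro!: glim)
  have "norm (g t - g s) * norm (g t' - g s') \<le> 2 * ((g t - g s) \<bullet> (g t' - g s'))"
  proof (rule LIMSEQ_le)
    show "(\<lambda>m. norm (g (y m) - g (x m)) * norm (g (y' m) - g (x' m))) \<longlonglongrightarrow> norm (g t - g s) *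
        norm (g t' - g s')"
      by (intro tendsto_intros G)
    show "(\<lambda>m. 2 * ((g (y m) - g (x m)) \<bullet> (g (y' m) - g (x' m)))) \<longlonglongrightarrow> 2 * ((g t - g s)
        \<bullet> (g t' - g s'))"
      by (intro tendsto_intros G)
  qed (use ineq in blast)
  then show False using viol by simp
qed

lemma turning_le_sum:
  fixes e :: "nat \<Rightarrow> 'a::real_normed_vector"
  assumes "i \<le> j"
  shows "norm (e j - e i) \<le> (\<Sum>k\<in>{i<..j}. norm (e k - e (k - 1)))"
  using assms
proof (induction j rule: dec_induct)
  case (step j)
  have "norm (e (Suc j) - e i) \<le> norm (e (Suc j) - e j) + norm (e j - e i)"
    using norm_triangle_ineq[of "e (Suc j) - e j" "e j - e i"] by simp
  moreover have "{i<..Suc j} = insert (Suc j) {i<..j}" using step.hyps by auto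
  ultimately show ?case using step.IH by simp
qed simp

text \<open>Each bad interval costs at least one unit of turning, in a fine enough inscribed polygon.\<close>

lemma no_disjoint_bad_intervals:
  fixes g :: "real \<Rightarrow> 'a::real_inner"
  assumes cont: "continuous_on {0..1} g"
    and var: "\<And>\<eta>. 0 < \<eta> \<Longrightarrow> \<exists>n \<tau>. time_chain 0 1 n \<tau> \<and> (\<forall>i<n.
        \<tau> (Suc i) - \<tau> i < \<eta>) \<and>
      (\<Sum>k\<in>{1..<n}. norm (direction g \<tau> k - direction g \<tau> (k - 1))) \<le> K"
    and lr: "\<And>m. 0 \<le> l m \<and> l m \<le> r m \<and> r m \<le> 1" and bad: "\<And>m::nat. \<not> acute_on (l m) (r
        m) g"
    and disj: "\<And>m m'. m < m' \<Longrightarrow> r m < l m' \<or> r m' < l m"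
  shows False
proof -
  \<comment> \<open>More than \<open>K\<close> bad intervals already exceed the available turning.
    The mesh that exposes a bad interval depends on the interval, so a common mesh is taken for
    finitely many of them.\<close>
  obtain N :: nat where N: "K < real N" using reals_Archimedean2 by blast
  define Q where "Q m \<eta> \<longleftrightarrow> (\<forall>n \<tau>. time_chain 0 1 n \<tau> \<longrightarrow>
      (\<forall>i<n. \<tau> (Suc i) - \<tau> i < \<eta>) \<longrightarrow>
    (\<exists>i j. i \<le> j \<and> j < n \<and> l m \<le> \<tau> i \<and> \<tau> (Suc j) \<le> r m \<and> 1 < norm
        (direction g \<tau> j - direction g \<tau> i)))" for m \<eta>
  have "\<exists>\<eta>>0. \<forall>m\<in>{..<N}. Q m \<eta>"
  proof (rule finite_uniform_radius)
    show "\<exists>\<eta>>0. Q m \<eta>" for m unfolding Q_def using not_acute_turning[OF cont _ _ _ bad] lr by blast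
    show "Q m e" if "Q m d" "e \<le> d" for m d e using that unfolding Q_def by (meson less_le_trans)
  qed simp
  then obtain \<eta> where \<eta>: "0 < \<eta>" "\<And>m. m < N \<Longrightarrow> Q m \<eta>" by auto
  obtain n \<tau> where \<tau>: "time_chain 0 1 n \<tau>" and mesh: "\<forall>i<n. \<tau> (Suc i) - \<tau> i < \<eta>"
    and K: "(\<Sum>k\<in>{1..<n}. norm (direction g \<tau> k - direction g \<tau> (k - 1))) \<le> K" using var[OF \<eta>(1)]
        by blast
  define D where "D k = norm (direction g \<tau> k - direction g \<tau> (k - 1))" for k
  define I where "I m = {k \<in> {1..<n}. l m \<le> \<tau> k \<and> \<tau> k \<le> r m}" for m
  have one: "1 \<le> sum D (I m)" if m: "m < N" for m
  proof -
    obtain i j where ij: "i \<le> j" "j < n" "l m \<le> \<tau> i" "\<tau> (Suc j) \<le> r m" "1 < norm (direction g \<tau> j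
        - direction g \<tau> i)"
      using \<eta>(2)[OF m] \<tau> mesh unfolding Q_def by blast
    \<comment> \<open>\<open>D k\<close> compares the sides before and after
      \<open>\<tau> k\<close>, so the turning from side \<open>i\<close> to side \<open>j\<close>
      happens at the indices from \<open>Suc i\<close> to \<open>j\<close>.\<close>
    have "{i<..j} \<subseteq> I m"
    proof
      fix k assume k: "k \<in> {i<..j}"
      then have "\<tau> i \<le> \<tau> k" "\<tau> k \<le> \<tau> (Suc j)" using time_chain_le[OF \<tau>] ij by auto
      then show "k \<in> I m" using k ij by (auto simp: I_def)
    qed
    then have "sum D {i<..j} \<le> sum D (I m)" by (intro sum_mono2) (auto simp: I_def D_def)
    then show ?thesis using turning_le_sum[OF ij(1), of "direction g \<tau>"] ij(5) by (simp add: D_def)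
  qed
  have "real N = (\<Sum>m<N. 1)" by simp
  also have "\<dots> \<le> (\<Sum>m<N. sum D (I m))" by (intro sum_mono one) simp
  also have "\<dots> = sum D (\<Union>m<N. I m)"
  proof (rule sum.UNION_disjoint[symmetric])
    have "I m \<inter> I m' = {}" if "m < m'" for m m' using disj[OF that] by (auto simp: I_def)
    then show "\<forall>m\<in>{..<N}. \<forall>m'\<in>{..<N}. m \<noteq> m' \<longrightarrow> I m \<inter> I m' = {}"
      by (metis inf_commute linorder_neqE_nat)
  qed (auto simp: I_def)
  also have "\<dots> \<le> sum D {1..<n}" by (intro sum_mono2) (auto simp: I_def D_def)
  finally show False using K N unfolding D_def by linarith
qed

text \<open>Each time \<open>u\<close> is approximated by \<open>max (l m) u\<close>, which stays in
  the smaller interval and tends to \<open>u\<close>; the non-strict inequality survives.\<close>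

lemma acute_on_left_closed:
  fixes g :: "real \<Rightarrow> 'a::real_inner"
  assumes cont: "continuous_on {a..b} g" and "a < b" and ac: "\<And>l. a < l \<Longrightarrow> l \<le> b \<Longrightarrow>
      acute_on l b g"
  shows "acute_on a b g"
  unfolding acute_on_def
proof (intro allI impI)
  fix s t s' t' assume st: "a \<le> s" "s \<le> t" "t \<le> b" "a \<le> s'" "s' \<le> t'" "t' \<le> b"
  define l where "l m = a + (b - a) / real (Suc m)" for m
  have l: "a < l m" "l m \<le> b" for m
  proof -
    have "(b - a) / real (Suc m) \<le> (b - a) / 1" using \<open>a < b\<close> by (intro divide_left_mono) auto
    then show "a < l m" "l m \<le> b" using \<open>a < b\<close> by (simp_all add: l_def)
  qed
  have "(\<lambda>m. (b - a) / real (Suc m)) \<longlonglongrightarrow> 0" by (rule LIMSEQ_Suc) (rule lim_const_over_n)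
  from tendsto_add[OF tendsto_const[of a] this] have ll: "l \<longlonglongrightarrow> a" unfolding l_def by simp
  have G: "(\<lambda>m. g (max (l m) u)) \<longlonglongrightarrow> g u" if u: "a \<le> u" "u \<le> b" for u
  proof (rule continuous_on_tendsto_compose[OF cont])
    show "(\<lambda>m. max (l m) u) \<longlonglongrightarrow> u" using tendsto_max[OF ll tendsto_const[of u]] u by (simp
        add: max_absorb2)
    show "\<forall>\<^sub>F m in sequentially. max (l m) u \<in> {a..b}" using l u by (simp add: le_max_iff_disj)
  qed (use u in simp)
  have Gs: "(\<lambda>m. g (max (l m) s)) \<longlonglongrightarrow> g s" "(\<lambda>m. g (max (l m) t))
      \<longlonglongrightarrow> g t"
    "(\<lambda>m. g (max (l m) s')) \<longlonglongrightarrow> g s'" "(\<lambda>m. g (max (l m) t'))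
        \<longlonglongrightarrow> g t'"
    using st by (auto intro!: G)
  show "norm (g t - g s) * norm (g t' - g s') \<le> 2 * ((g t - g s) \<bullet> (g t' - g s'))"
  proof (rule LIMSEQ_le)
    show "(\<lambda>m. norm (g (max (l m) t) - g (max (l m) s)) * norm (g (max (l m) t') - g (max (l m) s')))
      \<longlonglongrightarrow> norm (g t - g s) * norm (g t' - g s')" by (intro tendsto_intros Gs)
    show "(\<lambda>m. 2 * ((g (max (l m) t) - g (max (l m) s)) \<bullet> (g (max (l m) t') - g (max (l m) s'))))
      \<longlonglongrightarrow> 2 * ((g t - g s) \<bullet> (g t' - g s'))" by (intro tendsto_intros Gs)
    have "norm (g (max (l m) t) - g (max (l m) s)) * norm (g (max (l m) t') - g (max (l m) s'))
      \<le> 2 * ((g (max (l m) t) - g (max (l m) s)) \<bullet> (g (max (l m) t') - g (max (l m) s')))" for m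
      by (rule ac[OF l(1,2)[of m], unfolded acute_on_def, rule_format]) (use l[of m] st in \<open>auto simp:
          le_max_iff_disj\<close>)
    then show "\<exists>M. \<forall>m\<ge>M. norm (g (max (l m) t) - g (max (l m) s)) * norm (g (max (l m) t') - g (max (l
        m) s'))
      \<le> 2 * ((g (max (l m) t) - g (max (l m) s)) \<bullet> (g (max (l m) t') - g (max (l m) s')))" by blast
  qed
qed

text \<open>Otherwise, by \<open>acute_on_left_closed\<close>, every right neighbourhood of
  \<open>x\<close> contains a bad interval that does not touch \<open>x\<close>. Choosing each one
  to the left of the previous one gives infinitely many disjoint bad intervals, contrary to
  \<open>no\<close>.\<close>

lemma acute_right:
  fixes g :: "real \<Rightarrow> 'a::real_inner"
  assumes cont: "continuous_on {0..1} g"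
    and no: "\<And>l r. (\<And>m::nat. 0 \<le> l m \<and> l m \<le> r m \<and> r m \<le> 1) \<Longrightarrow> (\<And>m.
        \<not> acute_on (l m) (r m) g) \<Longrightarrow>
      (\<And>m m'. m < m' \<Longrightarrow> r m < l m' \<or> r m' < l m) \<Longrightarrow> False"
    and x: "0 \<le> x" "x < 1"
  shows "\<exists>d>0. x + d \<le> 1 \<and> acute_on x (x + d) g"
proof (rule ccontr)
  assume contra: "\<not> ?thesis"
  have bad: "\<exists>l r. x < l \<and> l \<le> r \<and> r < b \<and> \<not> acute_on l r g" if b: "x < b" "b \<le> 1" for b
  proof -
    define c where "c = (x + b) / 2"
    have c: "x < c" "c < b" using b by (auto simp: c_def)
    have "continuous_on {x..c} g" using continuous_on_subset[OF cont] x b c by auto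
    moreover have "\<not> acute_on x c g" using contra c b by (auto dest: spec[of _ "c - x"])
    ultimately obtain l where "x < l" "l \<le> c" "\<not> acute_on l c g" using acute_on_left_closed c(1) by blast
    then show ?thesis using c by blast
  qed
  have "\<exists>f. \<forall>m::nat. (x < fst (f m) \<and> fst (f m) \<le> snd (f m) \<and> snd (f m) \<le> 1 \<and> \<not>
      acute_on (fst (f m)) (snd (f m)) g) \<and>
      snd (f (Suc m)) < fst (f m)"
  proof (rule dependent_nat_choice)
    show "\<exists>p. x < fst p \<and> fst p \<le> snd p \<and> snd p \<le> 1 \<and> \<not> acute_on (fst p) (snd p) g"
      using bad[OF x(2)] by force
    fix p and m :: nat assume p: "x < fst p \<and> fst p \<le> snd p \<and> snd p \<le> 1 \<and> \<not> acute_on (fst p)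
        (snd p) g"
    then obtain l r where "x < l" "l \<le> r" "r < fst p" "\<not> acute_on l r g" using bad[of "fst p"] by auto
    then show "\<exists>q. (x < fst q \<and> fst q \<le> snd q \<and> snd q \<le> 1 \<and> \<not> acute_on (fst q) (snd q)
        g) \<and> snd q < fst p"
      using p by (intro exI[of _ "(l, r)"]) auto
  qed
  then obtain f where f: "\<And>m::nat. x < fst (f m)" "\<And>m. fst (f m) \<le> snd (f m)" "\<And>m. snd (f m) \<le> 1"
    "\<And>m. \<not> acute_on (fst (f m)) (snd (f m)) g" "\<And>m. snd (f (Suc m)) < fst (f m)" by blast
  have "snd (f m') < fst (f m)" if "m < m'" for m m'
    using that
  proof (induction m')
    case (Suc m')
    show ?case
    proof (cases "m = m'")
      case False
      then have "snd (f m') < fst (f m)" using Suc by simp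
      then show ?thesis using f(2)[of m'] f(5)[of m'] by linarith
    qed (simp add: f(5))
  qed simp
  moreover have "0 \<le> fst (f m) \<and> fst (f m) \<le> snd (f m) \<and> snd (f m) \<le> 1" for m using f(1-3)[of m] x(1)
      by simp
  ultimately show False using no[of "\<lambda>m. fst (f m)" "\<lambda>m. snd (f m)"] f(4) by blast
qed

lemma acute_on_reflect:
  fixes g :: "real \<Rightarrow> 'a::real_inner"
  assumes "acute_on a b (\<lambda>x. g (1 - x))"
  shows "acute_on (1 - b) (1 - a) g"
  unfolding acute_on_def
proof (intro allI impI)
  fix s t s' t' assume st: "1 - b \<le> s" "s \<le> t" "t \<le> 1 - a" "1 - b \<le> s'" "s' \<le> t'" "t' \<le> 1 - a"
  have "norm (g (1 - (1 - s)) - g (1 - (1 - t))) * norm (g (1 - (1 - s')) - g (1 - (1 - t')))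
      \<le> 2 * ((g (1 - (1 - s)) - g (1 - (1 - t))) \<bullet> (g (1 - (1 - s')) - g (1 - (1 - t'))))"
    using assms[unfolded acute_on_def, rule_format, of "1 - t" "1 - s" "1 - t'" "1 - s'"] st by simp
  then have "norm (g s - g t) * norm (g s' - g t') \<le> 2 * ((g s - g t) \<bullet> (g s' - g t'))" by simp
  also have "\<dots> = 2 * ((g t - g s) \<bullet> (g t' - g s'))" by (metis inner_minus_left inner_minus_right minus_diff_eq
      minus_minus)
  finally show "norm (g t - g s) * norm (g t' - g s') \<le> 2 * ((g t - g s) \<bullet> (g t' - g s'))"
    by (simp add: norm_minus_commute)
qed

text \<open>Reversal of time exchanges the two sides and maps disjoint bad intervals to disjoint bad
  intervals.\<close>

lemma acute_left:
  fixes g :: "real \<Rightarrow> 'a::real_inner"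
  assumes cont: "continuous_on {0..1} g"
    and no: "\<And>l r. (\<And>m::nat. 0 \<le> l m \<and> l m \<le> r m \<and> r m \<le> 1) \<Longrightarrow> (\<And>m.
        \<not> acute_on (l m) (r m) g) \<Longrightarrow>
      (\<And>m m'. m < m' \<Longrightarrow> r m < l m' \<or> r m' < l m) \<Longrightarrow> False"
    and x: "0 < x" "x \<le> 1"
  shows "\<exists>d>0. 0 \<le> x - d \<and> acute_on (x - d) x g"
proof -
  have "\<exists>d>0. (1 - x) + d \<le> 1 \<and> acute_on (1 - x) ((1 - x) + d) (\<lambda>x. g (1 - x))"
  proof (rule acute_right)
    show "continuous_on {0..1} (\<lambda>x. g (1 - x))"
      by (rule continuous_on_compose2[OF cont]) (auto intro!: continuous_intros)
    fix l r :: "nat \<Rightarrow> real"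
    assume lr: "\<And>m. 0 \<le> l m \<and> l m \<le> r m \<and> r m \<le> 1" and bad: "\<And>m. \<not> acute_on (l m) (r m)
        (\<lambda>x. g (1 - x))"
      and disj: "\<And>m m'. m < m' \<Longrightarrow> r m < l m' \<or> r m' < l m"
    show False
    proof (rule no[of "\<lambda>m. 1 - r m" "\<lambda>m. 1 - l m"])
      show "0 \<le> 1 - r m \<and> 1 - r m \<le> 1 - l m \<and> 1 - l m \<le> 1" for m using lr[of m] by simp
      show "\<not> acute_on (1 - r m) (1 - l m) g" for m
        using bad[of m] acute_on_reflect[of "1 - r m" "1 - l m" "\<lambda>x. g (1 - x)"] by auto
      show "1 - l m < 1 - r m' \<or> 1 - l m' < 1 - r m" if "m < m'" for m m' using disj[OF that] by auto
    qed
  qed (use x in auto)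
  then obtain d where d: "d > 0" "(1 - x) + d \<le> 1" "acute_on (1 - x) ((1 - x) + d) (\<lambda>x. g (1 - x))" by blast
  then have "acute_on (x - d) x g" using acute_on_reflect[OF d(3)] by (simp add: algebra_simps)
  then show ?thesis using d by (intro exI[of _ d]) auto
qed

definition acute_chain :: "(real \<Rightarrow> 'a::real_inner) \<Rightarrow> real \<Rightarrow> real \<Rightarrow> nat
    \<Rightarrow> (nat \<Rightarrow> real) \<Rightarrow> bool" where
  "acute_chain g a b n \<tau> \<longleftrightarrow> time_chain a b n \<tau> \<and> (\<forall>i<n. acute_on (\<tau> i)
      (\<tau> (Suc i)) g)"

lemma acute_chain_append:
  assumes "acute_chain g a b n \<tau>" "acute_chain g b c m \<sigma>"
  shows "\<exists>k \<upsilon>. acute_chain g a c k \<upsilon>"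
proof -
  define \<upsilon> where "\<upsilon> i = (if i \<le> n then \<tau> i else \<sigma> (i - n))" for i
  have b: "\<tau> n = \<sigma> 0" using assms unfolding acute_chain_def time_chain_def by simp
  have *: "\<upsilon> i = \<sigma> (i - n)" if "n \<le> i" for i using that b by (auto simp: \<upsilon>_def)
  have "acute_chain g a c (n + m) \<upsilon>"
    unfolding acute_chain_def time_chain_def
  proof (intro conjI allI impI)
    show "\<upsilon> 0 = a" using assms by (simp add: \<upsilon>_def acute_chain_def time_chain_def)
    show "\<upsilon> (n + m) = c" using *[of "n + m"] assms by (simp add: acute_chain_def time_chain_def)
    fix i assume i: "i < n + m"
    have "\<upsilon> i < \<upsilon> (Suc i) \<and> acute_on (\<upsilon> i) (\<upsilon> (Suc i)) g"
    proof (cases "i < n")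
      case True
      then have "\<upsilon> i = \<tau> i" "\<upsilon> (Suc i) = \<tau> (Suc i)" by (auto simp: \<upsilon>_def)
      then show ?thesis using assms True by (simp add: acute_chain_def time_chain_def)
    next
      case False
      then have "\<upsilon> i = \<sigma> (i - n)" "\<upsilon> (Suc i) = \<sigma> (Suc (i - n))" "i - n < m"
        using *[of i] *[of "Suc i"] i by (auto simp: Suc_diff_le)
      then show ?thesis using assms by (simp add: acute_chain_def time_chain_def)
    qed
    then show "\<upsilon> i < \<upsilon> (Suc i)" "acute_on (\<upsilon> i) (\<upsilon> (Suc i)) g" by auto
  qed
  then show ?thesis by blast
qed

text \<open>Bisection reduces the claim to short intervals around a point \<open>x\<close>. These
  are cut at \<open>x\<close>, because acuteness is known on each side of \<open>x\<close> but may
  fail across it.\<close>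

lemma acute_chain_exists:
  fixes g :: "real \<Rightarrow> 'a::real_inner"
  assumes cont: "continuous_on {0..1} g"
    and var: "\<And>\<eta>. 0 < \<eta> \<Longrightarrow> \<exists>n \<tau>. time_chain 0 1 n \<tau> \<and> (\<forall>i<n.
        \<tau> (Suc i) - \<tau> i < \<eta>) \<and>
      (\<Sum>k\<in>{1..<n}. norm (direction g \<tau> k - direction g \<tau> (k - 1))) \<le> K"
  shows "\<exists>n \<tau>. acute_chain g 0 1 n \<tau>"
proof -
  have no: False
    if "\<And>m. 0 \<le> l m \<and> l m \<le> r m \<and> r m \<le> 1" "\<And>m::nat. \<not> acute_on (l m) (r m) g"
      "\<And>m m'. m < m' \<Longrightarrow> r m < l m' \<or> r m' < l m" for l r
    using no_disjoint_bad_intervals[where l = l and r = r, OF cont var that] .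
  have right: "\<exists>d>0. x + d \<le> 1 \<and> acute_on x (x + d) g" if "0 \<le> x" "x < 1" for x
    using acute_right[OF cont _ that] no by metis
  have left: "\<exists>d>0. 0 \<le> x - d \<and> acute_on (x - d) x g" if "0 < x" "x \<le> 1" for x
    using acute_left[OF cont _ that] no by metis
  define P where "P a b \<longleftrightarrow> (0 \<le> a \<longrightarrow> b \<le> 1 \<longrightarrow> (\<exists>n \<tau>.
      acute_chain g a b n \<tau>))" for a b
  \<comment> \<open>For \<open>a = b\<close> the chain has no steps; this occurs when
    \<open>x\<close> is an end of the short interval.\<close>
  have single: "\<exists>n \<tau>. acute_chain g a b n \<tau>" if "a \<le> b" "a < b \<Longrightarrow> acute_on a b g" for a
      b
  proof (cases "a = b")
    case True
    then show ?thesis by (intro exI[of _ 0] exI[of _ "\<lambda>_. a"]) (simp add: acute_chain_def time_chain_def)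
  next
    case False
    then show ?thesis using that
      by (intro exI[of _ 1] exI[of _ "\<lambda>i. if i = 0 then a else b"]) (simp add: acute_chain_def time_chain_def)
  qed
  have "P 0 1"
  proof (rule Bolzano)
    show "P a c" if "P a b" "P b c" "a \<le> b" "b \<le> c" for a b c
      using that acute_chain_append unfolding P_def by (metis order_trans)
    fix x :: real assume x: "0 \<le> x" "x \<le> 1"
    have "\<exists>d>0. \<forall>b. x < b \<longrightarrow> b \<le> 1 \<longrightarrow> b - x < d \<longrightarrow> acute_on
        x b g"
    proof (cases "x < 1")
      case True
      then obtain d where d: "d > 0" "acute_on x (x + d) g" using right[OF x(1)] by blast
      have "acute_on x b g" if "b - x < d" for b using acute_on_subset[OF d(2), of x b] that by simp
      then show ?thesis using d(1) by blast
    qed (use x in \<open>auto intro: exI[of _ 1]\<close>)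
    then obtain d where d: "d > 0" "\<And>b. x < b \<Longrightarrow> b \<le> 1 \<Longrightarrow> b - x < d \<Longrightarrow>
        acute_on x b g" by blast
    have "\<exists>e>0. \<forall>a. 0 \<le> a \<longrightarrow> a < x \<longrightarrow> x - a < e \<longrightarrow> acute_on
        a x g"
    proof (cases "0 < x")
      case True
      then obtain e where e: "e > 0" "acute_on (x - e) x g" using left[OF _ x(2)] by blast
      have "acute_on a x g" if "x - a < e" for a using acute_on_subset[OF e(2), of a x] that by simp
      then show ?thesis using e(1) by blast
    qed (use x in \<open>auto intro: exI[of _ 1]\<close>)
    then obtain e where e: "e > 0" "\<And>a. 0 \<le> a \<Longrightarrow> a < x \<Longrightarrow> x - a < e \<Longrightarrow>
        acute_on a x g" by blast
    have "P a b" if ab: "a \<le> x" "x \<le> b" "b - a < min d e" for a b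
      unfolding P_def
    proof (intro impI)
      assume ab': "0 \<le> a" "b \<le> 1"
      have "\<exists>n \<tau>. acute_chain g a x n \<tau>" using ab ab' by (intro single e) auto
      moreover have "\<exists>n \<tau>. acute_chain g x b n \<tau>" using ab ab' by (intro single d) auto
      ultimately show "\<exists>n \<tau>. acute_chain g a b n \<tau>" using acute_chain_append by blast
    qed
    then show "\<exists>d>0. \<forall>a b. a \<le> x \<and> x \<le> b \<and> b - a < d \<longrightarrow> P a b"
      using d(1) e(1) by (intro exI[of _ "min d e"]) auto
  qed simp
  then show ?thesis unfolding P_def by simp
qed

lemma (in parametrized_graph) acute_subdivision:
  assumes "curvature_notion c" "total_curvature c \<Gamma> < \<infinity>"
  shows "\<exists>n \<tau>. subdivided_graph \<Gamma> \<gamma> n \<tau> \<and> (\<forall>A\<in>edges \<Gamma>. \<forall>i<n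
      A. acute_on (\<tau> A i) (\<tau> A (Suc i)) (\<gamma> A))"
proof -
  have "\<exists>n \<tau>. acute_chain (\<gamma> A) 0 1 n \<tau>" if A: "A \<in> edges \<Gamma>" for A
    using finite_variation[OF assms A] acute_chain_exists[OF cont[OF A]] by blast
  then obtain n \<tau> where c: "\<And>A. A \<in> edges \<Gamma> \<Longrightarrow> acute_chain (\<gamma> A) 0 1 (n A)
      (\<tau> A)" by metis
  have "subdivided_graph \<Gamma> \<gamma> n \<tau>"
    by unfold_locales (use c in \<open>simp_all add: acute_chain_def time_chain_def\<close>)
  then show ?thesis using c unfolding acute_chain_def by blast
qed

section \<open>Straightening graphs with acute edges\<close>

definition polyhedral_set :: "'a::real_vector set \<Rightarrow> bool" where
  "polyhedral_set A \<longleftrightarrow> (\<exists>S. finite S \<and> (\<forall>s\<in>S. \<exists>a b. s = closed_segment a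
      b) \<and> A = \<Union>S)"

lemma polyhedral_set_segment: "polyhedral_set (closed_segment a b)"
  unfolding polyhedral_set_def by (intro exI[of _ "{closed_segment a b}"]) auto

lemma polyhedral_set_UN:
  assumes "finite I" "\<And>i. i \<in> I \<Longrightarrow> polyhedral_set (A i)"
  shows "polyhedral_set (\<Union>i\<in>I. A i)"
proof -
  have "\<forall>i\<in>I. \<exists>S. finite S \<and> (\<forall>s\<in>S. \<exists>a b. s = closed_segment a b) \<and> A i =
      \<Union>S"
    using assms(2) unfolding polyhedral_set_def by blast
  then obtain S where S: "\<forall>i\<in>I. finite (S i) \<and> (\<forall>s\<in>S i. \<exists>a b. s = closed_segment a b)
      \<and> A i = \<Union>(S i)"
    by metis
  then show ?thesis unfolding polyhedral_set_def using assms(1)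
    by (intro exI[of _ "\<Union>i\<in>I. S i"]) auto
qed

lemma polyhedral_set_Un: "polyhedral_set A \<Longrightarrow> polyhedral_set B \<Longrightarrow> polyhedral_set (A \<union>
    B)"
  using polyhedral_set_UN[of "{A, B}" "\<lambda>C. C"] by auto

lemma closed_segment_param:
  fixes p q :: "'a::real_vector"
  assumes "a < b"
  shows "(\<lambda>z. p + ((z - a) / (b - a)) *\<^sub>R (q - p)) ` {a..b} = closed_segment p q"
proof
  show "(\<lambda>z. p + ((z - a) / (b - a)) *\<^sub>R (q - p)) ` {a..b} \<subseteq> closed_segment p q"
  proof clarify
    fix z assume "z \<in> {a..b}"
    then have "0 \<le> (z - a) / (b - a)" "(z - a) / (b - a) \<le> 1" using assms by auto
    then show "p + ((z - a) / (b - a)) *\<^sub>R (q - p) \<in> closed_segment p q"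
      unfolding in_segment by (intro exI[of _ "(z - a) / (b - a)"]) (simp add: algebra_simps)
  qed
  show "closed_segment p q \<subseteq> (\<lambda>z. p + ((z - a) / (b - a)) *\<^sub>R (q - p)) ` {a..b}"
  proof
    fix x assume "x \<in> closed_segment p q"
    then obtain l where l: "0 \<le> l" "l \<le> 1" "x = (1 - l) *\<^sub>R p + l *\<^sub>R q" unfolding in_segment by blast
    have "(a + l * (b - a) - a) / (b - a) = l" using assms by simp
    then have "x = p + ((a + l * (b - a) - a) / (b - a)) *\<^sub>R (q - p)"
      using l(3) by (simp add: algebra_simps)
    moreover have "0 \<le> l * (b - a)" "l * (b - a) \<le> b - a"
      using l assms mult_right_mono[of l 1 "b - a"] by auto
    then have "a + l * (b - a) \<in> {a..b}" by simp
    ultimately show "x \<in> (\<lambda>z. p + ((z - a) / (b - a)) *\<^sub>R (q - p)) ` {a..b}" by blast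
  qed
qed

text \<open>Linear interpolation keeps the height \<open>z\<close>, so \<open>g z - f z\<close> is
  orthogonal to \<open>u\<close> and can serve as the displacement in \<open>tube_embedding\<close>.
  On short intervals one segment suffices, and bisection joins the segments.\<close>

lemma polygonal_approximation:
  fixes f :: "real \<Rightarrow> 'a::euclidean_space"
  assumes "\<alpha> \<le> \<beta>" and cont: "continuous_on {\<alpha>..\<beta>} f" and "0 < \<rho>" and height: "\<And>z. z
      \<in> {\<alpha>..\<beta>} \<Longrightarrow> f z \<bullet> u = z"
  shows "\<exists>g. continuous_on {\<alpha>..\<beta>} g \<and> g \<alpha> = f \<alpha> \<and> g \<beta> = f \<beta> \<and>
      polyhedral_set (g ` {\<alpha>..\<beta>}) \<and>
    (\<forall>z\<in>{\<alpha>..\<beta>}. g z \<bullet> u = z \<and> norm (g z - f z) \<le> \<rho>)"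
proof -
  define Q where "Q a b g \<longleftrightarrow> continuous_on {a..b} g \<and> g a = f a \<and> g b = f b \<and>
      polyhedral_set (g ` {a..b}) \<and>
    (\<forall>z\<in>{a..b}. g z \<bullet> u = z \<and> norm (g z - f z) \<le> \<rho>)" for a b and g :: "real \<Rightarrow>
        'a"
  define P where "P a b \<longleftrightarrow> (\<alpha> \<le> a \<longrightarrow> b \<le> \<beta> \<longrightarrow>
      (\<exists>g. Q a b g))" for a b
  have "P \<alpha> \<beta>"
  proof (rule Bolzano[OF assms(1)])
    fix a b c assume P: "P a b" "P b c" "a \<le> b" "b \<le> c"
    show "P a c" unfolding P_def
    proof (intro impI)
      assume ac: "\<alpha> \<le> a" "c \<le> \<beta>"
      obtain g where g: "Q a b g" using P ac unfolding P_def by auto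
      obtain h where h: "Q b c h" using P ac unfolding P_def by auto
      define k where "k z = (if z \<le> b then g z else h z)" for z
      have gb: "g b = h b" using g h unfolding Q_def by simp
      then have kg: "k z = g z" if "z \<in> {a..b}" for z using that by (simp add: k_def)
      have kh: "k z = h z" if "z \<in> {b..c}" for z using that gb by (cases "z = b") (auto simp: k_def)
      have U: "{a..c} = {a..b} \<union> {b..c}" using P by auto
      have "continuous_on {a..b} k" "continuous_on {b..c} k"
        using g h unfolding Q_def
        by (metis (no_types, lifting) kg continuous_on_eq, metis (no_types, lifting) kh continuous_on_eq)
      then have "continuous_on {a..c} k" unfolding U by (intro continuous_on_closed_Un) auto
      moreover have "k ` {a..c} = g ` {a..b} \<union> h ` {b..c}"
        unfolding U image_Un using kg kh by (metis image_cong)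
      then have "polyhedral_set (k ` {a..c})" using g h polyhedral_set_Un unfolding Q_def by metis
      moreover have "k a = f a" "k c = f c" using g h kg[of a] kh[of c] P unfolding Q_def by auto
      moreover have "k z \<bullet> u = z \<and> norm (k z - f z) \<le> \<rho>" if "z \<in> {a..c}" for z
        using that g h kg[of z] kh[of z] unfolding Q_def U by auto
      ultimately show "\<exists>g. Q a c g" unfolding Q_def by blast
    qed
  next
    fix x assume x: "\<alpha> \<le> x" "x \<le> \<beta>"
    obtain d where d: "d > 0" "\<And>z. z \<in> {\<alpha>..\<beta>} \<Longrightarrow> dist z x < d \<Longrightarrow> dist (f
        z) (f x) < \<rho> / 2"
      using cont x \<open>0 < \<rho>\<close> unfolding continuous_on_iff by (metis atLeastAtMost_iff half_gt_zero)
    have "P a b" if ab: "a \<le> x" "x \<le> b" "b - a < d" for a b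
      unfolding P_def
    proof (intro impI)
      assume ab': "\<alpha> \<le> a" "b \<le> \<beta>"
      have near: "norm (f z - f w) \<le> \<rho>" if "z \<in> {a..b}" "w \<in> {a..b}" for z w
      proof -
        have "dist (f z) (f x) < \<rho> / 2" "dist (f w) (f x) < \<rho> / 2"
          by (rule d(2); use that ab ab' in \<open>auto simp: dist_real_def\<close>)+
        then show ?thesis using dist_triangle2[of "f z" "f w" "f x"] by (simp add: dist_norm)
      qed
      show "\<exists>g. Q a b g"
      proof (cases "a = b")
        case True
        then have "Q a b f" using ab ab' height \<open>0 < \<rho>\<close> polyhedral_set_segment[of "f a" "f a"] by (auto
            simp: Q_def)
        then show ?thesis by blast
      next
        case False
        then have lt: "a < b" using ab by simp
        define g where "g = (\<lambda>z. f a + ((z - a) / (b - a)) *\<^sub>R (f b - f a))"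
        have "continuous_on {a..b} g" unfolding g_def using lt by (intro continuous_intros) auto
        moreover have "g a = f a" "g b = f b" using lt by (auto simp: g_def)
        moreover have "polyhedral_set (g ` {a..b})"
          unfolding g_def closed_segment_param[OF lt] by (rule polyhedral_set_segment)
        moreover have "g z \<bullet> u = z \<and> norm (g z - f z) \<le> \<rho>" if z: "z \<in> {a..b}" for z
        proof
          have "f a \<bullet> u = a" "f b \<bullet> u = b" using height ab ab' by auto
          then show "g z \<bullet> u = z" using lt by (simp add: g_def inner_add_left inner_diff_left)
          define l where "l = (z - a) / (b - a)"
          have l: "0 \<le> l" "l \<le> 1" using z lt by (auto simp: l_def)
          have "g z - f z = (1 - l) *\<^sub>R (f a - f z) + l *\<^sub>R (f b - f z)" by (simp add: g_def l_def[symmetric]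
              algebra_simps)
          then have "norm (g z - f z) \<le> (1 - l) * norm (f a - f z) + l * norm (f b - f z)"
            using l norm_triangle_ineq[of "(1 - l) *\<^sub>R (f a - f z)" "l *\<^sub>R (f b - f z)"] by simp
          also have "\<dots> \<le> (1 - l) * \<rho> + l * \<rho>" using l near z lt by (intro add_mono mult_left_mono) auto
          finally show "norm (g z - f z) \<le> \<rho>" by (simp add: algebra_simps)
        qed
        ultimately show ?thesis unfolding Q_def by blast
      qed
    qed
    then show "\<exists>d>0. \<forall>a b. a \<le> x \<and> x \<le> b \<and> b - a < d \<longrightarrow> P a b" using d(1)
        by blast
  qed
  then show ?thesis unfolding P_def Q_def by simp
qed

section \<open>Graphs all of whose edges are acute\<close>

locale acute_graph = parametrized_graph +
  assumes acute: "A \<in> edges \<Gamma> \<Longrightarrow> acute_on 0 1 (\<gamma> A)"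
begin

lemma chords_acute:
  assumes A: "A \<in> edges \<Gamma>" and "0 \<le> s" "s < t" "t \<le> 1" "0 \<le> s'" "s' < t'" "t' \<le> 1"
  shows "0 < (\<gamma> A t - \<gamma> A s) \<bullet> (\<gamma> A t' - \<gamma> A s')"
proof -
  have "\<gamma> A t \<noteq> \<gamma> A s" "\<gamma> A t' \<noteq> \<gamma> A s'" using inj[OF A] assms by auto
  then have "0 < norm (\<gamma> A t - \<gamma> A s) * norm (\<gamma> A t' - \<gamma> A s')" by simp
  also have "\<dots> \<le> 2 * ((\<gamma> A t - \<gamma> A s) \<bullet> (\<gamma> A t' - \<gamma> A s'))"
    using acute[OF A] assms unfolding acute_on_def by simp
  finally show ?thesis by simp
qed

lemma height_mono:
  assumes "A \<in> edges \<Gamma>" "0 \<le> s" "s < t" "t \<le> 1"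
  shows "\<gamma> A s \<bullet> (\<gamma> A 1 - \<gamma> A 0) < \<gamma> A t \<bullet> (\<gamma> A 1 - \<gamma> A 0)"
  using chords_acute[OF assms, of 0 1] by (simp add: inner_diff_left)

text \<open>The difference of the squared distances is the inner product of the chord from
  \<open>s\<close> to \<open>t\<close> with the sum of the chords from 0 to \<open>t\<close> and
  from 0 to \<open>s\<close>; acuteness makes it positive.\<close>

lemma dist_start_mono:
  assumes A: "A \<in> edges \<Gamma>" and st: "0 \<le> s" "s < t" "t \<le> 1"
  shows "dist (\<gamma> A 0) (\<gamma> A s) < dist (\<gamma> A 0) (\<gamma> A t)"
proof -
  have "0 < (\<gamma> A t - \<gamma> A s) \<bullet> (\<gamma> A t - \<gamma> A 0)" using chords_acute[OF A st, of 0 t] st by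
      simp
  moreover have "0 \<le> (\<gamma> A t - \<gamma> A s) \<bullet> (\<gamma> A s - \<gamma> A 0)"
    using chords_acute[OF A st, of 0 s] st by (cases "s = 0") auto
  moreover have "(norm (\<gamma> A t - \<gamma> A 0))\<^sup>2 - (norm (\<gamma> A s - \<gamma> A 0))\<^sup>2 =
      (\<gamma> A t - \<gamma> A s) \<bullet> (\<gamma> A t - \<gamma> A 0) + (\<gamma> A t - \<gamma> A s) \<bullet>
          (\<gamma> A s - \<gamma> A 0)"
    unfolding power2_norm_eq_inner by (simp add: algebra_simps inner_commute)
  ultimately have "(norm (\<gamma> A s - \<gamma> A 0))\<^sup>2 < (norm (\<gamma> A t - \<gamma> A 0))\<^sup>2" by linarith
  then show ?thesis by (simp add: dist_norm norm_minus_commute power_less_imp_less_base)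
qed

lemma dist_end_mono:
  assumes A: "A \<in> edges \<Gamma>" and st: "0 \<le> s" "s < t" "t \<le> 1"
  shows "dist (\<gamma> A 1) (\<gamma> A t) < dist (\<gamma> A 1) (\<gamma> A s)"
proof -
  have "0 < (\<gamma> A t - \<gamma> A s) \<bullet> (\<gamma> A 1 - \<gamma> A s)" using chords_acute[OF A st, of s 1] st by
      simp
  moreover have "0 \<le> (\<gamma> A t - \<gamma> A s) \<bullet> (\<gamma> A 1 - \<gamma> A t)"
    using chords_acute[OF A st, of t 1] st by (cases "t = 1") auto
  moreover have "(norm (\<gamma> A 1 - \<gamma> A s))\<^sup>2 - (norm (\<gamma> A 1 - \<gamma> A t))\<^sup>2 =
      (\<gamma> A t - \<gamma> A s) \<bullet> (\<gamma> A 1 - \<gamma> A s) + (\<gamma> A t - \<gamma> A s) \<bullet>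
          (\<gamma> A 1 - \<gamma> A t)"
    unfolding power2_norm_eq_inner by (simp add: algebra_simps inner_commute)
  ultimately have "(norm (\<gamma> A 1 - \<gamma> A t))\<^sup>2 < (norm (\<gamma> A 1 - \<gamma> A s))\<^sup>2" by linarith
  then show ?thesis by (simp add: dist_norm power_less_imp_less_base)
qed

lemma dist_end_inj:
  assumes A: "A \<in> edges \<Gamma>" and q: "q \<in> endpoints A"
  shows "inj_on (dist q) A"
proof -
  have "q = \<gamma> A 0 \<or> q = \<gamma> A 1" using q ends[OF A] by auto
  then have "s = t" if "s \<in> {0..1}" "t \<in> {0..1}" "dist q (\<gamma> A s) = dist q (\<gamma> A t)" for s t
    using dist_start_mono[OF A, of s t] dist_start_mono[OF A, of t s] dist_end_mono[OF A, of s t] dist_end_mono[OF A, of t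
        s] that
    by (cases s t rule: linorder_cases) auto
  then have "inj_on (dist q) (\<gamma> A ` {0..1})" by (intro inj_onI) blast
  then show ?thesis unfolding img'[OF A] .
qed

text \<open>By \<open>dist_end_inj\<close> the distance from \<open>q\<close> is a homeomorphism of
  the compact edge onto its image, which is connected and contains \<open>{0..\<epsilon>}\<close>.
  The inverse is the parametrization by radius from which the directions in
  \<open>cone_embedding\<close> are formed.\<close>

lemma radial_parametrization:
  assumes A: "A \<in> edges \<Gamma>" and q: "q \<in> endpoints A" and e: "\<epsilon> \<le> dist (\<gamma> A 0) (\<gamma> A
      1)"
  shows "\<exists>p. continuous_on {0..\<epsilon>} p \<and> (\<forall>r\<in>{0..\<epsilon>}. p r \<in> A \<and> dist q (p r)
      = r) \<and> (\<forall>z\<in>A. p (dist q z) = z)"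
proof -
  have comp: "compact A" using compact_arc_image[OF arc[OF A]] img[OF A] by simp
  have cont': "continuous_on A (dist q)" by (intro continuous_intros)
  obtain p where p: "homeomorphism A (dist q ` A) (dist q) p"
    using homeomorphism_compact[OF comp cont' refl dist_end_inj[OF A q]] by blast
  have "{0..\<epsilon>} \<subseteq> dist q ` A"
  proof -
    have "connected (dist q ` A)"
      using connected_continuous_image[OF cont'] connected_path_image[OF arc_imp_path[OF arc[OF A]]] img[OF A] by simp
    moreover have "0 \<in> dist q ` A"
      using q ends[OF A] in_edge[OF A, of 0] in_edge[OF A, of 1] by force
    moreover have "dist (\<gamma> A 0) (\<gamma> A 1) \<in> dist q ` A"
    proof (cases "q = \<gamma> A 0")
      case False
      then have "q = \<gamma> A 1" using q ends[OF A] by auto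
      then have "dist (\<gamma> A 0) (\<gamma> A 1) = dist q (\<gamma> A 0)" by (simp add: dist_commute)
      then show ?thesis using in_edge[OF A, of 0] by simp
    qed (use in_edge[OF A, of 1] in auto)
    ultimately have "{0..dist (\<gamma> A 0) (\<gamma> A 1)} \<subseteq> dist q ` A" by (simp add: connected_contains_Icc)
    then show ?thesis using e by auto
  qed
  then have sub: "r \<in> dist q ` A" if "r \<in> {0..\<epsilon>}" for r using that by blast
  have "continuous_on {0..\<epsilon>} p"
    by (rule continuous_on_subset[OF homeomorphism_cont2[OF p]]) (use sub in blast)
  moreover have "p r \<in> A \<and> dist q (p r) = r" if "r \<in> {0..\<epsilon>}" for r
    using homeomorphism_apply2[OF p sub[OF that]] homeomorphism_image2[OF p] sub[OF that] by blast
  ultimately show ?thesis using homeomorphism_apply1[OF p] by (intro exI[of _ p]) simp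
qed

text \<open>At each radius the directions of the edges at \<open>q\<close> are distinct, since edges
  meet only at vertices and the ball contains no other vertex. So \<open>cone_embedding\<close>,
  centred at \<open>q\<close>, applies.\<close>

lemma straightens_near_vertex:
  assumes "0 < \<epsilon>" and q: "q \<in> verts \<Gamma>" and sep: "\<And>q'. q' \<in> verts \<Gamma> \<Longrightarrow> q'
      \<noteq> q \<Longrightarrow> 2 * \<epsilon> < dist q q'"
  shows "\<exists>h. bounded_embedding h \<and> (\<forall>x. x \<notin> ball q \<epsilon> \<longrightarrow> h x = x) \<and>
    (\<forall>A\<in>edges_at \<Gamma> q. \<forall>w\<in>A. dist q w = \<epsilon> \<longrightarrow> h ` (A \<inter> cball q
        \<epsilon>) = closed_segment q w)"
proof -
  let ?I = "edges_at \<Gamma> q"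
  have I: "A \<in> edges \<Gamma>" "q \<in> endpoints A" if "A \<in> ?I" for A using that by (auto simp: edges_at_def)
  have len: "\<epsilon> \<le> dist (\<gamma> A 0) (\<gamma> A 1)" if "A \<in> ?I" for A
  proof -
    have "\<gamma> A 0 = q \<or> \<gamma> A 1 = q" using I(2)[OF that] ends[OF I(1)[OF that]] by auto
    then have "2 * \<epsilon> < dist (\<gamma> A 0) (\<gamma> A 1)"
      using sep end_vert[OF I(1)[OF that]] ends_ne[OF I(1)[OF that]] by (metis dist_commute)
    then show ?thesis using \<open>0 < \<epsilon>\<close> by simp
  qed
  have "\<forall>A\<in>?I. \<exists>p. continuous_on {0..\<epsilon>} p \<and> (\<forall>r\<in>{0..\<epsilon>}. p r \<in> A
      \<and> dist q (p r) = r) \<and> (\<forall>z\<in>A. p (dist q z) = z)"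
    using radial_parametrization[OF I len] by blast
  then obtain p where p: "\<forall>A\<in>?I. continuous_on {0..\<epsilon>} (p A) \<and> (\<forall>r\<in>{0..\<epsilon>}. p A
      r \<in> A \<and> dist q (p A r) = r) \<and> (\<forall>z\<in>A. p A (dist q z) = z)"
    by metis
  have pc: "continuous_on {0..\<epsilon>} (p A)" and pA: "\<And>r. r \<in> {0..\<epsilon>} \<Longrightarrow> p A r \<in> A"
      and pd: "\<And>r. r \<in> {0..\<epsilon>} \<Longrightarrow> dist q (p A r) = r"
    and pz: "\<And>z. z \<in> A \<Longrightarrow> p A (dist q z) = z" if "A \<in> ?I" for A
    using p that by auto
  define P where "P A r = (1/r) *\<^sub>R (p A r - q)" for A r
  obtain k where k: "continuous_on UNIV k" "inj k" "\<And>x. norm (k x) = norm x" "\<And>x. \<epsilon> \<le> norm x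
      \<Longrightarrow> k x = x"
    "\<And>A r. A \<in> ?I \<Longrightarrow> r \<in> {0<..\<epsilon>} \<Longrightarrow> k (r *\<^sub>R P A r) = r *\<^sub>R
        P A \<epsilon>"
  proof (rule cone_embedding[of ?I \<epsilon> P])
    show "finite ?I" using finite_graph(2) by (simp add: edges_at_def)
    fix A assume A: "A \<in> ?I"
    have "continuous_on {0<..\<epsilon>} (p A)" by (rule continuous_on_subset[OF pc[OF A]]) auto
    then show "continuous_on {0<..\<epsilon>} (P A)" unfolding P_def by (intro continuous_intros) auto
    show "norm (P A r) = 1" if "r \<in> {0<..\<epsilon>}" for r
      using pd[OF A, of r] that by (simp add: P_def dist_norm norm_minus_commute)
    fix B r assume B: "B \<in> ?I" "A \<noteq> B" and r: "r \<in> {0<..\<epsilon>}"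
    show "P A r \<noteq> P B r"
    proof
      assume "P A r = P B r"
      then have eq: "p A r = p B r" using r by (simp add: P_def)
      have "p A r \<in> verts \<Gamma>"
        using edges_meet[OF I(1)[OF A] I(1)[OF B(1)] B(2), of "p A r"] pA[OF A, of r] pA[OF B(1), of r] eq r by simp
      moreover have "dist q (p A r) = r" using pd[OF A, of r] r by simp
      ultimately show False using sep[of "p A r"] r by fastforce
    qed
  qed (use \<open>0 < \<epsilon>\<close> in auto)
  define h where "h x = q + k (x - q)" for x
  have "bounded_embedding h"
    unfolding bounded_embedding_def
  \<comment> \<open>Inside the ball a point and its image have the same distance from
    \<open>q\<close>, which is below \<epsilon>.\<close>
  proof (intro conjI exI[of _ "2 * \<epsilon>"] allI)
    show "continuous_on UNIV h" unfolding h_def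
      by (intro continuous_intros continuous_on_compose2[OF k(1)]) auto
    show "inj h"
    proof (rule injI)
      fix x y assume "h x = h y"
      then have "k (x - q) = k (y - q)" by (simp add: h_def)
      from injD[OF k(2) this] show "x = y" by simp
    qed
    show "norm (h x - x) \<le> 2 * \<epsilon>" for x
    proof (cases "\<epsilon> \<le> norm (x - q)")
      case False
      have "h x - x = k (x - q) - (x - q)" by (simp add: h_def)
      then have "norm (h x - x) \<le> norm (k (x - q)) + norm (x - q)" by (metis norm_triangle_ineq4)
      then show ?thesis using False k(3)[of "x - q"] by simp
    qed (use k(4)[of "x - q"] \<open>0 < \<epsilon>\<close> in \<open>simp add: h_def\<close>)
  qed
  moreover have "h x = x" if "x \<notin> ball q \<epsilon>" for x
    using that k(4)[of "x - q"] by (simp add: h_def dist_norm norm_minus_commute)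
  moreover have "h ` (A \<inter> cball q \<epsilon>) = closed_segment q w" if A: "A \<in> ?I" and w: "w \<in> A" "dist q w =
      \<epsilon>" for A w
  proof -
    have "A \<inter> cball q \<epsilon> = p A ` {0..\<epsilon>}"
    proof
      show "A \<inter> cball q \<epsilon> \<subseteq> p A ` {0..\<epsilon>}"
      proof
        fix z assume z: "z \<in> A \<inter> cball q \<epsilon>"
        then have "z = p A (dist q z)" using pz[OF A] by simp
        then show "z \<in> p A ` {0..\<epsilon>}" using z by (metis IntD2 atLeastAtMost_iff imageI mem_cball zero_le_dist)
      qed
      show "p A ` {0..\<epsilon>} \<subseteq> A \<inter> cball q \<epsilon>" using pA[OF A] pd[OF A] by auto
    qed
    moreover have "h (p A r) = q + ((r - 0) / (\<epsilon> - 0)) *\<^sub>R (w - q)" if r: "r \<in> {0..\<epsilon>}" for r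
    proof (cases "r = 0")
      case True
      then have "p A r = q" using pd[OF A, of 0] \<open>0 < \<epsilon>\<close> by simp
      moreover have "k 0 = 0" using k(3)[of 0] by simp
      ultimately show ?thesis using True by (simp add: h_def)
    next
      case False
      have "p A r - q = r *\<^sub>R P A r" using False by (simp add: P_def)
      moreover have "p A \<epsilon> = w" using pz[OF A w(1)] w(2) by simp
      ultimately show ?thesis using k(5)[OF A, of r] r False by (simp add: h_def P_def)
    qed
    ultimately have "h ` (A \<inter> cball q \<epsilon>) = (\<lambda>r. q + ((r - 0) / (\<epsilon> - 0)) *\<^sub>R (w - q))
        ` {0..\<epsilon>}"
      by (simp add: image_image)
    also have "\<dots> = closed_segment q w" by (rule closed_segment_param[OF \<open>0 < \<epsilon>\<close>])
    finally show ?thesis .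
  qed
  ultimately show ?thesis by blast
qed

lemma straightens_near_vertices:
  obtains H s t where "bounded_embedding H"
    "\<And>A. A \<in> edges \<Gamma> \<Longrightarrow> 0 < s A \<and> s A < t A \<and> t A < 1"
    "\<And>A x. A \<in> edges \<Gamma> \<Longrightarrow> x \<in> {s A..t A} \<Longrightarrow> H (\<gamma> A x) = \<gamma> A
        x"
    "\<And>A. A \<in> edges \<Gamma> \<Longrightarrow> H ` \<gamma> A ` {0..s A} = closed_segment (\<gamma> A 0) (\<gamma> A
        (s A))"
    "\<And>A. A \<in> edges \<Gamma> \<Longrightarrow> H ` \<gamma> A ` {t A..1} = closed_segment (\<gamma> A 1) (\<gamma> A
        (t A))"
proof -
  let ?V = "verts \<Gamma>" and ?E = "edges \<Gamma>"
  obtain \<epsilon> where \<epsilon>: "0 < \<epsilon>" and sep: "\<And>q q'. q \<in> ?V \<Longrightarrow> q' \<in> ?V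
      \<Longrightarrow> q' \<noteq> q \<Longrightarrow> 2 * \<epsilon> < dist q q'"
    and far: "\<And>q A z. q \<in> ?V \<Longrightarrow> A \<in> ?E \<Longrightarrow> q \<notin> A \<Longrightarrow> z \<in>
        A \<Longrightarrow> \<epsilon> < dist q z"
    using vertex_separation by metis
  have "\<forall>q\<in>?V. \<exists>h. bounded_embedding h \<and> (\<forall>x. x \<notin> ball q \<epsilon>
      \<longrightarrow> h x = x) \<and>
    (\<forall>A\<in>edges_at \<Gamma> q. \<forall>w\<in>A. dist q w = \<epsilon> \<longrightarrow> h ` (A \<inter> cball q
        \<epsilon>) = closed_segment q w)"
    using straightens_near_vertex[OF \<epsilon> _ sep] by blast
  then obtain h where h: "\<forall>q\<in>?V. bounded_embedding (h q) \<and> (\<forall>x. x \<notin> ball q \<epsilon>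
      \<longrightarrow> h q x = x) \<and>
    (\<forall>A\<in>edges_at \<Gamma> q. \<forall>w\<in>A. dist q w = \<epsilon> \<longrightarrow> h q ` (A \<inter> cball q
        \<epsilon>) = closed_segment q w)"
    by metis
  obtain H where H: "bounded_embedding H" "\<And>q x. q \<in> ?V \<Longrightarrow> x \<in> ball q \<epsilon>
      \<Longrightarrow> H x = h q x"
    "\<And>x. x \<notin> (\<Union>q\<in>?V. ball q \<epsilon>) \<Longrightarrow> H x = x"
  proof (rule bounded_embedding_disjoint_sum[of ?V h "\<lambda>q. ball q \<epsilon>"])
    show "ball q \<epsilon> \<inter> ball q' \<epsilon> = {}" if "q \<in> ?V" "q' \<in> ?V" "q \<noteq> q'" for q q'
      using sep[OF that(1,2)] that(3) by (intro disjoint_ballI) auto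
  qed (use finite_graph h in auto)
  \<comment> \<open>On the sphere both maps are the identity, so \<open>h q\<close> describes
    \<open>H\<close> on the closed ball too; the end of the straight segment lies on the
    sphere.\<close>
  have Hq: "H x = h q x" if q: "q \<in> ?V" and x: "x \<in> cball q \<epsilon>" for q x
  proof (cases "x \<in> ball q \<epsilon>")
    case False
    then have "dist q x = \<epsilon>" using x by simp
    have "x \<notin> ball q' \<epsilon>" if "q' \<in> ?V" for q'
    proof (cases "q' = q")
      case False
      then show ?thesis using sep[OF q that] dist_triangle[of q q' x] \<open>dist q x = \<epsilon>\<close> by (simp add:
          dist_commute)
    qed (use \<open>x \<notin> ball q \<epsilon>\<close> in simp)
    then have "H x = x" using H(3) by blast
    then show ?thesis using h q False by simp
  qed (use H(2) q in blast)
  have Hend: "H ` (A \<inter> cball q \<epsilon>) = closed_segment q w"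
    if "A \<in> ?E" "q \<in> endpoints A" "w \<in> A" "dist q w = \<epsilon>" for A q w
  proof -
    have q: "q \<in> ?V" using edge_Int_verts[OF that(1)] that(2) by blast
    have "H ` (A \<inter> cball q \<epsilon>) = h q ` (A \<inter> cball q \<epsilon>)" using Hq[OF q] by (intro image_cong)
        auto
    then show ?thesis using h q that by (simp add: edges_at_def)
  qed
  have "\<exists>s t. 0 < s \<and> s < t \<and> t < 1 \<and> dist (\<gamma> A 0) (\<gamma> A s) = \<epsilon> \<and> dist
      (\<gamma> A 1) (\<gamma> A t) = \<epsilon>" if A: "A \<in> ?E" for A
  proof -
    have "2 * \<epsilon> < dist (\<gamma> A 0) (\<gamma> A 1)" using sep[OF end_vert[OF A]] ends_ne[OF A] by metis
    from last_exit[OF cont[OF A] \<epsilon> this] show ?thesis by metis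
  qed
  then obtain s t where "\<forall>A\<in>?E. 0 < s A \<and> s A < t A \<and> t A < 1 \<and> dist (\<gamma> A 0) (\<gamma> A
      (s A)) = \<epsilon> \<and> dist (\<gamma> A 1) (\<gamma> A (t A)) = \<epsilon>"
    by metis
  then have st: "0 < s A \<and> s A < t A \<and> t A < 1" and ds: "dist (\<gamma> A 0) (\<gamma> A (s A)) = \<epsilon>" and
      dt: "dist (\<gamma> A 1) (\<gamma> A (t A)) = \<epsilon>"
    if "A \<in> ?E" for A using that by auto
  \<comment> \<open>Monotone distances make the exit times unique: the edge is inside the ball
    exactly during an initial interval, and symmetrically at the other end.\<close>
  have ball0: "dist (\<gamma> A 0) (\<gamma> A x) \<le> \<epsilon> \<longleftrightarrow> x \<le> s A" and ball0': "dist
      (\<gamma> A 0) (\<gamma> A x) < \<epsilon> \<longleftrightarrow> x < s A"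
    if A: "A \<in> ?E" and x: "x \<in> {0..1}" for A x
    using dist_start_mono[OF A, of x "s A"] dist_start_mono[OF A, of "s A" x] st[OF A] ds[OF A] x
    by (cases x "s A" rule: linorder_cases; force)+
  have ball1: "dist (\<gamma> A 1) (\<gamma> A x) \<le> \<epsilon> \<longleftrightarrow> t A \<le> x" and ball1': "dist
      (\<gamma> A 1) (\<gamma> A x) < \<epsilon> \<longleftrightarrow> t A < x"
    if A: "A \<in> ?E" and x: "x \<in> {0..1}" for A x
    using dist_end_mono[OF A, of x "t A"] dist_end_mono[OF A, of "t A" x] st[OF A] dt[OF A] x
    by (cases x "t A" rule: linorder_cases; force)+
  show thesis
  proof (rule that[of H s t])
    show "bounded_embedding H" by (fact H(1))
    fix A assume A: "A \<in> ?E"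
    show "0 < s A \<and> s A < t A \<and> t A < 1" using st[OF A] .
    show "H (\<gamma> A x) = \<gamma> A x" if x: "x \<in> {s A..t A}" for x
    proof (rule H(3), clarify)
      fix q assume q: "q \<in> ?V" and "\<gamma> A x \<in> ball q \<epsilon>"
      then have d: "dist q (\<gamma> A x) < \<epsilon>" by simp
      have x01: "x \<in> {0..1}" using x st[OF A] by auto
      have "q \<in> A" using far[OF q A _ in_edge[OF A x01]] d by force
      then have "q = \<gamma> A 0 \<or> q = \<gamma> A 1" using edge_Int_verts[OF A] ends[OF A] q by blast
      then show False using ball0'[OF A x01] ball1'[OF A x01] d x by auto
    qed
    have "\<gamma> A ` {0..s A} = A \<inter> cball (\<gamma> A 0) \<epsilon>"
      using ball0[OF A] st[OF A] by (subst (3) img'[OF A, symmetric]) auto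
    then show "H ` \<gamma> A ` {0..s A} = closed_segment (\<gamma> A 0) (\<gamma> A (s A))"
      using Hend[OF A _ in_edge[OF A] ds[OF A]] st[OF A] ends[OF A] by auto
    have "\<gamma> A ` {t A..1} = A \<inter> cball (\<gamma> A 1) \<epsilon>"
      using ball1[OF A] st[OF A] by (subst (3) img'[OF A, symmetric]) auto
    then show "H ` \<gamma> A ` {t A..1} = closed_segment (\<gamma> A 1) (\<gamma> A (t A))"
      using Hend[OF A _ in_edge[OF A] dt[OF A]] st[OF A] ends[OF A] by auto
  qed
qed

end

context acute_graph
begin

text \<open>The height in the direction of the chord of the whole edge increases along the edge. So
  the middle arc is a graph over \<open>{a..b}\<close>, and the straight end segments have heights
  at most \<open>a\<close> or at least \<open>b\<close>, where \<open>tube_embedding\<close> moves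
  nothing.\<close>

lemma straightens_middle:
  assumes A: "A \<in> edges \<Gamma>" and st: "0 < s" "s < t" "t < 1" and "0 < \<rho>"
  shows "\<exists>T. bounded_embedding T \<and> polyhedral_set (T ` \<gamma> A ` {s..t}) \<and>
    (\<forall>x. x \<notin> (\<Union>z\<in>\<gamma> A ` {s..t}. cball z \<rho>) \<longrightarrow> T x = x) \<and>
    (\<forall>x\<in>closed_segment (\<gamma> A 0) (\<gamma> A s) \<union> closed_segment (\<gamma> A 1) (\<gamma> A t). T x
        = x)"
proof -
  define u where "u = \<gamma> A 1 - \<gamma> A 0"
  define M where "M = \<gamma> A ` {s..t}"
  have mono: "\<gamma> A x \<bullet> u < \<gamma> A y \<bullet> u" if "0 \<le> x" "x < y" "y \<le> 1" for x y
    using height_mono[OF A that] by (simp add: u_def)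
  have mono': "\<gamma> A x \<bullet> u \<le> \<gamma> A y \<bullet> u" if "0 \<le> x" "x \<le> y" "y \<le> 1" for x y
    using mono[of x y] that by (cases "x = y") auto
  define a b where "a = \<gamma> A s \<bullet> u" and "b = \<gamma> A t \<bullet> u"
  have ab: "a < b" unfolding a_def b_def using mono st by simp
  have contM: "continuous_on {s..t} (\<gamma> A)" using continuous_on_subset[OF cont[OF A]] st by auto
  have compM: "compact M" unfolding M_def using contM by (intro compact_continuous_image) auto
  have contu: "continuous_on M (\<lambda>x. x \<bullet> u)" by (intro continuous_intros)
  have injM: "inj_on (\<lambda>x. x \<bullet> u) M"
  proof (rule inj_onI)
    fix x y assume "x \<in> M" "y \<in> M" and eq: "x \<bullet> u = y \<bullet> u"
    then obtain v w where vw: "v \<in> {s..t}" "w \<in> {s..t}" "x = \<gamma> A v" "y = \<gamma> A w" unfolding M_def by auto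
    then have "v = w" using mono[of v w] mono[of w v] eq st by (cases v w rule: linorder_cases) auto
    then show "x = y" using vw by simp
  qed
  have imgM: "(\<lambda>x. x \<bullet> u) ` M = {a..b}"
  proof
    show "(\<lambda>x. x \<bullet> u) ` M \<subseteq> {a..b}" unfolding M_def a_def b_def using mono' st by auto
    have "connected ((\<lambda>x. x \<bullet> u) ` M)"
      unfolding M_def by (intro connected_continuous_image contM contu[unfolded M_def]) auto
    moreover have "a \<in> (\<lambda>x. x \<bullet> u) ` M" "b \<in> (\<lambda>x. x \<bullet> u) ` M" unfolding M_def a_def
        b_def using st by auto
    ultimately show "{a..b} \<subseteq> (\<lambda>x. x \<bullet> u) ` M" by (rule connected_contains_Icc)
  qed
  obtain f where f: "homeomorphism M {a..b} (\<lambda>x. x \<bullet> u) f"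
    using homeomorphism_compact[OF compM contu imgM injM] by blast
  have fc: "continuous_on {a..b} f" and fM: "f ` {a..b} = M" and fu: "\<And>z. z \<in> {a..b} \<Longrightarrow> f z
      \<bullet> u = z"
    using homeomorphism_cont2[OF f] homeomorphism_image2[OF f] homeomorphism_apply2[OF f] by auto
  \<comment> \<open>\<open>tube_embedding\<close> allows displacements up to half the radius of the
    tube.\<close>
  have "0 < \<rho>/2" using \<open>0 < \<rho>\<close> by simp
  then obtain g where g: "continuous_on {a..b} g" "g a = f a" "g b = f b" "polyhedral_set (g ` {a..b})"
    "\<And>z. z \<in> {a..b} \<Longrightarrow> g z \<bullet> u = z" "\<And>z. z \<in> {a..b} \<Longrightarrow> norm (g z - f
        z) \<le> \<rho>/2"
    using polygonal_approximation[OF _ fc _ fu, of "\<rho>/2"] ab by fastforce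
  obtain T where T: "bounded_embedding T" "\<And>z. z \<in> {a..b} \<Longrightarrow> T (f z) = f z + (g z - f z)"
    "\<And>x. x \<bullet> u \<le> a \<or> b \<le> x \<bullet> u \<Longrightarrow> T x = x" "\<And>x. x \<notin>
        (\<Union>z\<in>{a..b}. cball (f z) \<rho>) \<Longrightarrow> T x = x"
  proof (rule tube_embedding[of a b \<rho> f "\<lambda>z. g z - f z" u])
    show "continuous_on {a..b} (\<lambda>z. g z - f z)" using g(1) fc by (intro continuous_intros)
    show "(g z - f z) \<bullet> u = 0" if "z \<in> {a..b}" for z using g(5)[OF that] fu[OF that] by (simp add:
        inner_diff_left)
  qed (use ab \<open>0 < \<rho>\<close> fc fu g in auto)
  have "T ` M = g ` {a..b}" unfolding fM[symmetric] image_image using T(2) by (intro image_cong) auto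
  moreover have "(\<Union>z\<in>M. cball z \<rho>) = (\<Union>z\<in>{a..b}. cball (f z) \<rho>)" unfolding fM[symmetric] by
      simp
  moreover have "T x = x" if "x \<in> closed_segment (\<gamma> A 0) (\<gamma> A s)" for x
  proof -
    obtain l where l: "0 \<le> l" "l \<le> 1" "x = (1 - l) *\<^sub>R \<gamma> A 0 + l *\<^sub>R \<gamma> A s" using \<open>x
        \<in> _\<close> unfolding in_segment by blast
    have "x \<bullet> u = (1 - l) * (\<gamma> A 0 \<bullet> u) + l * a" unfolding l(3) a_def by (simp add: inner_add_left)
    also have "\<dots> \<le> (1 - l) * a + l * a"
      using l mono'[of 0 s] st unfolding a_def by (intro add_right_mono mult_left_mono) auto
    finally show ?thesis using T(3) by (simp add: algebra_simps)
  qed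
  moreover have "T x = x" if "x \<in> closed_segment (\<gamma> A 1) (\<gamma> A t)" for x
  proof -
    obtain l where l: "0 \<le> l" "l \<le> 1" "x = (1 - l) *\<^sub>R \<gamma> A 1 + l *\<^sub>R \<gamma> A t" using \<open>x
        \<in> _\<close> unfolding in_segment by blast
    have "b = (1 - l) * b + l * b" by (simp add: algebra_simps)
    also have "\<dots> \<le> (1 - l) * (\<gamma> A 1 \<bullet> u) + l * b"
      using l mono'[of t 1] st unfolding b_def by (intro add_right_mono mult_left_mono) auto
    also have "\<dots> = x \<bullet> u" unfolding l(3) b_def by (simp add: inner_add_left)
    finally show ?thesis using T(3) by simp
  qed
  ultimately show ?thesis using T(1,4) g(4) unfolding M_def by (intro exI[of _ T]) auto
qed

lemma straightening:
  "\<exists>h. bounded_embedding h \<and> (\<forall>A\<in>edges \<Gamma>. polyhedral_set (h ` A))"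
proof -
  let ?E = "edges \<Gamma>"
  obtain H s t where H: "bounded_embedding H"
    and st: "\<And>A. A \<in> ?E \<Longrightarrow> 0 < s A \<and> s A < t A \<and> t A < 1"
    and mid: "\<And>A x. A \<in> ?E \<Longrightarrow> x \<in> {s A..t A} \<Longrightarrow> H (\<gamma> A x) = \<gamma> A x"
    and seg0: "\<And>A. A \<in> ?E \<Longrightarrow> H ` \<gamma> A ` {0..s A} = closed_segment (\<gamma> A 0) (\<gamma> A
        (s A))"
    and seg1: "\<And>A. A \<in> ?E \<Longrightarrow> H ` \<gamma> A ` {t A..1} = closed_segment (\<gamma> A 1) (\<gamma> A
        (t A))"
    using straightens_near_vertices by blast
  have contH: "continuous_on UNIV H" and injH: "inj H" using H unfolding bounded_embedding_def by auto
  define M where "M A = \<gamma> A ` {s A..t A}" for A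
  have sub: "{s A..t A} \<subseteq> {0..1}" if "A \<in> ?E" for A using st[OF that] by auto
  have HM: "H ` M A = M A" if "A \<in> ?E" for A using mid[OF that] unfolding M_def by force
  have HA: "H ` A = closed_segment (\<gamma> A 0) (\<gamma> A (s A)) \<union> M A \<union> closed_segment (\<gamma> A 1)
      (\<gamma> A (t A))" if A: "A \<in> ?E" for A
  proof -
    have "{0..s A} \<union> {s A..t A} \<union> {t A..1} = {0..1}" using st[OF A] by auto
    then have "A = \<gamma> A ` ({0..s A} \<union> {s A..t A} \<union> {t A..1})" using img'[OF A] by simp
    then have "H ` A = H ` \<gamma> A ` {0..s A} \<union> H ` M A \<union> H ` \<gamma> A ` {t A..1}" unfolding M_def by
        (metis image_Un)
    then show ?thesis using seg0[OF A] seg1[OF A] HM[OF A] by simp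
  qed
  \<comment> \<open>The tubes must avoid the other edges as they are after straightening near the
    vertices. Since \<open>H\<close> fixes the middle arcs and is injective, these are still
    disjoint from the images of the other edges.\<close>
  have "\<exists>d>0. \<forall>i\<in>{i\<in>?E \<times> ?E. fst i \<noteq> snd i}. \<forall>x\<in>M (fst i).
      \<forall>y\<in>H ` snd i. d < dist x y"
  proof (rule finite_dist_bound)
    fix i assume *: "i \<in> {i\<in>?E \<times> ?E. fst i \<noteq> snd i}"
    obtain A B where AB: "i = (A, B)" by (cases i)
    then have i: "A \<in> ?E" "B \<in> ?E" "A \<noteq> B" using * by simp_all
    have "compact (M A)" unfolding M_def
      using continuous_on_subset[OF cont[OF i(1)] sub[OF i(1)]] by (intro compact_continuous_image) auto
    moreover have "compact (H ` B)"
      using compact_continuous_image[OF continuous_on_subset[OF contH] compact_edge[OF i(2)]] by simp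
    moreover have "M A \<inter> H ` B = {}"
    proof (rule ccontr)
      assume "M A \<inter> H ` B \<noteq> {}"
      then obtain x y where x: "x \<in> {s A..t A}" and y: "y \<in> B" "\<gamma> A x = H y" unfolding M_def by blast
      then have "H (\<gamma> A x) = H y" using mid[OF i(1) x] by simp
      then have eq: "\<gamma> A x = y" using injD[OF injH] by blast
      have x01: "x \<in> {0..1}" using x sub[OF i(1)] by blast
      have "\<gamma> A x \<in> verts \<Gamma>" using edges_meet[OF i in_edge[OF i(1) x01]] eq y by simp
      then show False using vert_time[OF i(1) x01] st[OF i(1)] x by auto
    qed
    ultimately show "compact (M (fst i)) \<and> closed (H ` snd i) \<and> M (fst i) \<inter> H ` snd i = {}"
      unfolding AB by (simp add: compact_imp_closed)
  qed (use finite_graph in simp)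
  then obtain d where d0: "d > 0" "\<forall>i\<in>{i\<in>?E \<times> ?E. fst i \<noteq> snd i}. \<forall>x\<in>M (fst i).
      \<forall>y\<in>H ` snd i. d < dist x y"
    by blast
  have d: "d > 0" "\<And>A B x y. A \<in> ?E \<Longrightarrow> B \<in> ?E \<Longrightarrow> A \<noteq> B \<Longrightarrow> x
      \<in> M A \<Longrightarrow> y \<in> H ` B \<Longrightarrow> d < dist x y"
  proof -
    show "d < dist x y" if "A \<in> ?E" "B \<in> ?E" "A \<noteq> B" "x \<in> M A" "y \<in> H ` B" for A B x y
      using bspec[OF d0(2), of "(A, B)"] that by auto
  qed (fact d0(1))
  \<comment> \<open>With half the distance, tubes of different edges are also disjoint from each
    other.\<close>
  define \<rho> where "\<rho> = d / 2"
  have "0 < \<rho>" using d by (simp add: \<rho>_def)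
  define K where "K A = (\<Union>z\<in>M A. cball z \<rho>)" for A
  have KH: "K A \<inter> H ` B = {}" if "A \<in> ?E" "B \<in> ?E" "A \<noteq> B" for A B
  proof -
    have "\<not> dist x y \<le> \<rho>" if "x \<in> M A" "y \<in> H ` B" for x y
      using d(2)[OF \<open>A \<in> ?E\<close> \<open>B \<in> ?E\<close> \<open>A \<noteq> B\<close> that] d(1) by (simp add:
          \<rho>_def)
    then show ?thesis unfolding K_def by (auto simp: disjoint_iff)
  qed
  have KK: "K A \<inter> K B = {}" if "A \<in> ?E" "B \<in> ?E" "A \<noteq> B" for A B
  proof -
    have False if "x \<in> M A" "y \<in> M B" "dist x z \<le> \<rho>" "dist y z \<le> \<rho>" for x y z
    proof -
      have "d < dist x y" using d(2)[OF \<open>A \<in> ?E\<close> \<open>B \<in> ?E\<close> \<open>A \<noteq> B\<close>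
          that(1)] that(2) HA[OF \<open>B \<in> ?E\<close>] by blast
      then show False using that(3,4) dist_triangle2[of x y z] by (simp add: \<rho>_def)
    qed
    then show ?thesis unfolding K_def by (auto simp: disjoint_iff)
  qed
  define good where "good A T \<longleftrightarrow> bounded_embedding T \<and> polyhedral_set (T ` M A) \<and> (\<forall>x.
      x \<notin> K A \<longrightarrow> T x = x) \<and>
    (\<forall>x\<in>closed_segment (\<gamma> A 0) (\<gamma> A (s A)) \<union> closed_segment (\<gamma> A 1) (\<gamma> A (t
        A)). T x = x)" for A T
  have "\<forall>A\<in>?E. \<exists>T. good A T"
    using straightens_middle[OF _ _ _ _ \<open>0 < \<rho>\<close>] st unfolding good_def K_def M_def by blast
  then obtain T where T: "\<And>A. A \<in> ?E \<Longrightarrow> good A (T A)" by metis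
  obtain G where G: "bounded_embedding G" "\<And>A x. A \<in> ?E \<Longrightarrow> x \<in> K A \<Longrightarrow> G x = T A x"
    "\<And>x. x \<notin> (\<Union>A\<in>?E. K A) \<Longrightarrow> G x = x"
  proof (rule bounded_embedding_disjoint_sum[of ?E T K])
    show "bounded_embedding (T A)" if "A \<in> ?E" for A using T[OF that] by (simp add: good_def)
    show "T A x = x" if "A \<in> ?E" "x \<notin> K A" for A x using T[OF that(1)] that(2) by (simp add: good_def)
  qed (use finite_graph KK in auto)
  have "polyhedral_set (G ` H ` A)" if A: "A \<in> ?E" for A
  proof -
    \<comment> \<open>A point of the straightened edge \<open>A\<close> lies in no tube of another
      edge, so on this edge \<open>G\<close> acts as \<open>T A\<close>.\<close>
    have GT: "G x = T A x" if x: "x \<in> H ` A" for x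
    proof (cases "x \<in> K A")
      case False
      then have "x \<notin> (\<Union>A\<in>?E. K A)" using KH[OF _ A] x by blast
      then show ?thesis using G(3) T[OF A] False by (simp add: good_def)
    qed (use G(2) A in blast)
    have "G ` H ` A = T A ` H ` A" using GT by (intro image_cong) auto
    also have "\<dots> = closed_segment (\<gamma> A 0) (\<gamma> A (s A)) \<union> T A ` M A \<union> closed_segment
        (\<gamma> A 1) (\<gamma> A (t A))"
    proof -
      have "T A ` closed_segment (\<gamma> A 0) (\<gamma> A (s A)) = closed_segment (\<gamma> A 0) (\<gamma> A (s A))"
        "T A ` closed_segment (\<gamma> A 1) (\<gamma> A (t A)) = closed_segment (\<gamma> A 1) (\<gamma> A (t A))"
        using T[OF A] unfolding good_def by (force simp: image_iff)+
      then show ?thesis unfolding HA[OF A] image_Un by simp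
    qed
    finally show ?thesis using T[OF A] by (simp add: good_def polyhedral_set_Un polyhedral_set_segment)
  qed
  then show ?thesis using bounded_embedding_comp[OF H G(1)] by (intro exI[of _ "\<lambda>x. G (H x)"]) (simp add:
      image_image)
qed

end

section \<open>Tameness from polyhedral images of the edges\<close>

lemma (in parametrized_graph) tame_if_polyhedral_image:
  assumes h: "bounded_embedding h" and pl: "\<And>A. A \<in> edges \<Gamma> \<Longrightarrow> polyhedral_set (h ` A)"
  shows "tame \<Gamma>"
proof -
  have conth: "continuous_on UNIV h" and injh: "inj h" using h unfolding bounded_embedding_def by auto
  define Q where "Q = \<lparr>verts = h ` verts \<Gamma>, edges = (\<lambda>A. h ` A) ` edges \<Gamma>\<rparr>"
  have ends': "simple_arc (h ` A) \<and> endpoints (h ` A) = h ` endpoints A" if A: "A \<in> edges \<Gamma>" for A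
  proof -
    have a: "arc (h \<circ> \<gamma> A)"
      unfolding arc_def
    proof
      show "path (h \<circ> \<gamma> A)"
        using path_continuous_image[OF arc_imp_path[OF arc[OF A]]] continuous_on_subset[OF conth] by blast
      show "inj_on (h \<circ> \<gamma> A) {0..1}"
        using comp_inj_on[OF arc_imp_inj_on[OF arc[OF A]]] inj_on_subset[OF injh] by blast
    qed
    moreover have "path_image (h \<circ> \<gamma> A) = h ` A" using img[OF A] by (simp add: path_image_compose)
    ultimately show ?thesis using endpoints_path_image[OF a] ends[OF A] unfolding simple_arc_def
      by (auto simp: pathstart_def pathfinish_def)
  qed
  have Int: "h ` X \<inter> h ` Y = h ` (X \<inter> Y)" for X Y using image_Int[OF injh] by metis
  have "continuous_graph Q" unfolding continuous_graph_def
  proof (intro conjI ballI impI)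
    show "finite (verts Q)" "finite (edges Q)" using finite_graph by (simp_all add: Q_def)
    show "verts Q \<noteq> {}" using graph by (simp add: Q_def continuous_graph_def)
    have "support Q = h ` support \<Gamma>" by (auto simp: support_def Q_def)
    moreover have "connected (support \<Gamma>)" using graph by (simp add: continuous_graph_def)
    ultimately show "connected (support Q)"
      using connected_continuous_image[OF continuous_on_subset[OF conth]] by simp
    fix C assume "C \<in> edges Q"
    then obtain A where A: "A \<in> edges \<Gamma>" "C = h ` A" by (auto simp: Q_def)
    show "simple_arc C" using ends'[OF A(1)] A(2) by simp
    show "C \<inter> verts Q = endpoints C"
      using ends'[OF A(1)] A(2) Int[of A "verts \<Gamma>"] edge_Int_verts[OF A(1)] by (simp add: Q_def)
    fix D assume D: "D \<in> edges Q" "C \<noteq> D"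
    then obtain B where B: "B \<in> edges \<Gamma>" "D = h ` B" by (auto simp: Q_def)
    have "A \<inter> B \<subseteq> endpoints A \<inter> endpoints B"
      using graph A(1) B(1) D(2) A(2) B(2) unfolding continuous_graph_def by metis
    then have "h ` (A \<inter> B) \<subseteq> h ` (endpoints A \<inter> endpoints B)" by (rule image_mono)
    then show "C \<inter> D \<subseteq> endpoints C \<inter> endpoints D"
      using ends'[OF A(1)] ends'[OF B(1)] A(2) B(2) Int by simp
  qed
  then have "polyhedral_graph Q"
    using pl unfolding polyhedral_graph_def polyhedral_set_def by (auto simp: Q_def)
  moreover obtain H where "ambient_isotopy H" "H 1 = h" using bounded_embedding_ambient_isotopy[OF h] by blast
  then have "isotopic \<Gamma> Q" unfolding isotopic_def by (auto simp: Q_def)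
  ultimately show ?thesis unfolding tame_def by blast
qed

text \<open>Increasing reparametrizations preserve acuteness, so a piece may be rescaled to
  \<open>{0..1}\<close>.\<close>

lemma (in subdivided_graph) refined_acute:
  assumes ac: "\<And>A i. A \<in> edges \<Gamma> \<Longrightarrow> i < n A \<Longrightarrow> acute_on (\<tau> A i) (\<tau> A
      (Suc i)) (\<gamma> A)"
  shows "\<exists>\<gamma>'. acute_graph refined \<gamma>'"
proof -
  have "\<exists>g. arc g \<and> path_image g = C \<and> acute_on 0 1 g" if C0: "C \<in> edges refined" for C
  proof -
    obtain A i where C: "C = piece A i" "A \<in> edges \<Gamma>" "i < n A" using C0 by (auto simp: refined_def)
    let ?a = "\<tau> A i" and ?b = "\<tau> A (Suc i)"
    define g where "g = subpath ?a ?b (\<gamma> A)"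
    have ab: "0 \<le> ?a" "?a < ?b" "?b \<le> 1" using \<tau>_range[OF C(2), of i] \<tau>_range[OF C(2), of "Suc i"]
        \<tau>_Suc[OF C(2,3)] C(3) by auto
    have "arc g" unfolding g_def using ab by (intro arc_subpath_arc arc C) auto
    moreover have "path_image g = C" using ab C(1) by (simp add: g_def path_image_subpath piece_def)
    moreover have "acute_on 0 1 g" unfolding acute_on_def
    proof (intro allI impI)
      fix s t s' t' :: real assume st: "0 \<le> s" "s \<le> t" "t \<le> 1" "0 \<le> s'" "s' \<le> t'" "t' \<le> 1"
      define \<phi> where "\<phi> x = (?b - ?a) * x + ?a" for x
      have mono: "\<phi> x \<le> \<phi> y" if "x \<le> y" for x y using that ab by (simp add: \<phi>_def mult_left_mono)
      have e: "\<phi> 0 = ?a" "\<phi> 1 = ?b" by (simp_all add: \<phi>_def)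
      have "norm (\<gamma> A (\<phi> t) - \<gamma> A (\<phi> s)) * norm (\<gamma> A (\<phi> t') - \<gamma> A (\<phi> s'))
        \<le> 2 * ((\<gamma> A (\<phi> t) - \<gamma> A (\<phi> s)) \<bullet> (\<gamma> A (\<phi> t') - \<gamma> A (\<phi>
            s')))"
        by (rule ac[OF C(2,3), unfolded acute_on_def, rule_format]) (use st mono e in metis)+
      then show "norm (g t - g s) * norm (g t' - g s') \<le> 2 * ((g t - g s) \<bullet> (g t' - g s'))"
        by (simp add: g_def subpath_def \<phi>_def)
    qed
    ultimately show ?thesis by blast
  qed
  then obtain \<gamma>' where "\<forall>C\<in>edges refined. arc (\<gamma>' C) \<and> path_image (\<gamma>' C) = C \<and>
      acute_on 0 1 (\<gamma>' C)" by metis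
  then have "acute_graph refined \<gamma>'" using refined_graph by unfold_locales auto
  then show ?thesis by blast
qed

theorem corollary4:
  fixes c :: "nat \<Rightarrow> (nat \<Rightarrow> real^3) \<Rightarrow> real" and \<Gamma> :: space_graph
  assumes "curvature_notion c"
    and "continuous_graph \<Gamma>"
    and "total_curvature c \<Gamma> < \<infinity>"
  shows "tame \<Gamma>"
proof -
  obtain \<gamma> where "parametrized_graph \<Gamma> \<gamma>" using continuous_graph_parametrized[OF assms(2)] .
  then interpret parametrized_graph \<Gamma> \<gamma> .
  obtain n \<tau> where "subdivided_graph \<Gamma> \<gamma> n \<tau>"
    and ac: "\<forall>A\<in>edges \<Gamma>. \<forall>i<n A. acute_on (\<tau> A i) (\<tau> A (Suc i)) (\<gamma> A)"
    using acute_subdivision[OF assms(1,3)] by blast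
  then interpret S: subdivided_graph \<Gamma> \<gamma> n \<tau> by simp
  obtain \<gamma>' where "acute_graph S.refined \<gamma>'" using S.refined_acute ac by blast
  from acute_graph.straightening[OF this] obtain h where h: "bounded_embedding h"
    "\<forall>C\<in>edges S.refined. polyhedral_set (h ` C)" by blast
  show ?thesis
  proof (rule tame_if_polyhedral_image[OF h(1)])
    fix A assume A: "A \<in> edges \<Gamma>"
    \<comment> \<open>The isotopy has to carry the edges of \<open>\<Gamma>\<close>, not their
      pieces, to edges. A polyhedral edge may consist of several segments, so the straightened
      pieces are put together again.\<close>
    have "polyhedral_set (\<Union>i\<in>{..<n A}. h ` S.piece A i)"
      using h(2) A by (intro polyhedral_set_UN) (auto simp: S.refined_def)
    then show "polyhedral_set (h ` A)" using S.pieces_cover[OF A] by (metis image_UN)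
  qed
qed

end
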